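(* For any $0<\theta<\frac12$, one has the convergence in distribution, as $n\to\infty$, $$\frac{c_n}{\sqrt{\mathbb{E}(|c_n|^2)}}\ \overset{d}{\longrightarrow}\ \sqrt{\mathcal M_\theta}\,\mathcal Z,$$ where $\mathcal Z$ and $\mathcal M_\theta$ are independent, $\mathcal Z$ is a standard complex normal random variable, and $\mathcal M_\theta$ has the law of the total mass of the Gaussian multiplicative chaos $\mathrm{GMC}_\theta$ normalized by $\frac{1}{2\pi}$.
   Context: Let $(\mathcal N_k)_{k\ge1}$ be i.i.d. standard complex normal random variables ($\mathbb{E}\mathcal N_k=0$, $\mathbb{E}\mathcal N_k^2=0$, $\mathbb{E}|\mathcal N_k|^2=1$) and let $G^{\mathbb C}(z)=\sum_{k\ge1}\frac{z^k}{\sqrt k}\mathcal N_k$, $G(z)=2\,\mathrm{Re}\,G^{\mathbb C}(z)$ for $|z|<1$. For $\theta>0$ and $n\ge0$, $c_n$ is the coefficient of $z^n$ in the power series expansion of $e^{\sqrt\theta G^{\mathbb C}(z)}$ at $z=0$. For $\theta\in(0,1)$, $\mathrm{GMC}_\theta$ is the random measure on $[0,2\pi)$ given by $\mathrm{GMC}_\theta(d\vartheta)=\lim_{r\to1^-}(1-r^2)^\theta e^{\sqrt\theta G(re^{i\vartheta})}d\vartheta$ (limit in probability in the weak-* sense), and $\mathcal M_\theta=\frac1{2\pi}\int_0^{2\pi}\mathrm{GMC}_\theta(d\vartheta)$. Its law is known explicitly: $\mathbb{E}(\mathcal M_\theta^p)=\Gamma(1-p\theta)/\Gamma(1-\theta)^p$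 for $p>0$ with $p\theta<1$, and $\mathcal M_\theta$ is equal in law to $\mathcal E(1)^{-\theta}/\Gamma(1-\theta)$, where $\mathcal E(1)$ is an exponential random variable with parameter $1$. *)

theory Defs
  imports "HOL-Probability.Probability" "HOL-Complex_Analysis.Complex_Analysis"
begin

definition converges_in_distribution ::
  "'a measure \<Rightarrow> (nat \<Rightarrow> 'a \<Rightarrow> 'c::topological_space) \<Rightarrow> 'b measure \<Rightarrow> ('b \<Rightarrow> 'c) \<Rightarrow> bool" where
  "converges_in_distribution P X Q Y \<longleftrightarrow>
     (\<forall>n. X n \<in> borel_measurable P) \<and> Y \<in> borel_measurable Q \<and>
     (\<forall>f :: 'c \<Rightarrow> real. continuous_on UNIV f \<longrightarrow> bounded (range f) \<longrightarrow>
        (\<lambda>n. \<integral>\<omega>. f (X n \<omega>) \<partial>P) \<longlonglongrightarrow> (\<integral>\<omega>. f (Y \<omega>) \<partial>Q))"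

definition converges_in_probability ::
  "'a measure \<Rightarrow> ('i \<Rightarrow> 'a \<Rightarrow> real) \<Rightarrow> ('a \<Rightarrow> real) \<Rightarrow> 'i filter \<Rightarrow> bool" where
  "converges_in_probability P X Y F \<longleftrightarrow>
     (\<forall>\<epsilon>>0. ((\<lambda>i. measure P {\<omega> \<in> space P. \<epsilon> < \<bar>X i \<omega> - Y \<omega>\<bar>}) \<longlongrightarrow> 0) F)"

(* The real and imaginary parts are independent centred real Gaussians of variance 1/2, i.e.
   E Z = 0, E Z^2 = 0, E |Z|^2 = 1. The second argument of normal_density is the standard
   deviation. *)
definition std_complex_normal :: "'a measure \<Rightarrow> ('a \<Rightarrow> complex) \<Rightarrow> bool" where
  "std_complex_normal P Z \<longleftrightarrow>
     Z \<in> borel_measurable P \<and>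
     prob_space.indep_var P borel (\<lambda>\<omega>. Re (Z \<omega>)) borel (\<lambda>\<omega>. Im (Z \<omega>)) \<and>
     distributed P lborel (\<lambda>\<omega>. Re (Z \<omega>)) (\<lambda>x. ennreal (normal_density 0 (sqrt (1/2)) x)) \<and>
     distributed P lborel (\<lambda>\<omega>. Im (Z \<omega>)) (\<lambda>x. ennreal (normal_density 0 (sqrt (1/2)) x))"

(* The index set is k >= 1; the value N 0 is never used. *)
definition iid_std_complex_normal :: "'a measure \<Rightarrow> (nat \<Rightarrow> 'a \<Rightarrow> complex) \<Rightarrow> bool" where
  "iid_std_complex_normal P N \<longleftrightarrow>
     prob_space.indep_vars P (\<lambda>_. borel) N {1..} \<and> (\<forall>k\<ge>1. std_complex_normal P (N k))"

definition GC :: "(nat \<Rightarrow> 'a \<Rightarrow> complex) \<Rightarrow> 'a \<Rightarrow> complex \<Rightarrow> complex" where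
  "GC N \<omega> z = (\<Sum>k. z ^ Suc k / complex_of_real (sqrt (real (Suc k))) * N (Suc k) \<omega>)"

definition G_field :: "(nat \<Rightarrow> 'a \<Rightarrow> complex) \<Rightarrow> 'a \<Rightarrow> complex \<Rightarrow> real" where
  "G_field N \<omega> z = 2 * Re (GC N \<omega> z)"

definition secular_coeff ::
  "(nat \<Rightarrow> 'a \<Rightarrow> complex) \<Rightarrow> real \<Rightarrow> nat \<Rightarrow> 'a \<Rightarrow> complex" where
  "secular_coeff N \<theta> n \<omega> =
     fps_nth (fps_expansion (\<lambda>z. exp (complex_of_real (sqrt \<theta>) * GC N \<omega> z)) 0) n"

definition GMC_approx ::
  "(nat \<Rightarrow> 'a \<Rightarrow> complex) \<Rightarrow> real \<Rightarrow> real \<Rightarrow> 'a \<Rightarrow> real measure" where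
  "GMC_approx N \<theta> r \<omega> =
     density (restrict_space lborel {0..<2 * pi})
       (\<lambda>\<phi>. ennreal ((1 - r\<^sup>2) powr \<theta> * exp (sqrt \<theta> * G_field N \<omega> (complex_of_real r * cis \<phi>))))"

definition random_finite_measure ::
  "'a measure \<Rightarrow> 'c measure \<Rightarrow> ('a \<Rightarrow> 'c measure) \<Rightarrow> bool" where
  "random_finite_measure P S \<mu> \<longleftrightarrow>
     (\<forall>\<omega>\<in>space P. sets (\<mu> \<omega>) = sets S \<and> finite_measure (\<mu> \<omega>)) \<and>
     (\<forall>A\<in>sets S. (\<lambda>\<omega>. emeasure (\<mu> \<omega>) A) \<in> borel_measurable P)"

(* Weak-* convergence of measures on [0, 2 pi), identified with the unit circle: the test
   functions are the continuous functions of e^(i phi). *)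
definition is_GMC ::
  "'a measure \<Rightarrow> (nat \<Rightarrow> 'a \<Rightarrow> complex) \<Rightarrow> real \<Rightarrow> ('a \<Rightarrow> real measure) \<Rightarrow> bool" where
  "is_GMC P N \<theta> \<mu> \<longleftrightarrow>
     random_finite_measure P (restrict_space borel {0..<2 * pi}) \<mu> \<and>
     (\<forall>f :: complex \<Rightarrow> real. continuous_on (sphere 0 1) f \<longrightarrow>
        converges_in_probability P
          (\<lambda>r \<omega>. \<integral>\<phi>. f (cis \<phi>) \<partial>GMC_approx N \<theta> r \<omega>)
          (\<lambda>\<omega>. \<integral>\<phi>. f (cis \<phi>) \<partial>\<mu> \<omega>) (at_left 1))"

definition GMC_mass :: "('a \<Rightarrow> real measure) \<Rightarrow> 'a \<Rightarrow> real" where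
  "GMC_mass \<mu> \<omega> = measure (\<mu> \<omega>) {0..<2 * pi} / (2 * pi)"

(* Independence of two random variables of different types, which the library's indep_var
   does not cover: the generated sigma-algebras are independent. *)
definition indep_rvs ::
  "'a measure \<Rightarrow> ('a \<Rightarrow> 'c::topological_space) \<Rightarrow> ('a \<Rightarrow> 'd::topological_space) \<Rightarrow> bool" where
  "indep_rvs P X Y \<longleftrightarrow>
     X \<in> borel_measurable P \<and> Y \<in> borel_measurable P \<and>
     prob_space.indep_set P (sets (vimage_algebra (space P) X borel))
       (sets (vimage_algebra (space P) Y borel))"

end

(* With V_n = (theta/n) * (sum of |c_j|^2 over j < n), Gaussian integration by parts together with the
   Euler identity n c_n = sqrt theta * sum_{k=1..n} sqrt k N_k c_{n-k} gives, with dbar the derivative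
   in the conjugate variable, the exact identity E[c_n f(c_n)] = E[V_n dbar f(c_n)]:
   V_n is a Stein kernel of c_n. By Parseval the GMC hypothesis, tested against the constant 1, says that
   (1 - r^2)^theta * sum_j |c_j|^2 r^(2j) converges in probability to the total mass M; for
   theta < 1/2 these variables are bounded in L^2, so the convergence is in L^1, and
   Karamata's Tauberian argument turns it into V_n / E|c_n|^2 --> M in L^1. Interpolating along
   s |-> E[exp(i s Re(conj xi X_n)) exp(-(1 - s^2) |xi|^2 M_m / 4)] for the normalised
   X_n = c_n / sqrt(E|c_n|^2) and M_m = V_m / E|c_m|^2, the Stein identity
   shows that the derivative in s vanishes in the limit n --> infinity, then m --> infinity, so the
   characteristic function of X_n tends to E[exp(-|xi|^2 M / 4)], that of sqrt M * Z. *)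
theory Submission
  imports Defs
begin

section \<open>Gaussian integration by parts\<close>

text \<open>The exponent carries M_m with m fixed because the limit M is not a function of finitely
  many Gaussians, so integration by parts cannot act on it. Differentiating M_m yields only terms
  with k <= j < m, a number independent of n; after normalisation they are O(1 / (n
  sqrt(E|c_n|^2))), which is O(n^(-1/2)). This is why n tends to infinity before m. The constant
  |xi|^2 / 4 comes from E exp(i Re(conj xi Z)) = exp(-|xi|^2 / 4), and the profile 1 - s^2 lets the
  derivative of the damping cancel the Stein term. The L^2 bound is a fourth-moment computation.
  E(c_a conj(c_b) c_e conj(c_d)) is a sum over 2 by 2 tables with row sums a, e and column sums b,
  d, each weighted by the product of E|c_k|^2 over its entries. Since E|c_k|^2 is of order
  k^(\<theta> - 1), the resulting bound needs these numbers to be square summable, and this is the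
  condition \<theta> < 1/2. The coefficients are handled as explicit polynomials in the Gaussians;
  they are matched with the power series only almost surely, since on a null set the series may have
  radius of convergence zero.\<close>

definition poly_growth :: "('a::real_normed_vector \<Rightarrow> complex) \<Rightarrow> bool" where
  "poly_growth f \<longleftrightarrow> continuous_on UNIV f \<and> (\<exists>C d. \<forall>y. norm (f y) \<le> C * (1 + norm y) ^ d)"

lemma poly_growthI:
  "continuous_on UNIV f \<Longrightarrow> (\<And>y. norm (f y) \<le> C * (1 + norm y) ^ d) \<Longrightarrow> poly_growth f"
  unfolding poly_growth_def by blast

lemma poly_growthE:
  assumes "poly_growth f"
  obtains C d where "C \<ge> 0" "\<And>y. norm (f y) \<le> C * (1 + norm y) ^ d"
proof -
  obtain C d where *: "\<And>y. norm (f y) \<le> C * (1 + norm y) ^ d"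
    using assms unfolding poly_growth_def by blast
  from *[of 0] have "C \<ge> 0" by (smt (verit) norm_ge_zero norm_zero mult_cancel_left1 power_one)
  with * that show ?thesis by blast
qed

lemma poly_growth_const [intro, simp]: "poly_growth (\<lambda>_. c)"
  by (rule poly_growthI[where C = "norm c" and d = 0]) auto

lemma poly_growth_id: "poly_growth (\<lambda>y. y)"
  by (rule poly_growthI[where C = 1 and d = 1]) auto

lemma poly_growth_add:
  assumes "poly_growth f" "poly_growth g" shows "poly_growth (\<lambda>y. f y + g y)"
proof -
  obtain C d where f: "C \<ge> 0" "\<And>y. norm (f y) \<le> C * (1 + norm y) ^ d" using poly_growthE[OF assms(1)] by blast
  obtain C' d' where g: "C' \<ge> 0" "\<And>y. norm (g y) \<le> C' * (1 + norm y) ^ d'" using poly_growthE[OF assms(2)] by blast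
  show ?thesis
  proof (rule poly_growthI[where C = "C + C'" and d = "d + d'"])
    show "continuous_on UNIV (\<lambda>y. f y + g y)"
      using assms unfolding poly_growth_def by (intro continuous_intros) auto
    fix y
    have "norm (f y + g y) \<le> C * (1 + norm y) ^ d + C' * (1 + norm y) ^ d'"
      using f(2)[of y] g(2)[of y] norm_triangle_ineq[of "f y" "g y"] by linarith
    also have "\<dots> \<le> C * (1 + norm y) ^ (d + d') + C' * (1 + norm y) ^ (d + d')"
      by (intro add_mono mult_left_mono power_increasing f g) auto
    finally show "norm (f y + g y) \<le> (C + C') * (1 + norm y) ^ (d + d')" by (simp add: algebra_simps)
  qed
qed

lemma poly_growth_mult:
  assumes "poly_growth f" "poly_growth g" shows "poly_growth (\<lambda>y. f y * g y)"
proof -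
  obtain C d where f: "C \<ge> 0" "\<And>y. norm (f y) \<le> C * (1 + norm y) ^ d" using poly_growthE[OF assms(1)] by blast
  obtain C' d' where g: "C' \<ge> 0" "\<And>y. norm (g y) \<le> C' * (1 + norm y) ^ d'" using poly_growthE[OF assms(2)] by blast
  show ?thesis
  proof (rule poly_growthI[where C = "C * C'" and d = "d + d'"])
    show "continuous_on UNIV (\<lambda>y. f y * g y)"
      using assms unfolding poly_growth_def by (intro continuous_intros) auto
    fix y
    have "norm (f y * g y) \<le> (C * (1 + norm y) ^ d) * (C' * (1 + norm y) ^ d')"
      unfolding norm_mult by (intro mult_mono f g) (use f in auto)
    then show "norm (f y * g y) \<le> (C * C') * (1 + norm y) ^ (d + d')" by (simp add: algebra_simps power_add)
  qed
qed

lemma poly_growth_cnj: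
  assumes "poly_growth f" shows "poly_growth (\<lambda>y. cnj (f y))"
  using assms unfolding poly_growth_def by (auto intro: continuous_intros)

lemma poly_growth_compose:
  assumes "poly_growth f" "continuous_on UNIV h" "\<And>y. norm (h y) \<le> C * (1 + norm y)" "C \<ge> 1"
  shows "poly_growth (\<lambda>y. f (h y))"
proof -
  obtain D d where f: "D \<ge> 0" "\<And>y. norm (f y) \<le> D * (1 + norm y) ^ d" using poly_growthE[OF assms(1)] by blast
  show ?thesis
  proof (rule poly_growthI[where C = "D * (2 * C) ^ d" and d = d])
    show "continuous_on UNIV (\<lambda>y. f (h y))"
      using assms unfolding poly_growth_def by (auto intro: continuous_on_compose2)
    fix y
    have "1 + norm (h y) \<le> 1 + C * (1 + norm y)" using assms(3)[of y] by auto
    also have "\<dots> \<le> 2 * C * (1 + norm y)"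
      using mult_mono[of 1 C 1 "1 + norm y"] assms(4) by simp
    finally have le: "1 + norm (h y) \<le> 2 * C * (1 + norm y)" .
    have "norm (f (h y)) \<le> D * (1 + norm (h y)) ^ d" by (rule f)
    also have "\<dots> \<le> D * (2 * C * (1 + norm y)) ^ d"
      by (intro mult_left_mono power_mono le f) auto
    finally show "norm (f (h y)) \<le> D * (2 * C) ^ d * (1 + norm y) ^ d" by (simp add: power_mult_distrib)
  qed
qed

section \<open>One-dimensional Gaussian integrals of functions of polynomial growth\<close>

abbreviation gdens :: "real \<Rightarrow> real" where "gdens \<equiv> normal_density 0 (sqrt (1/2))"

text \<open>The even exponent matters: |x|^(2d) = x^(2d), so growth bounds reduce to the plain
  Gaussian moments of \<open>integrable_normal_moment\<close>.\<close>

lemma one_add_power_le: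
  fixes t :: real assumes "t \<ge> 0" shows "(1 + t) ^ d \<le> 2 ^ d * (2 + t ^ (2 * d))"
proof (cases "t \<le> 1")
  case True
  then have "(1 + t) ^ d \<le> 2 ^ d" using assms by (intro power_mono) auto
  also have "\<dots> \<le> 2 ^ d * (2 + t ^ (2 * d))" using assms by (auto intro: add_nonneg_nonneg add_increasing2)
  finally show ?thesis .
next
  case False
  then have "(1 + t) ^ d \<le> (2 * t) ^ d" by (intro power_mono) auto
  also have "\<dots> = 2 ^ d * t ^ d" by (simp add: power_mult_distrib)
  also have "\<dots> \<le> 2 ^ d * (2 + t ^ (2 * d))"
  proof -
    have "t ^ d \<le> t ^ (2 * d)" using False by (intro power_increasing) auto
    then show ?thesis by (intro mult_left_mono) auto
  qed
  finally show ?thesis .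
qed

lemma integrable_gdens_growth: "integrable lborel (\<lambda>x. gdens x * (1 + \<bar>x\<bar>) ^ d)"
proof (rule Bochner_Integration.integrable_bound)
  show "integrable lborel (\<lambda>x. 2 ^ d * (2 * (gdens x * (x - 0) ^ 0) + gdens x * (x - 0) ^ (2 * d)))"
    by (intro integrable_mult_right Bochner_Integration.integrable_add integrable_normal_moment) simp_all
  show "AE x in lborel. norm (gdens x * (1 + \<bar>x\<bar>) ^ d) \<le> norm (2 ^ d * (2 * (gdens x * (x - 0) ^ 0) + gdens x * (x - 0) ^ (2 * d)))"
  proof (rule AE_I2)
    fix x :: real
    have "gdens x * (1 + \<bar>x\<bar>) ^ d \<le> gdens x * (2 ^ d * (2 + \<bar>x\<bar> ^ (2 * d)))"
      by (intro mult_left_mono one_add_power_le) auto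
    also have "\<dots> = 2 ^ d * (2 * (gdens x * (x - 0) ^ 0) + gdens x * (x - 0) ^ (2 * d))"
      by (simp add: algebra_simps power_even_abs del: power_mult)
    finally show "norm (gdens x * (1 + \<bar>x\<bar>) ^ d) \<le> norm (2 ^ d * (2 * (gdens x * (x - 0) ^ 0) + gdens x * (x - 0) ^ (2 * d)))"
      by (auto simp: abs_mult)
  qed
qed auto

lemma poly_growth_measurable: "poly_growth f \<Longrightarrow> f \<in> borel_measurable borel"
  unfolding poly_growth_def by (auto intro: borel_measurable_continuous_onI)

lemma integrable_gdens_poly_growth:
  fixes f :: "real \<Rightarrow> complex" assumes "poly_growth f"
  shows "integrable lborel (\<lambda>x. gdens x *\<^sub>R f x)"
proof -
  obtain C d where f: "C \<ge> 0" "\<And>y. norm (f y) \<le> C * (1 + norm y) ^ d" using poly_growthE[OF assms] by blast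
  note [measurable] = poly_growth_measurable[OF assms]
  show ?thesis
  proof (rule Bochner_Integration.integrable_bound)
    show "integrable lborel (\<lambda>x. C * (gdens x * (1 + \<bar>x\<bar>) ^ d))"
      by (intro integrable_mult_right integrable_gdens_growth)
    show "AE x in lborel. norm (gdens x *\<^sub>R f x) \<le> norm (C * (gdens x * (1 + \<bar>x\<bar>) ^ d))"
    proof (rule AE_I2)
      fix x :: real
      have "gdens x * norm (f x) \<le> gdens x * (C * (1 + \<bar>x\<bar>) ^ d)"
        using f(2)[of x] by (intro mult_left_mono) auto
      then show "norm (gdens x *\<^sub>R f x) \<le> norm (C * (gdens x * (1 + \<bar>x\<bar>) ^ d))"
        using f(1) by (simp add: abs_mult mult_ac)
    qed
  qed auto
qed

lemma DERIV_gdens: "(gdens has_real_derivative (- 2 * x * gdens x)) (at x)"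
  unfolding normal_density_def by (auto intro!: derivative_eq_intros simp: field_simps power2_eq_square)

lemma gdens_growth_tendsto:
  assumes "F = at_top \<or> F = at_bot"
  shows "((\<lambda>x. gdens x * (1 + \<bar>x\<bar>) ^ d) \<longlongrightarrow> 0) F"
proof -
  have top: "((\<lambda>x::real. exp (- (x\<^sup>2)) * (1 + \<bar>x\<bar>) ^ d) \<longlongrightarrow> 0) at_top"
    by real_asymp
  have bot: "((\<lambda>x::real. exp (- (x\<^sup>2)) * (1 + \<bar>x\<bar>) ^ d) \<longlongrightarrow> 0) at_bot"
    using top unfolding filterlim_at_bot_mirror by simp
  have "((\<lambda>x::real. (1 / sqrt pi) * (exp (- (x\<^sup>2)) * (1 + \<bar>x\<bar>) ^ d)) \<longlongrightarrow> (1 / sqrt pi) * 0) F"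
    using top bot assms by (intro tendsto_mult tendsto_const) auto
  then show ?thesis by (simp add: normal_density_def)
qed

text \<open>The variance is 1/2, so the density has derivative -2x times itself; this is the origin
  of the factor 1/2. The fundamental theorem of calculus on the whole line is applied to the density
  times \<open>g\<close>, whose boundary values vanish because \<open>g\<close> grows at most
  polynomially.\<close>

lemma gaussian_ibp_real:
  fixes g g' :: "real \<Rightarrow> complex"
  assumes g: "poly_growth g" and g': "poly_growth g'"
    and der: "\<And>x. (g has_vector_derivative g' x) (at x)"
  shows "(\<integral>x. gdens x *\<^sub>R (of_real x * g x) \<partial>lborel) = (1/2) * (\<integral>x. gdens x *\<^sub>R g' x \<partial>lborel)"
proof -
  have xg: "poly_growth (\<lambda>x. of_real x * g x)"
  proof (rule poly_growth_mult[OF _ g])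
    show "poly_growth (\<lambda>x::real. complex_of_real x)"
      by (rule poly_growthI[where C = 1 and d = 1]) (auto intro: continuous_intros)
  qed
  define F where "F = (\<lambda>x. gdens x *\<^sub>R g x)"
  define f where "f = (\<lambda>x. gdens x *\<^sub>R g' x - 2 * (gdens x *\<^sub>R (of_real x * g x)))"
  have i1: "integrable lborel (\<lambda>x. gdens x *\<^sub>R g' x)" by (rule integrable_gdens_poly_growth[OF g'])
  have i2: "integrable lborel (\<lambda>x. gdens x *\<^sub>R (of_real x * g x))" by (rule integrable_gdens_poly_growth[OF xg])
  have intf: "integrable lborel f" unfolding f_def
    by (intro Bochner_Integration.integrable_diff integrable_mult_right i1 i2)
  have lim: "(F \<longlongrightarrow> 0) A" if "A = at_top \<or> A = at_bot" for A
  proof -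
    obtain C d where C: "C \<ge> 0" "\<And>y. norm (g y) \<le> C * (1 + norm y) ^ d" using poly_growthE[OF g] by blast
    have "((\<lambda>x. C * (gdens x * (1 + \<bar>x\<bar>) ^ d)) \<longlongrightarrow> C * 0) A"
      by (intro tendsto_mult tendsto_const gdens_growth_tendsto that)
    then have "((\<lambda>x. C * (gdens x * (1 + \<bar>x\<bar>) ^ d)) \<longlongrightarrow> 0) A" by simp
    then show ?thesis
    proof (rule Lim_null_comparison[rotated], intro always_eventually allI)
      fix x
      have "gdens x * norm (g x) \<le> gdens x * (C * (1 + \<bar>x\<bar>) ^ d)"
        using C(2)[of x] by (intro mult_left_mono) auto
      then show "norm (F x) \<le> C * (gdens x * (1 + \<bar>x\<bar>) ^ d)" by (simp add: F_def mult_ac)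
    qed
  qed
  have cont: "isCont f x" for x
  proof -
    have "isCont g x" "isCont g' x" using g g' unfolding poly_growth_def by (auto simp: continuous_on_eq_continuous_at)
    moreover have "isCont gdens x" using DERIV_gdens DERIV_isCont by blast
    ultimately show ?thesis unfolding f_def by (intro continuous_intros)
  qed
  have "(LBINT x=-\<infinity>..\<infinity>. f x) = 0 - 0"
  proof (rule interval_integral_FTC_integrable)
    show "(F has_vector_derivative f x) (at x)" for x
      unfolding F_def f_def
      by (rule has_vector_derivative_eq_rhs[OF has_vector_derivative_scaleR[OF DERIV_gdens der]])
         (simp add: scaleR_conv_of_real algebra_simps)
    show "set_integrable lborel (einterval (- \<infinity>) \<infinity>) f"
      using intf by (simp add: set_integrable_def)
    show "((F \<circ> real_of_ereal) \<longlongrightarrow> 0) (at_right (- \<infinity>))" 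
      using lim[of at_bot] by (simp add: at_right_MInf filterlim_filtermap comp_def ereal_tendsto_simps)
    show "((F \<circ> real_of_ereal) \<longlongrightarrow> 0) (at_left \<infinity>)"
      using lim[of at_top] by (simp add: at_left_PInf filterlim_filtermap comp_def)
  qed (use cont in auto)
  then have "integral\<^sup>L lborel f = 0"
    by (simp add: interval_lebesgue_integral_def set_lebesgue_integral_def)
  moreover have "integral\<^sup>L lborel f = (\<integral>x. gdens x *\<^sub>R g' x \<partial>lborel) - 2 * (\<integral>x. gdens x *\<^sub>R (of_real x * g x) \<partial>lborel)"
    unfolding f_def by (subst Bochner_Integration.integral_diff[OF i1 integrable_mult_right[OF i2]])
      (simp only: integral_mult_right_zero)
  ultimately show ?thesis by simp
qed

section \<open>The standard complex Gaussian law\<close>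

definition gmeas :: "real measure" where "gmeas = density lborel gdens"

definition cgauss :: "complex measure" where
  "cgauss = distr (gmeas \<Otimes>\<^sub>M gmeas) borel (\<lambda>(a, b). Complex a b)"

lemma sets_gmeas [measurable_cong, simp]: "sets gmeas = sets borel"
  by (simp add: gmeas_def)

lemma space_gmeas [simp]: "space gmeas = UNIV"
  by (simp add: gmeas_def)

lemma sets_cgauss [measurable_cong, simp]: "sets cgauss = sets borel"
  by (simp add: cgauss_def)

lemma space_cgauss [simp]: "space cgauss = UNIV"
  by (simp add: cgauss_def)

lemma measurable_Complex [measurable]:
  "f \<in> borel_measurable M \<Longrightarrow> g \<in> borel_measurable M \<Longrightarrow> (\<lambda>x. Complex (f x) (g x)) \<in> borel_measurable M"
  by (simp add: borel_measurable_complex_iff)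

interpretation gmeas: prob_space gmeas
  unfolding gmeas_def by (rule prob_space_normal_density) simp

interpretation gmeas_pair: pair_prob_space gmeas gmeas ..

interpretation cgauss: prob_space cgauss
  unfolding cgauss_def by (rule gmeas_pair.prob_space_distr) measurable

lemma gmeas_ibp:
  fixes g g' :: "real \<Rightarrow> complex"
  assumes g: "poly_growth g" and g': "poly_growth g'"
    and der: "\<And>x. (g has_vector_derivative g' x) (at x)"
  shows "(\<integral>x. of_real x * g x \<partial>gmeas) = (1/2) * (\<integral>x. g' x \<partial>gmeas)"
  using gaussian_ibp_real[OF assms] poly_growth_measurable[OF g] poly_growth_measurable[OF g']
  unfolding gmeas_def by (simp add: integral_density)

lemma poly_growth_slices:
  fixes f :: "complex \<Rightarrow> complex" assumes "poly_growth f"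
  shows "poly_growth (\<lambda>a. f (Complex a b))" "poly_growth (\<lambda>b. f (Complex a b))"
proof -
  have n: "norm (Complex a b) \<le> (1 + \<bar>b\<bar>) * (1 + \<bar>a\<bar>)" for a b
  proof -
    have "norm (Complex a b) \<le> \<bar>a\<bar> + \<bar>b\<bar>" using cmod_le[of "Complex a b"] by simp
    moreover have "0 \<le> \<bar>a\<bar> * \<bar>b\<bar>" by simp
    ultimately show ?thesis by (simp only: distrib_left distrib_right mult_1 mult_1_right mult.commute add.assoc)
  qed
  show "poly_growth (\<lambda>a. f (Complex a b))"
    by (rule poly_growth_compose[OF assms, where C = "1 + \<bar>b\<bar>"])
       (auto simp: Complex_eq[abs_def] intro!: continuous_intros n[unfolded Complex_eq])
  show "poly_growth (\<lambda>b. f (Complex a b))"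
    by (rule poly_growth_compose[OF assms, where C = "1 + \<bar>a\<bar>"])
       (auto simp: Complex_eq[abs_def] mult.commute[of "1 + \<bar>a\<bar>"] intro!: continuous_intros n[unfolded Complex_eq])
qed

text \<open>The bound 1 + |a + ib| <= (1 + |a|)(1 + |b|) separates the variables and reduces the
  claim to one-dimensional moments.\<close>

lemma integrable_gmeas_pair_poly_growth:
  fixes f :: "complex \<Rightarrow> complex" assumes "poly_growth f"
  shows "integrable (gmeas \<Otimes>\<^sub>M gmeas) (\<lambda>(a, b). f (Complex a b))"
proof -
  obtain C d where f: "C \<ge> 0" "\<And>y. norm (f y) \<le> C * (1 + norm y) ^ d" using poly_growthE[OF assms] by blast
  note [measurable] = poly_growth_measurable[OF assms]
  have int1: "integrable gmeas (\<lambda>x. (1 + \<bar>x\<bar>) ^ d)"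
    unfolding gmeas_def using integrable_gdens_growth[of d] by (subst integrable_density) auto
  have "integrable (gmeas \<Otimes>\<^sub>M gmeas) (\<lambda>z. C * ((1 + \<bar>fst z\<bar>) ^ d * (1 + \<bar>snd z\<bar>) ^ d))"
  proof (rule gmeas_pair.Fubini_integrable)
    have "integrable gmeas (\<lambda>x. C * (1 + \<bar>x\<bar>) ^ d * (\<integral>y. (1 + \<bar>y\<bar>) ^ d \<partial>gmeas))"
      using int1 by (intro integrable_mult_left integrable_mult_right)
    then show "integrable gmeas (\<lambda>x. \<integral>y. norm (C * ((1 + \<bar>fst (x, y)\<bar>) ^ d * (1 + \<bar>snd (x, y)\<bar>) ^ d)) \<partial>gmeas)"
      using f by (simp add: abs_mult mult_ac)
    show "AE x in gmeas. integrable gmeas (\<lambda>y. C * ((1 + \<bar>fst (x, y)\<bar>) ^ d * (1 + \<bar>snd (x, y)\<bar>) ^ d))"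
      using int1 by simp
  qed measurable
  then show ?thesis
  proof (rule Bochner_Integration.integrable_bound, measurable, intro AE_I2)
    fix z :: "real \<times> real"
    obtain a b where z: "z = (a, b)" by fastforce
    have "norm (Complex a b) \<le> \<bar>a\<bar> + \<bar>b\<bar>" using cmod_le[of "Complex a b"] by simp
    moreover have "0 \<le> \<bar>a\<bar> * \<bar>b\<bar>" by simp
    ultimately have "1 + norm (Complex a b) \<le> (1 + \<bar>a\<bar>) * (1 + \<bar>b\<bar>)"
      by (simp only: distrib_left distrib_right mult_1 mult_1_right)
    then have "(1 + norm (Complex a b)) ^ d \<le> ((1 + \<bar>a\<bar>) * (1 + \<bar>b\<bar>)) ^ d" by (intro power_mono) auto
    then have "C * (1 + norm (Complex a b)) ^ d \<le> C * ((1 + \<bar>a\<bar>) ^ d * (1 + \<bar>b\<bar>) ^ d)"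
      using f(1) by (intro mult_left_mono) (auto simp: power_mult_distrib)
    then show "norm (case z of (a, b) \<Rightarrow> f (Complex a b)) \<le> norm (C * ((1 + \<bar>fst z\<bar>) ^ d * (1 + \<bar>snd z\<bar>) ^ d))"
      using f(2)[of "Complex a b"] f(1) by (simp add: z abs_mult)
  qed
qed

lemma
  fixes f :: "complex \<Rightarrow> complex" assumes "poly_growth f"
  shows integrable_cgauss_poly_growth: "integrable cgauss f"
    and integral_cgauss_fst: "(\<integral>y. f y \<partial>cgauss) = (\<integral>a. (\<integral>b. f (Complex a b) \<partial>gmeas) \<partial>gmeas)"
    and integral_cgauss_snd: "(\<integral>y. f y \<partial>cgauss) = (\<integral>b. (\<integral>a. f (Complex a b) \<partial>gmeas) \<partial>gmeas)"
proof -
  note [measurable] = poly_growth_measurable[OF assms]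
  note int = integrable_gmeas_pair_poly_growth[OF assms]
  show "integrable cgauss f"
    unfolding cgauss_def using int by (subst integrable_distr_eq) (auto simp: case_prod_beta')
  have "(\<integral>y. f y \<partial>cgauss) = (\<integral>(a, b). f (Complex a b) \<partial>(gmeas \<Otimes>\<^sub>M gmeas))"
    unfolding cgauss_def by (subst integral_distr) (auto simp: case_prod_beta')
  then show "(\<integral>y. f y \<partial>cgauss) = (\<integral>a. (\<integral>b. f (Complex a b) \<partial>gmeas) \<partial>gmeas)"
    "(\<integral>y. f y \<partial>cgauss) = (\<integral>b. (\<integral>a. f (Complex a b) \<partial>gmeas) \<partial>gmeas)"
    using gmeas_pair.integral_fst[OF int] gmeas_pair.integral_snd[OF int] by simp_all
qed

text \<open>Here \<open>p\<close> and \<open>q\<close> are the derivatives of \<open>g\<close> in y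
  and in its conjugate. Integrating by parts in the real part gives (p + q)/2, in the imaginary part
  (i p - i q)/2; adding the first to i times the second cancels \<open>p\<close> and leaves
  \<open>q\<close>.\<close>

lemma cgauss_ibp:
  fixes g p q :: "complex \<Rightarrow> complex"
  assumes g: "poly_growth g" and p: "poly_growth p" and q: "poly_growth q"
    and der: "\<And>y. (g has_derivative (\<lambda>h. p y * h + q y * cnj h)) (at y)"
  shows "(\<integral>y. y * g y \<partial>cgauss) = (\<integral>y. q y \<partial>cgauss)"
proof -
  have reg: "poly_growth (\<lambda>y. of_real (Re y) * g y)" "poly_growth (\<lambda>y. of_real (Im y) * g y)"
  proof -
    have "poly_growth (\<lambda>y::complex. complex_of_real (Re y))"
      by (rule poly_growthI[where C = 1 and d = 1]) (auto intro!: continuous_intros abs_Re_le_cmod add_increasing)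
    moreover have "poly_growth (\<lambda>y::complex. complex_of_real (Im y))"
      by (rule poly_growthI[where C = 1 and d = 1]) (auto intro!: continuous_intros abs_Im_le_cmod add_increasing)
    ultimately show "poly_growth (\<lambda>y. of_real (Re y) * g y)" "poly_growth (\<lambda>y. of_real (Im y) * g y)"
      by (auto intro: poly_growth_mult g)
  qed
  have pq: "poly_growth (\<lambda>y. p y + q y)" by (intro poly_growth_add p q)
  have pq': "poly_growth (\<lambda>y. \<i> * p y + - \<i> * q y)"
    by (intro poly_growth_add poly_growth_mult[OF poly_growth_const] p q)
  have da: "((\<lambda>a. g (Complex a b)) has_vector_derivative (p (Complex a b) + q (Complex a b))) (at a)" for a b
  proof -
    have "((\<lambda>a. Complex a b) has_derivative (\<lambda>h. of_real h)) (at a)"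
      unfolding Complex_eq by (auto intro!: derivative_eq_intros)
    from has_derivative_compose[OF this der] show ?thesis
      unfolding has_vector_derivative_def by (simp add: scaleR_conv_of_real algebra_simps)
  qed
  have db: "((\<lambda>b. g (Complex a b)) has_vector_derivative (\<i> * p (Complex a b) + - \<i> * q (Complex a b))) (at b)" for a b
  proof -
    have "((\<lambda>b. Complex a b) has_derivative (\<lambda>h. \<i> * of_real h)) (at b)"
      unfolding Complex_eq by (auto intro!: derivative_eq_intros)
    from has_derivative_compose[OF this der] show ?thesis
      unfolding has_vector_derivative_def by (simp add: scaleR_conv_of_real algebra_simps)
  qed
  have 1: "(\<integral>y. of_real (Re y) * g y \<partial>cgauss) = (1/2) * (\<integral>y. p y + q y \<partial>cgauss)"
    unfolding integral_cgauss_snd[OF reg(1)] integral_cgauss_snd[OF pq]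
    by (simp only: complex.sel integral_mult_right_zero
      gmeas_ibp[OF poly_growth_slices(1)[OF g] poly_growth_slices(1)[OF pq] da])
  have 2: "(\<integral>y. of_real (Im y) * g y \<partial>cgauss) = (1/2) * (\<integral>y. \<i> * p y + - \<i> * q y \<partial>cgauss)"
    unfolding integral_cgauss_fst[OF reg(2)] integral_cgauss_fst[OF pq']
    by (simp only: complex.sel integral_mult_right_zero
      gmeas_ibp[OF poly_growth_slices(2)[OF g] poly_growth_slices(2)[OF pq'] db])
  note ip = integrable_cgauss_poly_growth[OF p] and iq = integrable_cgauss_poly_growth[OF q]
  have "(\<integral>y. y * g y \<partial>cgauss) = (\<integral>y. of_real (Re y) * g y + \<i> * (of_real (Im y) * g y) \<partial>cgauss)"
    by (intro Bochner_Integration.integral_cong) (simp_all add: complex_eq_iff algebra_simps)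
  also have "\<dots> = (\<integral>y. of_real (Re y) * g y \<partial>cgauss) + \<i> * (\<integral>y. of_real (Im y) * g y \<partial>cgauss)"
    using integrable_cgauss_poly_growth[OF reg(1)] integrable_cgauss_poly_growth[OF reg(2)] by simp
  also have "\<dots> = (\<integral>y. q y \<partial>cgauss)"
    unfolding 1 2 using ip iq by (simp add: algebra_simps)
  finally show ?thesis .
qed

lemma std_complex_normal_distr:
  assumes "prob_space P" and "std_complex_normal P Z"
  shows "distr P borel Z = cgauss"
proof -
  interpret prob_space P by fact
  have [measurable]: "Z \<in> borel_measurable P"
    and ind: "indep_var borel (\<lambda>\<omega>. Re (Z \<omega>)) borel (\<lambda>\<omega>. Im (Z \<omega>))"
    and d: "distributed P lborel (\<lambda>\<omega>. Re (Z \<omega>)) (\<lambda>x. ennreal (gdens x))"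
      "distributed P lborel (\<lambda>\<omega>. Im (Z \<omega>)) (\<lambda>x. ennreal (gdens x))"
    using assms(2) unfolding std_complex_normal_def by auto
  have re: "distr P borel (\<lambda>\<omega>. Re (Z \<omega>)) = gmeas" and im: "distr P borel (\<lambda>\<omega>. Im (Z \<omega>)) = gmeas"
    using distributed_distr_eq_density[OF d(1)] distributed_distr_eq_density[OF d(2)]
    by (simp_all add: gmeas_def cong: distr_cong)
  have "gmeas \<Otimes>\<^sub>M gmeas = distr P (borel \<Otimes>\<^sub>M borel) (\<lambda>\<omega>. (Re (Z \<omega>), Im (Z \<omega>)))"
    using ind unfolding indep_var_distribution_eq re im by simp
  then have "cgauss = distr P borel (\<lambda>\<omega>. Complex (Re (Z \<omega>)) (Im (Z \<omega>)))"
    unfolding cgauss_def by (simp add: distr_distr comp_def)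
  then show ?thesis by simp
qed

section \<open>Secular coefficients as polynomials in the Gaussian variables\<close>

text \<open>The simplifier would otherwise turn the index sets \<open>{1..m}\<close> into \<open>{Suc 0..m}\<close>, blocking \<open>sec_restrict\<close>.\<close>

declare One_nat_def [simp del]

text \<open>This is the coefficient of z^n in exp(sum of sqrt(\<theta>/k) x_k z^k), introduced
  through the recursion that z d/dz gives for an exponential. No convergence question arises, and
  measurability, moments and derivatives all follow by induction. The factor k sqrt(\<theta>/k) is
  left unsimplified because differentiating in x_k supplies a second sqrt(\<theta>/k), and the
  product is \<theta>.\<close>

fun sec :: "real \<Rightarrow> nat \<Rightarrow> (nat \<Rightarrow> complex) \<Rightarrow> complex" where
  "sec \<theta> 0 x = 1"
| "sec \<theta> (Suc n) x =
     (\<Sum>j\<le>n. of_real (real (Suc j) * sqrt (\<theta> / real (Suc j))) * x (Suc j) * sec \<theta> (n - j) x) / of_nat (Suc n)"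

declare sec.simps(2) [simp del]

lemma sec_euler:
  "of_nat n * sec \<theta> n x = (\<Sum>k=1..n. of_real (real k * sqrt (\<theta> / real k)) * x k * sec \<theta> (n - k) x)"
proof (cases n)
  case (Suc m)
  have "of_nat n * sec \<theta> n x =
      (\<Sum>j\<le>m. of_real (real (Suc j) * sqrt (\<theta> / real (Suc j))) * x (Suc j) * sec \<theta> (n - Suc j) x)"
    unfolding Suc sec.simps(2) by (simp del: of_nat_Suc)
  also have "\<dots> = (\<Sum>k=1..n. of_real (real k * sqrt (\<theta> / real k)) * x k * sec \<theta> (n - k) x)"
    by (rule sum.reindex_bij_witness[of _ "\<lambda>k. k - 1" Suc]) (auto simp: Suc)
  finally show ?thesis .
qed simp

lemma sec_cong: "(\<And>k. k \<in> {1..n} \<Longrightarrow> x k = y k) \<Longrightarrow> sec \<theta> n x = sec \<theta> n y"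
proof (induction n rule: less_induct)
  case (less n)
  have "of_nat n * sec \<theta> n x = of_nat n * sec \<theta> n y"
    unfolding sec_euler using less by (intro sum.cong) auto
  then show ?case by (cases "n = 0") auto
qed

lemma sec_restrict [simp]: "n \<le> m \<Longrightarrow> sec \<theta> n (restrict x {1..m}) = sec \<theta> n x"
  by (rule sec_cong) auto

lemma measurable_sec:
  assumes "n \<le> m"
  shows "sec \<theta> n \<in> borel_measurable (PiM {1..m} (\<lambda>_. borel))"
  using assms
proof (induction n rule: less_induct)
  case (less n)
  show ?case
  proof (cases n)
    case 0
    then show ?thesis by simp
  next
    case (Suc l)
    have m: "sec \<theta> (l - j) \<in> borel_measurable (PiM {1..m} (\<lambda>_. borel))" for j
      using less Suc by simp
    have c: "(\<lambda>x. x (Suc j)) \<in> measurable (PiM {1..m} (\<lambda>_. borel)) (borel :: complex measure)" if "j \<le> l" for j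
      using that less.prems Suc by (intro measurable_component_singleton) auto
    show ?thesis unfolding Suc sec.simps(2)
      by (intro borel_measurable_divide borel_measurable_sum borel_measurable_times c m) auto
  qed
qed

section \<open>Wirtinger derivatives in a single coordinate\<close>

definition dsec :: "real \<Rightarrow> nat \<Rightarrow> nat \<Rightarrow> (nat \<Rightarrow> complex) \<Rightarrow> complex" where
  "dsec \<theta> k n x = (if k \<le> n then of_real (sqrt (\<theta> / real k)) * sec \<theta> (n - k) x else 0)"

text \<open>\<open>p\<close> and \<open>q\<close> are the derivatives of \<open>G\<close> in x_k and
  in the conjugate of x_k. The growth conditions are imposed on each slice separately: this is the
  form in which \<open>cgauss_ibp\<close> uses them, and they survive sums, products and
  conjugation.\<close>

definition wirtinger ::
  "nat \<Rightarrow> ((nat \<Rightarrow> complex) \<Rightarrow> complex) \<Rightarrow> ((nat \<Rightarrow> complex) \<Rightarrow> complex) \<Rightarrow> ((nat \<Rightarrow> complex) \<Rightarrow> complex) \<Rightarrow> bool" where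
  "wirtinger k G p q \<longleftrightarrow> (\<forall>x. poly_growth (\<lambda>y. G (x(k := y))) \<and> poly_growth (\<lambda>y. p (x(k := y))) \<and>
     poly_growth (\<lambda>y. q (x(k := y))) \<and>
     (\<forall>y. ((\<lambda>w. G (x(k := w))) has_derivative (\<lambda>h. p (x(k := y)) * h + q (x(k := y)) * cnj h)) (at y)))"

lemma wirtinger_eq_rhs: "wirtinger k G p q \<Longrightarrow> (\<And>x. p x = p' x) \<Longrightarrow> (\<And>x. q x = q' x) \<Longrightarrow> wirtinger k G p' q'"
  by (simp add: wirtinger_def)

lemma wirtinger_const: "wirtinger k (\<lambda>_. c) (\<lambda>_. 0) (\<lambda>_. 0)"
  by (simp add: wirtinger_def)

lemma wirtinger_coord: "wirtinger k (\<lambda>x. x j) (\<lambda>_. if j = k then 1 else 0) (\<lambda>_. 0)"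
  unfolding wirtinger_def
  by (auto simp: poly_growth_id intro!: derivative_eq_intros)

lemma wirtingerD:
  "wirtinger k G p q \<Longrightarrow>
    ((\<lambda>w. G (x(k := w))) has_derivative (\<lambda>h. p (x(k := y)) * h + q (x(k := y)) * cnj h)) (at y)"
  by (simp add: wirtinger_def)

lemma wirtinger_add:
  assumes "wirtinger k G p q" "wirtinger k G' p' q'"
  shows "wirtinger k (\<lambda>x. G x + G' x) (\<lambda>x. p x + p' x) (\<lambda>x. q x + q' x)"
  unfolding wirtinger_def
proof (intro allI conjI)
  fix x y
  show "((\<lambda>w. G (x(k := w)) + G' (x(k := w))) has_derivative
     (\<lambda>h. (p (x(k := y)) + p' (x(k := y))) * h + (q (x(k := y)) + q' (x(k := y))) * cnj h)) (at y)"
    by (rule has_derivative_eq_rhs[OF has_derivative_add[OF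
        wirtingerD[OF assms(1)] wirtingerD[OF assms(2)]]]) (auto simp: algebra_simps)
qed (use assms in \<open>auto simp: wirtinger_def intro: poly_growth_add\<close>)

lemma wirtinger_mult:
  assumes "wirtinger k G p q" "wirtinger k G' p' q'"
  shows "wirtinger k (\<lambda>x. G x * G' x) (\<lambda>x. p x * G' x + G x * p' x) (\<lambda>x. q x * G' x + G x * q' x)"
  unfolding wirtinger_def
proof (intro allI conjI)
  fix x y
  show "((\<lambda>w. G (x(k := w)) * G' (x(k := w))) has_derivative
     (\<lambda>h. (p (x(k := y)) * G' (x(k := y)) + G (x(k := y)) * p' (x(k := y))) * h +
          (q (x(k := y)) * G' (x(k := y)) + G (x(k := y)) * q' (x(k := y))) * cnj h)) (at y)"
    by (rule has_derivative_eq_rhs[OF has_derivative_mult[OF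
        wirtingerD[OF assms(1)] wirtingerD[OF assms(2)]]]) (auto simp: algebra_simps)
qed (use assms in \<open>auto simp: wirtinger_def intro!: poly_growth_add poly_growth_mult\<close>)

lemma wirtinger_cmult:
  "wirtinger k G p q \<Longrightarrow> wirtinger k (\<lambda>x. c * G x) (\<lambda>x. c * p x) (\<lambda>x. c * q x)"
  using wirtinger_mult[OF wirtinger_const[of k c]] by simp

lemma wirtinger_cnj:
  assumes "wirtinger k G p q"
  shows "wirtinger k (\<lambda>x. cnj (G x)) (\<lambda>x. cnj (q x)) (\<lambda>x. cnj (p x))"
  unfolding wirtinger_def
proof (intro allI conjI)
  fix x y
  show "((\<lambda>w. cnj (G (x(k := w)))) has_derivative
     (\<lambda>h. cnj (q (x(k := y))) * h + cnj (p (x(k := y))) * cnj h)) (at y)"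
    by (rule has_derivative_eq_rhs[OF has_derivative_cnj[OF wirtingerD[OF assms]]]) (auto simp: algebra_simps)
qed (use assms in \<open>auto simp: wirtinger_def intro: poly_growth_cnj\<close>)

lemma wirtinger_sum:
  assumes "\<And>i. i \<in> I \<Longrightarrow> wirtinger k (G i) (p i) (q i)"
  shows "wirtinger k (\<lambda>x. \<Sum>i\<in>I. G i x) (\<lambda>x. \<Sum>i\<in>I. p i x) (\<lambda>x. \<Sum>i\<in>I. q i x)"
  using assms by (induction I rule: infinite_finite_induct) (auto intro: wirtinger_add wirtinger_const)

text \<open>The sign condition keeps the exponential bounded by 1; without such control it would
  leave the class of functions of polynomial growth.\<close>

lemma wirtinger_exp:
  assumes H: "wirtinger k H p q" and neg: "\<And>x. Re (H x) \<le> 0"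
  shows "wirtinger k (\<lambda>x. exp (H x)) (\<lambda>x. exp (H x) * p x) (\<lambda>x. exp (H x) * q x)"
proof -
  have e: "poly_growth (\<lambda>y. exp (H (x(k := y))))" for x
  proof (rule poly_growthI[where C = 1 and d = 0])
    have "continuous_on UNIV (\<lambda>y. H (x(k := y)))" using H by (simp add: wirtinger_def poly_growth_def)
    then show "continuous_on UNIV (\<lambda>y. exp (H (x(k := y))))" by (intro continuous_intros)
    show "cmod (exp (H (x(k := y)))) \<le> 1 * (1 + cmod y) ^ 0" for y
      using neg by (simp add: norm_exp_eq_Re)
  qed
  have d: "((\<lambda>w. exp (H (x(k := w)))) has_derivative
     (\<lambda>h. exp (H (x(k := y))) * p (x(k := y)) * h + exp (H (x(k := y))) * q (x(k := y)) * cnj h)) (at y)" for x y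
  proof -
    have 1: "((\<lambda>w. H (x(k := w))) has_derivative (\<lambda>h. p (x(k := y)) * h + q (x(k := y)) * cnj h)) (at y)"
      using H by (simp add: wirtinger_def)
    have 2: "(exp has_derivative (\<lambda>h. exp (H (x(k := y))) * h)) (at (H (x(k := y))))"
      using DERIV_exp[of "H (x(k := y))"] unfolding has_field_derivative_def by simp
    show ?thesis
      by (rule has_derivative_eq_rhs[OF has_derivative_compose[OF 1 2]]) (auto simp: algebra_simps)
  qed
  show ?thesis unfolding wirtinger_def
    using H e d by (auto simp: wirtinger_def intro!: poly_growth_mult)
qed

text \<open>Differentiating the exponential generating function in x_k multiplies it by
  sqrt(\<theta>/k) z^k, which shifts the index by k. In the induction the derivative of the explicit
  factor x_k contributes k times \<open>dsec\<close>, and the derivatives of the lower coefficients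
  contribute n - k times \<open>dsec\<close>. The conjugate derivative is 0 because the polynomial
  is holomorphic.\<close>

lemma wirtinger_sec:
  assumes "k \<ge> 1"
  shows "wirtinger k (sec \<theta> n) (dsec \<theta> k n) (\<lambda>_. 0)"
proof (induction n rule: less_induct)
  case (less n)
  show ?case
  proof (cases "n = 0")
    case True
    then have "sec \<theta> n = (\<lambda>_. 1)" "dsec \<theta> k n = (\<lambda>_. 0)" using assms by (auto simp: dsec_def fun_eq_iff)
    then show ?thesis by (simp add: wirtinger_const)
  next
    case False
    let ?c = "\<lambda>j. complex_of_real (real j * sqrt (\<theta> / real j))"
    have eq: "sec \<theta> n = (\<lambda>x. (1 / of_nat n) * (\<Sum>j=1..n. ?c j * (x j * sec \<theta> (n - j) x)))"
      using False sec_euler[of n \<theta>] by (simp add: fun_eq_iff field_simps)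
    have "wirtinger k (\<lambda>x. (1 / of_nat n) * (\<Sum>j=1..n. ?c j * (x j * sec \<theta> (n - j) x)))
       (\<lambda>x. (1 / of_nat n) * (\<Sum>j=1..n. ?c j * ((if j = k then 1 else 0) * sec \<theta> (n - j) x + x j * dsec \<theta> k (n - j) x)))
       (\<lambda>x. (1 / of_nat n) * (\<Sum>j=1..n. ?c j * (0 * sec \<theta> (n - j) x + x j * 0)))"
      using less False by (intro wirtinger_cmult wirtinger_sum wirtinger_mult wirtinger_coord) auto
    moreover have "(1 / of_nat n) * (\<Sum>j=1..n. ?c j * ((if j = k then 1 else 0) * sec \<theta> (n - j) x + x j * dsec \<theta> k (n - j) x))
        = dsec \<theta> k n x" for x
    proof -
      have "(\<Sum>j=1..n. ?c j * ((if j = k then 1 else 0) * sec \<theta> (n - j) x + x j * dsec \<theta> k (n - j) x))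
        = (\<Sum>j=1..n. if j = k then ?c j * sec \<theta> (n - j) x else 0) + (\<Sum>j=1..n. ?c j * x j * dsec \<theta> k (n - j) x)"
        unfolding sum.distrib[symmetric] by (rule sum.cong) (auto simp: algebra_simps)
      also have "(\<Sum>j=1..n. if j = k then ?c j * sec \<theta> (n - j) x else 0) = of_nat k * dsec \<theta> k n x"
        using assms by (auto simp: sum.delta dsec_def)
      \<comment> \<open>Up to the factor sqrt(\<theta>/k) this is the Euler recursion for the index
        n - k; the terms with j > n - k vanish.\<close>
      also have "(\<Sum>j=1..n. ?c j * x j * dsec \<theta> k (n - j) x) = of_nat (n - k) * dsec \<theta> k n x"
      proof (cases "k \<le> n")
        case True
        have "(\<Sum>j=1..n. ?c j * x j * dsec \<theta> k (n - j) x) =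
           (\<Sum>j=1..n - k. ?c j * x j * dsec \<theta> k (n - j) x)"
          by (rule sum.mono_neutral_right) (auto simp: dsec_def)
        also have "\<dots> = of_real (sqrt (\<theta> / real k)) * (\<Sum>j=1..n - k. ?c j * x j * sec \<theta> (n - k - j) x)"
          unfolding sum_distrib_left by (intro sum.cong) (auto simp: dsec_def algebra_simps)
        also have "\<dots> = of_nat (n - k) * dsec \<theta> k n x"
          unfolding sec_euler[symmetric] using True by (simp add: dsec_def)
        finally show ?thesis .
      qed (auto simp: dsec_def intro!: sum.neutral)
      also have "of_nat k * dsec \<theta> k n x + of_nat (n - k) * dsec \<theta> k n x = of_nat n * dsec \<theta> k n x"
        by (cases "k \<le> n") (auto simp: dsec_def algebra_simps of_nat_diff)
      finally show ?thesis using False by simp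
    qed
    ultimately show ?thesis unfolding eq
      by (rule_tac wirtinger_eq_rhs) (auto simp: eq[symmetric])
  qed
qed

section \<open>Random variables with moments of all orders\<close>

definition (in prob_space) all_moments :: "('a \<Rightarrow> complex) \<Rightarrow> bool" where
  "all_moments f \<longleftrightarrow> f \<in> borel_measurable M \<and> (\<forall>p::nat. integrable M (\<lambda>\<omega>. cmod (f \<omega>) ^ p))"

context prob_space
begin

lemma all_moments_measurable: "all_moments f \<Longrightarrow> f \<in> borel_measurable M"
  by (simp add: all_moments_def)

lemma all_moments_power: "all_moments f \<Longrightarrow> integrable M (\<lambda>\<omega>. cmod (f \<omega>) ^ p)"
  by (simp add: all_moments_def)

lemma all_moments_integrable: "all_moments f \<Longrightarrow> integrable M f"
  using all_moments_power[of f 1] by (auto simp: all_moments_def intro: integrable_norm_cancel)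

lemma all_moments_const [simp]: "all_moments (\<lambda>_. c)"
  by (simp add: all_moments_def)

lemma all_moments_bound:
  assumes "all_moments g" "f \<in> borel_measurable M" "\<And>\<omega>. cmod (f \<omega>) \<le> cmod (g \<omega>)"
  shows "all_moments f"
  unfolding all_moments_def
proof (intro conjI allI)
  fix p
  show "integrable M (\<lambda>\<omega>. cmod (f \<omega>) ^ p)"
    by (rule Bochner_Integration.integrable_bound[OF all_moments_power[OF assms(1), of p]])
       (use assms(2,3) in \<open>auto intro!: power_mono AE_I2\<close>)
qed (use assms in auto)

lemma all_moments_mult:
  assumes "all_moments f" "all_moments g" shows "all_moments (\<lambda>\<omega>. f \<omega> * g \<omega>)"
  unfolding all_moments_def
proof (intro conjI allI)
  note [measurable] = assms[THEN all_moments_measurable]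
  show "(\<lambda>\<omega>. f \<omega> * g \<omega>) \<in> borel_measurable M" by measurable
  fix p
  have "integrable M (\<lambda>\<omega>. cmod (f \<omega>) ^ (2 * p) + cmod (g \<omega>) ^ (2 * p))"
    using assms by (intro Bochner_Integration.integrable_add all_moments_power)
  then show "integrable M (\<lambda>\<omega>. cmod (f \<omega> * g \<omega>) ^ p)"
  proof (rule Bochner_Integration.integrable_bound, measurable, intro AE_I2)
    fix \<omega>
    have "2 * (cmod (f \<omega>) ^ p * cmod (g \<omega>) ^ p) \<le> (cmod (f \<omega>) ^ p)\<^sup>2 + (cmod (g \<omega>) ^ p)\<^sup>2"
      using sum_squares_bound[of "cmod (f \<omega>) ^ p" "cmod (g \<omega>) ^ p"] by (simp add: mult.assoc)
    moreover have "0 \<le> cmod (f \<omega>) ^ p * cmod (g \<omega>) ^ p" by simp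
    ultimately have "cmod (f \<omega>) ^ p * cmod (g \<omega>) ^ p \<le> (cmod (f \<omega>) ^ p)\<^sup>2 + (cmod (g \<omega>) ^ p)\<^sup>2" by linarith
    then show "norm (cmod (f \<omega> * g \<omega>) ^ p) \<le> norm (cmod (f \<omega>) ^ (2 * p) + cmod (g \<omega>) ^ (2 * p))"
      by (simp add: norm_mult power_mult_distrib abs_mult power_mult[symmetric] mult.commute[of p])
  qed
qed

lemma all_moments_add:
  assumes "all_moments f" "all_moments g" shows "all_moments (\<lambda>\<omega>. f \<omega> + g \<omega>)"
  unfolding all_moments_def
proof (intro conjI allI)
  note [measurable] = assms[THEN all_moments_measurable]
  show "(\<lambda>\<omega>. f \<omega> + g \<omega>) \<in> borel_measurable M" by measurable
  fix p
  have "integrable M (\<lambda>\<omega>. 2 ^ p * (cmod (f \<omega>) ^ p + cmod (g \<omega>) ^ p))"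
    using assms by (intro integrable_mult_right Bochner_Integration.integrable_add all_moments_power)
  then show "integrable M (\<lambda>\<omega>. cmod (f \<omega> + g \<omega>) ^ p)"
  proof (rule Bochner_Integration.integrable_bound, measurable, intro AE_I2)
    fix \<omega>
    let ?a = "cmod (f \<omega>)" and ?b = "cmod (g \<omega>)"
    have "cmod (f \<omega> + g \<omega>) \<le> 2 * max ?a ?b" using norm_triangle_ineq[of "f \<omega>" "g \<omega>"] by linarith
    then have "cmod (f \<omega> + g \<omega>) ^ p \<le> (2 * max ?a ?b) ^ p" by (intro power_mono) auto
    also have "\<dots> = 2 ^ p * (max ?a ?b) ^ p" by (simp add: power_mult_distrib)
    also have "\<dots> \<le> 2 ^ p * (?a ^ p + ?b ^ p)" by (intro mult_left_mono) (auto simp: max_def)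
    finally show "norm (cmod (f \<omega> + g \<omega>) ^ p) \<le> norm (2 ^ p * (?a ^ p + ?b ^ p))"
      by (simp add: abs_mult)
  qed
qed

lemma all_moments_sum:
  "(\<And>i. i \<in> I \<Longrightarrow> all_moments (f i)) \<Longrightarrow> all_moments (\<lambda>\<omega>. \<Sum>i\<in>I. f i \<omega>)"
  by (induction I rule: infinite_finite_induct) (auto intro: all_moments_add)

lemma all_moments_cnj: "all_moments f \<Longrightarrow> all_moments (\<lambda>\<omega>. cnj (f \<omega>))"
  by (rule all_moments_bound[of f]) (auto dest: all_moments_measurable simp: borel_measurable_complex_iff)

end

text \<open>The coefficient of x^n in (1 - x)^(-\<theta>). It turns out to be E|c_n|^2, see
  \<open>second_moment\<close>.\<close>

definition gbinom_wt :: "real \<Rightarrow> nat \<Rightarrow> real" where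
  "gbinom_wt \<theta> n = pochhammer \<theta> n / fact n"

lemma gbinom_wt_0 [simp]: "gbinom_wt \<theta> 0 = 1"
  by (simp add: gbinom_wt_def)

lemma gbinom_wt_Suc: "gbinom_wt \<theta> (Suc n) = gbinom_wt \<theta> n * (\<theta> + real n) / real (Suc n)"
  by (simp add: gbinom_wt_def pochhammer_Suc)

text \<open>Coefficient form of x d/dx applied to (1 - x)^(-\<theta>), the deterministic counterpart
  of the Euler recursion for the c_n. It also shows that the mean of V_n is exactly
  E|c_n|^2.\<close>

lemma gbinom_wt_euler: "real n * gbinom_wt \<theta> n = \<theta> * (\<Sum>j<n. gbinom_wt \<theta> j)"
proof (induction n)
  case (Suc n)
  have "real (Suc n) * gbinom_wt \<theta> (Suc n) = \<theta> * gbinom_wt \<theta> n + real n * gbinom_wt \<theta> n"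
    unfolding gbinom_wt_Suc by (simp add: algebra_simps add_divide_distrib[symmetric] del: of_nat_Suc) (simp add: field_simps)
  with Suc show ?case by (simp add: algebra_simps)
qed simp

lemma gbinom_wt_euler': "real n * gbinom_wt \<theta> n = (\<Sum>k=1..n. \<theta> * gbinom_wt \<theta> (n - k))"
  unfolding gbinom_wt_euler sum_distrib_left
  by (rule sum.reindex_bij_witness[of _ "\<lambda>k. n - k" "\<lambda>k. n - k"]) auto

lemma gbinom_wt_pos: "\<theta> > 0 \<Longrightarrow> gbinom_wt \<theta> n > 0"
  by (simp add: gbinom_wt_def pochhammer_pos)

section \<open>Integration by parts for the random coefficients\<close>

locale secular_chaos = prob_space P for P :: "'a measure" +
  fixes N :: "nat \<Rightarrow> 'a \<Rightarrow> complex" and \<theta> :: real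
  assumes iid: "iid_std_complex_normal P N" and theta_pos: "0 < \<theta>" and theta_lt: "\<theta> < 1 / 2"
begin

definition c :: "nat \<Rightarrow> 'a \<Rightarrow> complex" where "c n \<omega> = sec \<theta> n (\<lambda>k. N k \<omega>)"

definition trunc :: "nat \<Rightarrow> 'a \<Rightarrow> nat \<Rightarrow> complex" where "trunc m \<omega> = restrict (\<lambda>k. N k \<omega>) {1..m}"

lemma theta_lt_1: "\<theta> < 1"
  using theta_lt by simp

lemma sec_trunc [simp]: "n \<le> m \<Longrightarrow> sec \<theta> n (trunc m \<omega>) = c n \<omega>"
  by (simp add: trunc_def c_def)

lemma N_measurable [measurable]: "k \<ge> 1 \<Longrightarrow> N k \<in> borel_measurable P"
  using iid by (auto simp: iid_std_complex_normal_def std_complex_normal_def)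

lemma distr_N: "k \<ge> 1 \<Longrightarrow> distr P borel (N k) = cgauss"
  using iid by (intro std_complex_normal_distr) (auto simp: iid_std_complex_normal_def prob_space_axioms)

lemma trunc_measurable [measurable]: "trunc m \<in> measurable P (PiM {1..m} (\<lambda>_. borel))"
  unfolding trunc_def by (intro measurable_restrict) auto

lemma distr_trunc:
  assumes "m \<ge> 1" shows "distr P (PiM {1..m} (\<lambda>_. borel)) (trunc m) = PiM {1..m} (\<lambda>_. cgauss)"
proof -
  have "indep_vars (\<lambda>_. borel) N {1..m}"
    using iid by (auto simp: iid_std_complex_normal_def intro: indep_vars_subset)
  then have "distr P (PiM {1..m} (\<lambda>_. borel)) (trunc m) = PiM {1..m} (\<lambda>i. distr P borel (N i))"
    unfolding trunc_def using assms by (subst (asm) indep_vars_iff_distr_eq_PiM') auto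
  also have "\<dots> = PiM {1..m} (\<lambda>_. cgauss)" by (intro PiM_cong) (auto simp: distr_N)
  finally show ?thesis .
qed

lemma c_measurable [measurable]: "c n \<in> borel_measurable P"
proof -
  have "(\<lambda>\<omega>. sec \<theta> n (trunc n \<omega>)) \<in> borel_measurable P"
    by (rule measurable_compose[OF trunc_measurable measurable_sec]) simp
  then show ?thesis by (simp cong: measurable_cong)
qed

text \<open>By independence \<open>trunc m\<close> has a product law, so Fubini isolates the
  coordinate k and \<open>cgauss_ibp\<close> applies to the inner integral with all other
  coordinates frozen.\<close>

lemma ibp:
  assumes k: "1 \<le> k" "k \<le> m" and w: "wirtinger k G p q"
    and [measurable]: "G \<in> borel_measurable (PiM {1..m} (\<lambda>_. borel))" "q \<in> borel_measurable (PiM {1..m} (\<lambda>_. borel))"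
    and int: "integrable P (\<lambda>\<omega>. N k \<omega> * G (trunc m \<omega>))" "integrable P (\<lambda>\<omega>. q (trunc m \<omega>))"
  shows "(\<integral>\<omega>. N k \<omega> * G (trunc m \<omega>) \<partial>P) = (\<integral>\<omega>. q (trunc m \<omega>) \<partial>P)"
proof -
  interpret product_sigma_finite "\<lambda>_::nat. cgauss" ..
  let ?I = "{1..m} - {k}"
  have I: "insert k ?I = {1..m}" using k by auto
  have sets_eq: "sets (PiM {1..m} (\<lambda>_. cgauss)) = sets (PiM {1..m} (\<lambda>_. borel))" by (intro sets_PiM_cong) auto
  have meas: "F \<in> borel_measurable (PiM {1..m} (\<lambda>_. cgauss)) \<longleftrightarrow> F \<in> borel_measurable (PiM {1..m} (\<lambda>_. borel))"
    for F :: "(nat \<Rightarrow> complex) \<Rightarrow> complex"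
    by (rule measurable_cong_sets[OF sets_eq refl, THEN arg_cong])
  have fub: "(\<integral>\<omega>. F (trunc m \<omega>) \<partial>P) = (\<integral>x. (\<integral>y. F (x(k := y)) \<partial>cgauss) \<partial>PiM ?I (\<lambda>_. cgauss))"
    if F[measurable]: "F \<in> borel_measurable (PiM {1..m} (\<lambda>_. borel))" and "integrable P (\<lambda>\<omega>. F (trunc m \<omega>))" for F :: "_ \<Rightarrow> complex"
  proof -
    have i: "integrable (PiM (insert k ?I) (\<lambda>_. cgauss)) F"
      using that(2) k unfolding I by (subst distr_trunc[symmetric]) (auto simp: integrable_distr_eq)
    have "(\<integral>\<omega>. F (trunc m \<omega>) \<partial>P) = (\<integral>x. F x \<partial>PiM (insert k ?I) (\<lambda>_. cgauss))"
      using k unfolding I by (subst distr_trunc[symmetric]) (auto simp: integral_distr)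
    also have "\<dots> = (\<integral>x. (\<integral>y. F (x(k := y)) \<partial>cgauss) \<partial>PiM ?I (\<lambda>_. cgauss))"
      by (rule product_integral_insert[OF _ _ i]) auto
    finally show ?thesis .
  qed
  have c: "(\<lambda>x. x k) \<in> measurable (PiM {1..m} (\<lambda>_. borel)) (borel :: complex measure)"
    using k by (intro measurable_component_singleton) auto
  have Nk: "N k \<omega> = trunc m \<omega> k" for \<omega> using k by (simp add: trunc_def)
  have "(\<integral>\<omega>. N k \<omega> * G (trunc m \<omega>) \<partial>P) =
     (\<integral>x. (\<integral>y. y * G (x(k := y)) \<partial>cgauss) \<partial>PiM ?I (\<lambda>_. cgauss))"
    using fub[of "\<lambda>x. x k * G x"] int(1) c unfolding Nk by simp
  also have "\<dots> = (\<integral>x. (\<integral>y. q (x(k := y)) \<partial>cgauss) \<partial>PiM ?I (\<lambda>_. cgauss))"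
  proof (rule Bochner_Integration.integral_cong[OF refl])
    fix x
    show "(\<integral>y. y * G (x(k := y)) \<partial>cgauss) = (\<integral>y. q (x(k := y)) \<partial>cgauss)"
      using w unfolding wirtinger_def by (intro cgauss_ibp[where p = "\<lambda>y. p (x(k := y))"]) auto
  qed
  also have "\<dots> = (\<integral>\<omega>. q (trunc m \<omega>) \<partial>P)"
    using int(2) by (intro fub[symmetric]) auto
  finally show ?thesis .
qed

lemma all_moments_N: "k \<ge> 1 \<Longrightarrow> all_moments (N k)"
  unfolding all_moments_def
proof (intro conjI allI)
  fix p assume k: "k \<ge> 1"
  then show "N k \<in> borel_measurable P" by simp
  have "poly_growth (\<lambda>y::complex. complex_of_real (cmod y ^ p))"
    by (rule poly_growthI[where C = 1 and d = p]) (auto intro!: continuous_intros power_mono simp: norm_power)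
  from integrable_norm[OF integrable_cgauss_poly_growth[OF this]]
  have "integrable cgauss (\<lambda>y. cmod y ^ p)" by (simp add: norm_power)
  then show "integrable P (\<lambda>\<omega>. cmod (N k \<omega>) ^ p)"
    using k unfolding distr_N[OF k, symmetric] by (subst (asm) integrable_distr_eq) auto
qed

lemma c_euler: "of_nat n * c n \<omega> = (\<Sum>k=1..n. of_real (real k * sqrt (\<theta> / real k)) * N k \<omega> * c (n - k) \<omega>)"
  unfolding c_def by (rule sec_euler)

lemma c_0 [simp]: "c 0 \<omega> = 1"
  by (simp add: c_def)

lemma all_moments_c: "all_moments (c n)"
proof (induction n rule: less_induct)
  case (less n)
  show ?case
  proof (cases "n = 0")
    case False
    have "all_moments (\<lambda>\<omega>. (1 / of_nat n) * (\<Sum>k=1..n. of_real (real k * sqrt (\<theta> / real k)) * N k \<omega> * c (n - k) \<omega>))"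
      using less False by (intro all_moments_mult all_moments_sum all_moments_N all_moments_const) auto
    moreover have "c n = (\<lambda>\<omega>. (1 / of_nat n) * (\<Sum>k=1..n. of_real (real k * sqrt (\<theta> / real k)) * N k \<omega> * c (n - k) \<omega>))"
      unfolding c_euler[symmetric] using False by auto
    ultimately show ?thesis by simp
  qed (simp add: c_def cong: measurable_cong)
qed

text \<open>Expand a * c_a by the Euler recursion and integrate by parts in each N_k. The
  accompanying factor c_(a-k) is holomorphic, so the conjugate derivative only hits \<Phi>. The
  second moments, the fourth moments and the Stein identity are all instances of this formula with
  different choices of \<Phi>.\<close>

lemma ibp_euler:
  assumes am: "a \<le> m" and w: "\<And>k. k \<in> {1..a} \<Longrightarrow> wirtinger k \<Phi> (p k) (q k)"
    and meas: "\<Phi> \<in> borel_measurable (PiM {1..m} (\<lambda>_. borel))"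
      "\<And>k. k \<in> {1..a} \<Longrightarrow> q k \<in> borel_measurable (PiM {1..m} (\<lambda>_. borel))"
    and mom: "all_moments (\<lambda>\<omega>. \<Phi> (trunc m \<omega>))" "\<And>k. k \<in> {1..a} \<Longrightarrow> all_moments (\<lambda>\<omega>. q k (trunc m \<omega>))"
  shows "of_nat a * (\<integral>\<omega>. c a \<omega> * \<Phi> (trunc m \<omega>) \<partial>P) =
    (\<Sum>k=1..a. of_real (real k * sqrt (\<theta> / real k)) * (\<integral>\<omega>. c (a - k) \<omega> * q k (trunc m \<omega>) \<partial>P))"
proof -
  have int: "integrable P (\<lambda>\<omega>. N k \<omega> * (c (a - k) \<omega> * \<Phi> (trunc m \<omega>)))" if "k \<in> {1..a}" for k
    using that by (intro all_moments_integrable all_moments_mult all_moments_N all_moments_c mom) auto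
  have "of_nat a * (\<integral>\<omega>. c a \<omega> * \<Phi> (trunc m \<omega>) \<partial>P) = (\<integral>\<omega>. (of_nat a * c a \<omega>) * \<Phi> (trunc m \<omega>) \<partial>P)"
    by (simp add: mult.assoc)
  also have "\<dots> = (\<integral>\<omega>. (\<Sum>k=1..a. of_real (real k * sqrt (\<theta> / real k)) * (N k \<omega> * (c (a - k) \<omega> * \<Phi> (trunc m \<omega>)))) \<partial>P)"
    unfolding c_euler sum_distrib_right by (simp add: mult_ac)
  also have "\<dots> = (\<Sum>k=1..a. of_real (real k * sqrt (\<theta> / real k)) * (\<integral>\<omega>. N k \<omega> * (c (a - k) \<omega> * \<Phi> (trunc m \<omega>)) \<partial>P))"
    by (subst Bochner_Integration.integral_sum) (auto intro!: integrable_mult_right int)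
  also have "\<dots> = (\<Sum>k=1..a. of_real (real k * sqrt (\<theta> / real k)) * (\<integral>\<omega>. c (a - k) \<omega> * q k (trunc m \<omega>) \<partial>P))"
  proof (intro sum.cong refl arg_cong2[where f = "(*)"])
    fix k assume k: "k \<in> {1..a}"
    have w': "wirtinger k (\<lambda>x. sec \<theta> (a - k) x * \<Phi> x)
        (\<lambda>x. dsec \<theta> k (a - k) x * \<Phi> x + sec \<theta> (a - k) x * p k x) (\<lambda>x. 0 * \<Phi> x + sec \<theta> (a - k) x * q k x)"
      using k by (intro wirtinger_mult wirtinger_sec w) auto
    have "(\<integral>\<omega>. N k \<omega> * (sec \<theta> (a - k) (trunc m \<omega>) * \<Phi> (trunc m \<omega>)) \<partial>P) =
      (\<integral>\<omega>. 0 * \<Phi> (trunc m \<omega>) + sec \<theta> (a - k) (trunc m \<omega>) * q k (trunc m \<omega>) \<partial>P)"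
    proof (rule ibp[OF _ _ w'])
      show "integrable P (\<lambda>\<omega>. N k \<omega> * (sec \<theta> (a - k) (trunc m \<omega>) * \<Phi> (trunc m \<omega>)))"
        using int[OF k] am by simp
      have "integrable P (\<lambda>\<omega>. c (a - k) \<omega> * q k (trunc m \<omega>))"
        using k by (intro all_moments_integrable all_moments_mult all_moments_c mom) auto
      then show "integrable P (\<lambda>\<omega>. 0 * \<Phi> (trunc m \<omega>) + sec \<theta> (a - k) (trunc m \<omega>) * q k (trunc m \<omega>))"
        using am by simp
    qed (use k am in \<open>auto intro!: borel_measurable_times measurable_sec meas\<close>)
    then show "(\<integral>\<omega>. N k \<omega> * (c (a - k) \<omega> * \<Phi> (trunc m \<omega>)) \<partial>P) = (\<integral>\<omega>. c (a - k) \<omega> * q k (trunc m \<omega>) \<partial>P)"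
      using am by simp
  qed
  finally show ?thesis .
qed

end

section \<open>Fourth moments\<close>

text \<open>The sum runs over 2 by 2 tables of naturals with rows (i, a - i) and (k, e - k) and
  column sums b and d. It is the value of E(c_a conj(c_b) c_e conj(c_d)), see
  \<open>mom4_eq\<close>.\<close>

definition four_wt :: "real \<Rightarrow> nat \<Rightarrow> nat \<Rightarrow> nat \<Rightarrow> nat \<Rightarrow> real" where
  "four_wt \<theta> a b e d = (\<Sum>i\<le>a. \<Sum>k\<le>e. if i + k = b \<and> (a - i) + (e - k) = d
     then gbinom_wt \<theta> i * gbinom_wt \<theta> (a - i) * gbinom_wt \<theta> k * gbinom_wt \<theta> (e - k) else 0)"

lemma four_wt_swap: "four_wt \<theta> a b e d = four_wt \<theta> e b a d"
  unfolding four_wt_def by (subst sum.swap) (auto intro!: sum.cong simp: add.commute mult_ac)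

text \<open>Expand i * \<open>gbinom_wt\<close> i by its own recursion and substitute i = j + r:
  removing r from the first entry lowers the first row sum and the first column sum by r.\<close>

lemma four_wt_euler1:
  "(\<Sum>i\<le>a. \<Sum>k\<le>e. if i + k = b \<and> (a - i) + (e - k) = d
     then real i * gbinom_wt \<theta> i * gbinom_wt \<theta> (a - i) * gbinom_wt \<theta> k * gbinom_wt \<theta> (e - k) else 0) =
   (\<Sum>r=1..a. \<theta> * (if r \<le> b then four_wt \<theta> (a - r) (b - r) e d else 0))"
proof -
  define X where "X i r = (\<Sum>k\<le>e. if i + k = b \<and> (a - i) + (e - k) = d
     then \<theta> * gbinom_wt \<theta> (i - r) * gbinom_wt \<theta> (a - i) * gbinom_wt \<theta> k * gbinom_wt \<theta> (e - k) else 0)" for i r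
  have "(\<Sum>i\<le>a. \<Sum>k\<le>e. if i + k = b \<and> (a - i) + (e - k) = d
     then real i * gbinom_wt \<theta> i * gbinom_wt \<theta> (a - i) * gbinom_wt \<theta> k * gbinom_wt \<theta> (e - k) else 0) =
     (\<Sum>i\<le>a. \<Sum>r=1..i. X i r)"
  proof (rule sum.cong[OF refl])
    fix i
    have "(\<Sum>r=1..i. X i r) = (\<Sum>k\<le>e. \<Sum>r=1..i. if i + k = b \<and> (a - i) + (e - k) = d
     then \<theta> * gbinom_wt \<theta> (i - r) * gbinom_wt \<theta> (a - i) * gbinom_wt \<theta> k * gbinom_wt \<theta> (e - k) else 0)"
      unfolding X_def by (rule sum.swap)
    also have "\<dots> = (\<Sum>k\<le>e. if i + k = b \<and> (a - i) + (e - k) = d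
     then real i * gbinom_wt \<theta> i * gbinom_wt \<theta> (a - i) * gbinom_wt \<theta> k * gbinom_wt \<theta> (e - k) else 0)"
      unfolding gbinom_wt_euler' sum_distrib_right by (intro sum.cong) auto
    finally show "(\<Sum>k\<le>e. if i + k = b \<and> (a - i) + (e - k) = d
     then real i * gbinom_wt \<theta> i * gbinom_wt \<theta> (a - i) * gbinom_wt \<theta> k * gbinom_wt \<theta> (e - k) else 0) = (\<Sum>r=1..i. X i r)" ..
  qed
  also have "\<dots> = (\<Sum>(i, r)\<in>(SIGMA i:{..a}. {1..i}). X i r)" by (rule sum.Sigma) auto
  also have "\<dots> = (\<Sum>(r, j)\<in>(SIGMA r:{1..a}. {..a - r}). X (j + r) r)"
    by (rule sum.reindex_bij_witness[of _ "\<lambda>(r, j). (j + r, r)" "\<lambda>(i, r). (r, i - r)"]) auto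
  also have "\<dots> = (\<Sum>r=1..a. \<Sum>j\<le>a - r. X (j + r) r)" by (rule sum.Sigma[symmetric]) auto
  also have "\<dots> = (\<Sum>r=1..a. \<theta> * (if r \<le> b then four_wt \<theta> (a - r) (b - r) e d else 0))"
  proof (rule sum.cong[OF refl])
    fix r assume r: "r \<in> {1..a}"
    show "(\<Sum>j\<le>a - r. X (j + r) r) = \<theta> * (if r \<le> b then four_wt \<theta> (a - r) (b - r) e d else 0)"
    proof (cases "r \<le> b")
      case True
      then have eq: "j + r + k = b \<longleftrightarrow> j + k = b - r" "a - (j + r) = a - r - j" for j k by auto
      show ?thesis using True unfolding X_def four_wt_def eq
        by (auto simp: sum_distrib_left intro!: sum.cong)
    next
      case False
      then show ?thesis unfolding X_def by (auto intro!: sum.neutral)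
    qed
  qed
  finally show ?thesis .
qed

text \<open>Swapping the two columns of the table turns the second entry of the first row into the
  first one.\<close>

lemma four_wt_euler2:
  "(\<Sum>i\<le>a. \<Sum>k\<le>e. if i + k = b \<and> (a - i) + (e - k) = d
     then real (a - i) * gbinom_wt \<theta> i * gbinom_wt \<theta> (a - i) * gbinom_wt \<theta> k * gbinom_wt \<theta> (e - k) else 0) =
   (\<Sum>i\<le>a. \<Sum>k\<le>e. if i + k = d \<and> (a - i) + (e - k) = b
     then real i * gbinom_wt \<theta> i * gbinom_wt \<theta> (a - i) * gbinom_wt \<theta> k * gbinom_wt \<theta> (e - k) else 0)"
  by (rule sum.reindex_bij_witness[of _ "\<lambda>i. a - i" "\<lambda>i. a - i"], simp_all)
     (rule sum.reindex_bij_witness[of _ "\<lambda>i. e - i" "\<lambda>i. e - i"], auto simp: mult_ac)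

lemma four_wt_reflect: "four_wt \<theta> a b e d = four_wt \<theta> a d e b"
  unfolding four_wt_def
  by (rule sum.reindex_bij_witness[of _ "\<lambda>i. a - i" "\<lambda>i. a - i"], simp_all)
     (rule sum.reindex_bij_witness[of _ "\<lambda>i. e - i" "\<lambda>i. e - i"], auto simp: mult_ac)

text \<open>Write a = i + (a - i) and treat the two entries of the first row separately. The result
  has the same shape as \<open>mom4_rec\<close>, which is what allows the moments to be identified
  by induction.\<close>

lemma four_wt_rec:
  "real a * four_wt \<theta> a b e d = (\<Sum>r=1..a. \<theta> * ((if r \<le> b then four_wt \<theta> (a - r) (b - r) e d else 0) +
     (if r \<le> d then four_wt \<theta> (a - r) b e (d - r) else 0)))"
proof -
  have "real a * four_wt \<theta> a b e d =
    (\<Sum>i\<le>a. \<Sum>k\<le>e. if i + k = b \<and> (a - i) + (e - k) = d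
       then real i * gbinom_wt \<theta> i * gbinom_wt \<theta> (a - i) * gbinom_wt \<theta> k * gbinom_wt \<theta> (e - k) else 0) +
    (\<Sum>i\<le>a. \<Sum>k\<le>e. if i + k = b \<and> (a - i) + (e - k) = d
       then real (a - i) * gbinom_wt \<theta> i * gbinom_wt \<theta> (a - i) * gbinom_wt \<theta> k * gbinom_wt \<theta> (e - k) else 0)"
    unfolding four_wt_def sum_distrib_left sum.distrib[symmetric]
    by (intro sum.cong refl) (auto simp: algebra_simps of_nat_diff)
  also have "\<dots> = (\<Sum>r=1..a. \<theta> * (if r \<le> b then four_wt \<theta> (a - r) (b - r) e d else 0)) +
     (\<Sum>r=1..a. \<theta> * (if r \<le> d then four_wt \<theta> (a - r) (d - r) e b else 0))"
    unfolding four_wt_euler2 four_wt_euler1 ..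
  also have "\<dots> = (\<Sum>r=1..a. \<theta> * ((if r \<le> b then four_wt \<theta> (a - r) (b - r) e d else 0) +
     (if r \<le> d then four_wt \<theta> (a - r) b e (d - r) else 0)))"
    unfolding sum.distrib[symmetric] by (intro sum.cong refl) (auto simp: algebra_simps four_wt_reflect[of _ _ "d - _"])
  finally show ?thesis .
qed

text \<open>When row and column sums agree, one entry determines the table: the off-diagonal entries
  are equal, both k here. Hence the square.\<close>

lemma four_wt_diag:
  "four_wt \<theta> n n m m = (\<Sum>k\<le>m. if k \<le> n then gbinom_wt \<theta> (n - k) * (gbinom_wt \<theta> k)\<^sup>2 * gbinom_wt \<theta> (m - k) else 0)"
proof -
  have "four_wt \<theta> n n m m = (\<Sum>k\<le>m. \<Sum>i\<le>n. if i = n - k then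
      (if k \<le> n then gbinom_wt \<theta> i * (gbinom_wt \<theta> k)\<^sup>2 * gbinom_wt \<theta> (m - k) else 0) else 0)"
    unfolding four_wt_def by (subst sum.swap) (auto intro!: sum.cong simp: power2_eq_square)
  also have "\<dots> = (\<Sum>k\<le>m. if k \<le> n then gbinom_wt \<theta> (n - k) * (gbinom_wt \<theta> k)\<^sup>2 * gbinom_wt \<theta> (m - k) else 0)"
    by (intro sum.cong refl) (simp add: sum.delta)
  finally show ?thesis .
qed

section \<open>Size of the binomial weights and summation of the fourth moments\<close>

lemma powr_Bernoulli:
  fixes y p :: real assumes "y > -1" "0 \<le> p" "p \<le> 1"
  shows "(1 + y) powr p \<le> 1 + p * y"
  using Youngs_inequality_0[of p "1 - p" "1 + y" 1] assms by (simp add: algebra_simps)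

text \<open>With m = n + 1 the ratio of consecutive weights is 1 - (1 - \<theta>)/m, while Bernoulli
  bounds (1 + 1/m)^(1-\<theta>) by 1 + (1 - \<theta>)/m. The product of the two is 1 minus a
  square.\<close>

lemma gbinom_wt_le:
  assumes "0 < \<theta>" "\<theta> < 1" shows "gbinom_wt \<theta> n \<le> real (Suc n) powr (\<theta> - 1)"
proof (induction n)
  case (Suc n)
  let ?m = "real (Suc n)"
  have m: "?m > 0" by simp
  have "1 / ?m > 0" by simp
  with assms have "(1 + 1 / ?m) powr (1 - \<theta>) \<le> 1 + (1 - \<theta>) * (1 / ?m)"
    by (intro powr_Bernoulli) linarith+
  then have "(1 - (1 - \<theta>) / ?m) * (1 + 1 / ?m) powr (1 - \<theta>) \<le> (1 - (1 - \<theta>) / ?m) * (1 + (1 - \<theta>) / ?m)"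
    using assms by (intro mult_left_mono) (auto simp: field_simps)
  also have "\<dots> = 1 - ((1 - \<theta>) / ?m)\<^sup>2" by (simp add: algebra_simps power2_eq_square)
  also have "\<dots> \<le> 1" by simp
  finally have "(1 - (1 - \<theta>) / ?m) * (1 + 1 / ?m) powr (1 - \<theta>) \<le> 1" .
  moreover have "1 + 1 / ?m = real (Suc (Suc n)) / ?m" by (simp add: field_simps)
  moreover have "(1 - (1 - \<theta>) / ?m) = (\<theta> + real n) / ?m" by (simp add: field_simps)
  ultimately have "(\<theta> + real n) / ?m * (real (Suc (Suc n)) powr (1 - \<theta>) / ?m powr (1 - \<theta>)) \<le> 1"
    by (simp add: powr_divide del: of_nat_Suc)
  then have le: "(\<theta> + real n) / ?m \<le> real (Suc (Suc n)) powr (\<theta> - 1) * ?m powr (1 - \<theta>)"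
    by (simp add: powr_diff field_simps del: of_nat_Suc)
  have "gbinom_wt \<theta> (Suc n) = gbinom_wt \<theta> n * ((\<theta> + real n) / ?m)" by (simp add: gbinom_wt_Suc)
  also have "\<dots> \<le> ?m powr (\<theta> - 1) * (real (Suc (Suc n)) powr (\<theta> - 1) * ?m powr (1 - \<theta>))"
    using assms by (intro mult_mono Suc le) auto
  also have "\<dots> = real (Suc (Suc n)) powr (\<theta> - 1) * (?m powr (\<theta> - 1) * ?m powr (1 - \<theta>))" by (simp add: mult_ac)
  also have "?m powr (\<theta> - 1) * ?m powr (1 - \<theta>) = 1" unfolding powr_add[symmetric] by simp
  finally show ?case by simp
qed simp

text \<open>By \<open>gbinom_wt_euler\<close> consecutive partial sums have ratio 1 + \<theta>/n,
  which dominates (1 + 1/n)^\<theta> by Bernoulli.\<close>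

lemma sum_gbinom_wt_ge:
  assumes "0 < \<theta>" "\<theta> < 1" shows "real n powr \<theta> \<le> (\<Sum>j<n. gbinom_wt \<theta> j)"
proof (induction n)
  case (Suc n)
  show ?case
  proof (cases "n = 0")
    case False
    then have n: "real n > 0" by simp
    then have "1 / real n > 0" by simp
    with assms have "(1 + 1 / real n) powr \<theta> \<le> 1 + \<theta> * (1 / real n)"
      by (intro powr_Bernoulli) linarith+
    moreover have "1 + 1 / real n = real (Suc n) / real n" using n by (simp add: field_simps)
    ultimately have "real (Suc n) powr \<theta> \<le> (1 + \<theta> / real n) * real n powr \<theta>"
      using n by (simp add: powr_divide field_simps)
    also have "\<dots> \<le> (1 + \<theta> / real n) * (\<Sum>j<n. gbinom_wt \<theta> j)"
      using assms by (intro mult_left_mono Suc) auto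
    also have "\<dots> = (\<Sum>j<Suc n. gbinom_wt \<theta> j)"
      using gbinom_wt_euler[of n \<theta>] n by (simp add: field_simps)
    finally show ?thesis .
  qed simp
qed simp

lemma gbinom_wt_ge:
  assumes "0 < \<theta>" "\<theta> < 1" "n \<ge> 1" shows "\<theta> * real n powr (\<theta> - 1) \<le> gbinom_wt \<theta> n"
proof -
  have "\<theta> * real n powr \<theta> \<le> real n * gbinom_wt \<theta> n"
    unfolding gbinom_wt_euler using assms by (intro mult_left_mono sum_gbinom_wt_ge) auto
  then show ?thesis using assms(3) by (simp add: powr_diff field_simps)
qed

lemma gbinom_wt_le_1: "0 < \<theta> \<Longrightarrow> \<theta> < 1 \<Longrightarrow> gbinom_wt \<theta> n \<le> 1"
  using gbinom_wt_le[of \<theta> n] powr_mono[of "\<theta> - 1" 0 "real (Suc n)"] by simp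

text \<open>The squares decay like k^(2\<theta> - 2), summable because \<theta> < 1/2. This is the
  point at which the range of \<theta> is restricted to this half of (0, 1).\<close>

lemma summable_gbinom_wt_sq:
  assumes "0 < \<theta>" "\<theta> < 1/2" shows "summable (\<lambda>k. (gbinom_wt \<theta> k)\<^sup>2)"
proof (rule summable_comparison_test')
  have "summable (\<lambda>k. real k powr (2 * (\<theta> - 1)))"
    using assms by (simp add: summable_real_powr_iff)
  then show "summable (\<lambda>k. real (Suc k) powr (2 * (\<theta> - 1)))" by (subst summable_Suc_iff)
  fix k
  have "(gbinom_wt \<theta> k)\<^sup>2 \<le> (real (Suc k) powr (\<theta> - 1))\<^sup>2"
    using assms gbinom_wt_pos[of \<theta> k] by (intro power_mono gbinom_wt_le) auto
  then show "norm ((gbinom_wt \<theta> k)\<^sup>2) \<le> real (Suc k) powr (2 * (\<theta> - 1))"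
    by (simp add: power2_eq_square powr_add[symmetric])
qed

text \<open>By \<open>four_wt_diag\<close> the indices n and m interact only through the common k,
  so for fixed k the double sum is a perfect square. Shifting n by k inside it only gains a factor
  x^k <= 1, which leaves the sum of squared weights times the squared mean energy.\<close>

lemma four_wt_sum_le:
  assumes \<theta>: "0 < \<theta>" "\<theta> < 1/2" and x: "0 \<le> x" "x \<le> 1"
  shows "(\<Sum>n<J. \<Sum>m<J. x ^ n * x ^ m * four_wt \<theta> n n m m) \<le>
    (\<Sum>k. (gbinom_wt \<theta> k)\<^sup>2) * (\<Sum>j<J. gbinom_wt \<theta> j * x ^ j)\<^sup>2"
proof -
  let ?g = "gbinom_wt \<theta>"
  have pos: "0 \<le> ?g k" for k using gbinom_wt_pos[of \<theta> k] \<theta> by simp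
  have "(\<Sum>n<J. \<Sum>m<J. x ^ n * x ^ m * four_wt \<theta> n n m m) =
     (\<Sum>n<J. \<Sum>m<J. \<Sum>k<J. (?g k)\<^sup>2 * ((if k \<le> n then x ^ n * ?g (n - k) else 0) * (if k \<le> m then x ^ m * ?g (m - k) else 0)))"
  proof (intro sum.cong refl)
    fix n m assume "n \<in> {..<J}" "m \<in> {..<J}"
    have "(\<Sum>k<J. (?g k)\<^sup>2 * ((if k \<le> n then x ^ n * ?g (n - k) else 0) * (if k \<le> m then x ^ m * ?g (m - k) else 0))) =
       (\<Sum>k\<le>m. (?g k)\<^sup>2 * ((if k \<le> n then x ^ n * ?g (n - k) else 0) * (if k \<le> m then x ^ m * ?g (m - k) else 0)))"
      using \<open>m \<in> {..<J}\<close> by (intro sum.mono_neutral_right) auto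
    also have "\<dots> = x ^ n * x ^ m * four_wt \<theta> n n m m"
      unfolding four_wt_diag sum_distrib_left by (intro sum.cong) (auto simp: algebra_simps)
    finally show "x ^ n * x ^ m * four_wt \<theta> n n m m =
       (\<Sum>k<J. (?g k)\<^sup>2 * ((if k \<le> n then x ^ n * ?g (n - k) else 0) * (if k \<le> m then x ^ m * ?g (m - k) else 0)))" ..
  qed
  also have "\<dots> = (\<Sum>n<J. \<Sum>k<J. \<Sum>m<J. (?g k)\<^sup>2 * ((if k \<le> n then x ^ n * ?g (n - k) else 0) * (if k \<le> m then x ^ m * ?g (m - k) else 0)))"
    by (intro sum.cong refl sum.swap)
  also have "\<dots> = (\<Sum>k<J. \<Sum>n<J. \<Sum>m<J. (?g k)\<^sup>2 * ((if k \<le> n then x ^ n * ?g (n - k) else 0) * (if k \<le> m then x ^ m * ?g (m - k) else 0)))"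
    by (rule sum.swap)
  also have "\<dots> = (\<Sum>k<J. (?g k)\<^sup>2 * (\<Sum>n<J. if k \<le> n then x ^ n * ?g (n - k) else 0)\<^sup>2)"
    unfolding power2_eq_square[of "sum _ _"] sum_product
    by (simp only: sum_distrib_left)
  also have "\<dots> \<le> (\<Sum>k<J. (?g k)\<^sup>2 * (\<Sum>j<J. ?g j * x ^ j)\<^sup>2)"
  proof (rule sum_mono, rule mult_left_mono, rule power_mono)
    fix k assume k: "k \<in> {..<J}"
    have "(\<Sum>n<J. if k \<le> n then x ^ n * ?g (n - k) else 0) = (\<Sum>n\<in>{k..<J}. x ^ n * ?g (n - k))"
      by (rule sum.mono_neutral_cong_right) auto
    also have "\<dots> = (\<Sum>j<J - k. x ^ (j + k) * ?g j)"
      by (rule sum.reindex_bij_witness[of _ "\<lambda>j. j + k" "\<lambda>n. n - k"]) auto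
    also have "\<dots> \<le> (\<Sum>j<J - k. ?g j * x ^ j)"
    proof (rule sum_mono)
      fix j
      have "x ^ (j + k) \<le> x ^ j" using x by (intro power_decreasing) auto
      then show "x ^ (j + k) * ?g j \<le> ?g j * x ^ j" by (subst mult.commute[of "?g j"]) (intro mult_right_mono pos)
    qed
    also have "\<dots> \<le> (\<Sum>j<J. ?g j * x ^ j)" using pos x by (intro sum_mono2) auto
    finally show "(\<Sum>n<J. if k \<le> n then x ^ n * ?g (n - k) else 0) \<le> (\<Sum>j<J. ?g j * x ^ j)" .
    show "0 \<le> (\<Sum>n<J. if k \<le> n then x ^ n * ?g (n - k) else 0)" using pos x by (intro sum_nonneg) auto
  qed auto
  also have "\<dots> \<le> (\<Sum>k. (?g k)\<^sup>2) * (\<Sum>j<J. ?g j * x ^ j)\<^sup>2"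
    unfolding sum_distrib_right[symmetric] using summable_gbinom_wt_sq[OF \<theta>]
    by (intro mult_right_mono sum_le_suminf) auto
  finally show ?thesis .
qed

section \<open>Second and fourth moments of the coefficients\<close>

context secular_chaos
begin

lemma coeff_sq: "k \<ge> 1 \<Longrightarrow> real k * sqrt (\<theta> / real k) * sqrt (\<theta> / real k) = \<theta>"
  using theta_pos by (simp add: mult.assoc)

lemma coeff_sq_complex:
  "k \<ge> 1 \<Longrightarrow> of_real (real k * sqrt (\<theta> / real k)) * (of_real (sqrt (\<theta> / real k)) * z) = of_real \<theta> * (z :: complex)"
  by (simp only: mult.assoc[symmetric] of_real_mult[symmetric] coeff_sq)

lemma measurable_dsec: "n \<le> m \<Longrightarrow> dsec \<theta> k n \<in> borel_measurable (PiM {1..m} (\<lambda>_. borel))"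
  unfolding dsec_def[abs_def] by (cases "k \<le> n") (auto intro!: measurable_sec borel_measurable_times)

lemma measurable_cnj: "f \<in> borel_measurable A \<Longrightarrow> (\<lambda>x. cnj (f x)) \<in> borel_measurable A"
  by (simp add: borel_measurable_complex_iff)

definition dc :: "nat \<Rightarrow> nat \<Rightarrow> 'a \<Rightarrow> complex" where
  "dc k n \<omega> = (if k \<le> n then of_real (sqrt (\<theta> / real k)) * c (n - k) \<omega> else 0)"

lemma dsec_trunc [simp]: "n \<le> m \<Longrightarrow> dsec \<theta> k n (trunc m \<omega>) = dc k n \<omega>"
  by (simp add: dsec_def dc_def)

lemma all_moments_dc: "all_moments (dc k n)"
  unfolding dc_def[abs_def] by (cases "k \<le> n") (auto intro!: all_moments_mult all_moments_c)

text \<open>With \<Phi> the conjugate of c_n, \<open>ibp_euler\<close> expresses n E|c_n|^2 as the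
  sum of \<theta> E|c_(n-k)|^2 over k from 1 to n, the recursion of the weights.\<close>

lemma second_moment_complex: "(\<integral>\<omega>. c n \<omega> * cnj (c n \<omega>) \<partial>P) = of_real (gbinom_wt \<theta> n)"
proof (induction n rule: less_induct)
  case (less n)
  show ?case
  proof (cases "n = 0")
    case False
    have "of_nat n * (\<integral>\<omega>. c n \<omega> * cnj (sec \<theta> n (trunc n \<omega>)) \<partial>P) =
       (\<Sum>k=1..n. of_real (real k * sqrt (\<theta> / real k)) * (\<integral>\<omega>. c (n - k) \<omega> * cnj (dsec \<theta> k n (trunc n \<omega>)) \<partial>P))"
      by (rule ibp_euler[OF _ wirtinger_cnj[OF wirtinger_sec]])
         (auto intro!: measurable_cnj measurable_sec measurable_dsec all_moments_cnj all_moments_c all_moments_dc)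
    also have "\<dots> = (\<Sum>k=1..n. of_real \<theta> * (\<integral>\<omega>. c (n - k) \<omega> * cnj (c (n - k) \<omega>) \<partial>P))"
    proof (intro sum.cong refl)
      fix k assume k: "k \<in> {1..n}"
      have "(\<integral>\<omega>. c (n - k) \<omega> * cnj (dsec \<theta> k n (trunc n \<omega>)) \<partial>P) =
        of_real (sqrt (\<theta> / real k)) * (\<integral>\<omega>. c (n - k) \<omega> * cnj (c (n - k) \<omega>) \<partial>P)"
        using k by (subst integral_mult_right_zero[symmetric]) (auto simp: dc_def mult_ac)
      then show "of_real (real k * sqrt (\<theta> / real k)) * (\<integral>\<omega>. c (n - k) \<omega> * cnj (dsec \<theta> k n (trunc n \<omega>)) \<partial>P) =
        of_real \<theta> * (\<integral>\<omega>. c (n - k) \<omega> * cnj (c (n - k) \<omega>) \<partial>P)"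
        using k by (simp only: coeff_sq_complex atLeastAtMost_iff)
    qed
    also have "\<dots> = of_real (\<Sum>k=1..n. \<theta> * gbinom_wt \<theta> (n - k))"
      using less by simp
    also have "\<dots> = of_nat n * of_real (gbinom_wt \<theta> n)" unfolding gbinom_wt_euler'[symmetric] by simp
    finally show ?thesis using False by simp
  qed (simp add: prob_space)
qed

lemma integrable_c_sq: "integrable P (\<lambda>\<omega>. (cmod (c n \<omega>))\<^sup>2)"
  using all_moments_power[OF all_moments_c] .

lemma second_moment: "(\<integral>\<omega>. (cmod (c n \<omega>))\<^sup>2 \<partial>P) = gbinom_wt \<theta> n"
proof -
  have "complex_of_real (\<integral>\<omega>. (cmod (c n \<omega>))\<^sup>2 \<partial>P) = (\<integral>\<omega>. c n \<omega> * cnj (c n \<omega>) \<partial>P)"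
    by (simp only: complex_norm_square[symmetric] integral_complex_of_real)
  then show ?thesis unfolding second_moment_complex by (simp only: of_real_eq_iff)
qed

text \<open>The second factor is holomorphic, so every conjugate derivative produced by
  \<open>ibp_euler\<close> is 0.\<close>

lemma c_mult_integral_0: "b > 0 \<Longrightarrow> (\<integral>\<omega>. c b \<omega> * c d \<omega> \<partial>P) = 0"
proof -
  assume b: "b > 0"
  have "of_nat b * (\<integral>\<omega>. c b \<omega> * sec \<theta> d (trunc (b + d) \<omega>) \<partial>P) =
       (\<Sum>k=1..b. of_real (real k * sqrt (\<theta> / real k)) * (\<integral>\<omega>. c (b - k) \<omega> * 0 \<partial>P))"
    by (rule ibp_euler[OF _ wirtinger_sec])
       (auto intro!: measurable_sec all_moments_c)
  then show ?thesis using b by simp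
qed

text \<open>The bracketing isolates the first factor, leaving the other three to play the part of
  \<Phi> in \<open>ibp_euler\<close>.\<close>

definition mom4 :: "nat \<Rightarrow> nat \<Rightarrow> nat \<Rightarrow> nat \<Rightarrow> complex" where
  "mom4 a b e d = (\<integral>\<omega>. c a \<omega> * (cnj (c b \<omega>) * c e \<omega> * cnj (c d \<omega>)) \<partial>P)"

text \<open>Only the two conjugated factors have a nonzero conjugate derivative, hence two terms on
  the right, with b or d lowered by r.\<close>

lemma mom4_rec:
  "of_nat a * mom4 a b e d = (\<Sum>r=1..a. of_real \<theta> * ((if r \<le> b then mom4 (a - r) (b - r) e d else 0) +
     (if r \<le> d then mom4 (a - r) b e (d - r) else 0)))"
proof -
  \<comment> \<open>One truncation level large enough for all four indices at once.\<close>
  let ?m = "a + b + e + d"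
  have "of_nat a * (\<integral>\<omega>. c a \<omega> * (cnj (sec \<theta> b (trunc ?m \<omega>)) * sec \<theta> e (trunc ?m \<omega>) * cnj (sec \<theta> d (trunc ?m \<omega>))) \<partial>P) =
    (\<Sum>k=1..a. of_real (real k * sqrt (\<theta> / real k)) * (\<integral>\<omega>. c (a - k) \<omega> *
      ((cnj (dsec \<theta> k b (trunc ?m \<omega>)) * sec \<theta> e (trunc ?m \<omega>) + cnj (sec \<theta> b (trunc ?m \<omega>)) * 0) * cnj (sec \<theta> d (trunc ?m \<omega>)) +
       (cnj (sec \<theta> b (trunc ?m \<omega>)) * sec \<theta> e (trunc ?m \<omega>)) * cnj (dsec \<theta> k d (trunc ?m \<omega>))) \<partial>P))"
    by (rule ibp_euler[OF _ wirtinger_mult[OF wirtinger_mult[OF wirtinger_cnj[OF wirtinger_sec] wirtinger_sec] wirtinger_cnj[OF wirtinger_sec]]])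
       (auto intro!: measurable_cnj measurable_sec measurable_dsec borel_measurable_times borel_measurable_add
         all_moments_mult all_moments_add all_moments_cnj all_moments_c all_moments_dc)
  also have "\<dots> = (\<Sum>r=1..a. of_real \<theta> * ((if r \<le> b then mom4 (a - r) (b - r) e d else 0) +
     (if r \<le> d then mom4 (a - r) b e (d - r) else 0)))"
  proof (intro sum.cong refl)
    fix k assume k: "k \<in> {1..a}"
    let ?s = "complex_of_real (sqrt (\<theta> / real k))"
    have i1: "integrable P (\<lambda>\<omega>. ?s * (if k \<le> b then c (a - k) \<omega> * (cnj (c (b - k) \<omega>) * c e \<omega> * cnj (c d \<omega>)) else 0))"
      and i2: "integrable P (\<lambda>\<omega>. ?s * (if k \<le> d then c (a - k) \<omega> * (cnj (c b \<omega>) * c e \<omega> * cnj (c (d - k) \<omega>)) else 0))"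
      by (cases "k \<le> b"; cases "k \<le> d"; auto intro!: all_moments_integrable all_moments_mult all_moments_cnj all_moments_c)+
    have "(\<integral>\<omega>. c (a - k) \<omega> *
      ((cnj (dsec \<theta> k b (trunc ?m \<omega>)) * sec \<theta> e (trunc ?m \<omega>) + cnj (sec \<theta> b (trunc ?m \<omega>)) * 0) * cnj (sec \<theta> d (trunc ?m \<omega>)) +
       (cnj (sec \<theta> b (trunc ?m \<omega>)) * sec \<theta> e (trunc ?m \<omega>)) * cnj (dsec \<theta> k d (trunc ?m \<omega>))) \<partial>P) =
     (\<integral>\<omega>. ?s * (if k \<le> b then c (a - k) \<omega> * (cnj (c (b - k) \<omega>) * c e \<omega> * cnj (c d \<omega>)) else 0) +
       ?s * (if k \<le> d then c (a - k) \<omega> * (cnj (c b \<omega>) * c e \<omega> * cnj (c (d - k) \<omega>)) else 0) \<partial>P)"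
      by (intro Bochner_Integration.integral_cong) (auto simp: dc_def algebra_simps)
    also have "\<dots> = ?s * ((if k \<le> b then mom4 (a - k) (b - k) e d else 0) + (if k \<le> d then mom4 (a - k) b e (d - k) else 0))"
      unfolding Bochner_Integration.integral_add[OF i1 i2] mom4_def by (auto simp: algebra_simps)
    finally show "of_real (real k * sqrt (\<theta> / real k)) * (\<integral>\<omega>. c (a - k) \<omega> *
      ((cnj (dsec \<theta> k b (trunc ?m \<omega>)) * sec \<theta> e (trunc ?m \<omega>) + cnj (sec \<theta> b (trunc ?m \<omega>)) * 0) * cnj (sec \<theta> d (trunc ?m \<omega>)) +
       (cnj (sec \<theta> b (trunc ?m \<omega>)) * sec \<theta> e (trunc ?m \<omega>)) * cnj (dsec \<theta> k d (trunc ?m \<omega>))) \<partial>P) =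
      of_real \<theta> * ((if k \<le> b then mom4 (a - k) (b - k) e d else 0) + (if k \<le> d then mom4 (a - k) b e (d - k) else 0))"
      using k by (simp only: coeff_sq_complex atLeastAtMost_iff)
  qed
  finally show ?thesis unfolding mom4_def by simp
qed

lemma mom4_swap: "mom4 a b e d = mom4 e b a d"
  unfolding mom4_def by (simp add: mult_ac)

text \<open>If a > 0, both sides obey the same recursion. If only e > 0, the symmetry exchanging the
  two unconjugated factors reduces to that case. If a = e = 0, the conjugate of E(c_b c_d) remains,
  which vanishes unless b = d = 0.\<close>

lemma mom4_eq: "mom4 a b e d = of_real (four_wt \<theta> a b e d)"
proof (induction "a + e" arbitrary: a b e d rule: less_induct)
  case less
  have step: "mom4 a b e d = of_real (four_wt \<theta> a b e d)"
    if "a > 0" and IH: "\<And>a' b' e' d'. a' + e' < a + e \<Longrightarrow> mom4 a' b' e' d' = of_real (four_wt \<theta> a' b' e' d')"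
    for a b e d
  proof -
    have "of_nat a * mom4 a b e d = of_nat a * complex_of_real (four_wt \<theta> a b e d)"
    proof -
      have "of_nat a * mom4 a b e d = of_real (real a * four_wt \<theta> a b e d)"
        unfolding mom4_rec four_wt_rec of_real_sum
        by (intro sum.cong refl) (auto simp: IH)
      then show ?thesis by simp
    qed
    then show ?thesis using \<open>a > 0\<close> by simp
  qed
  consider "a > 0" | "e > 0" | "a = 0" "e = 0" by blast
  then show ?case
  proof cases
    case 1
    then show ?thesis by (rule step) (rule less)
  next
    case 2
    then have "mom4 e b a d = of_real (four_wt \<theta> e b a d)"
      by (rule step) (rule less, simp)
    then show ?thesis by (simp add: mom4_swap[of a] four_wt_swap[of \<theta> a])
  next
    case 3
    have cnj: "(\<integral>\<omega>. cnj (c b \<omega>) * cnj (c d \<omega>) \<partial>P) = cnj (\<integral>\<omega>. c b \<omega> * c d \<omega> \<partial>P)"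
      unfolding complex_cnj_mult[symmetric] by (rule Bochner_Integration.integral_cnj)
    have "mom4 a b e d = cnj (\<integral>\<omega>. c b \<omega> * c d \<omega> \<partial>P)"
      unfolding mom4_def 3 cnj[symmetric] by simp
    also have "\<dots> = of_real (four_wt \<theta> a b e d)"
      using c_mult_integral_0[of b d] c_mult_integral_0[of d b] 3
      by (cases "b = 0"; cases "d = 0") (auto simp: four_wt_def prob_space mult.commute)
    finally show ?thesis .
  qed
qed

lemma fourth_moment:
  "(\<integral>\<omega>. (cmod (c n \<omega>))\<^sup>2 * (cmod (c m \<omega>))\<^sup>2 \<partial>P) = four_wt \<theta> n n m m"
proof -
  have "complex_of_real (\<integral>\<omega>. (cmod (c n \<omega>))\<^sup>2 * (cmod (c m \<omega>))\<^sup>2 \<partial>P) = mom4 n n m m"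
    unfolding mom4_def integral_complex_of_real[symmetric] of_real_mult complex_norm_square by (simp add: mult_ac)
  then show ?thesis unfolding mom4_eq by (simp only: of_real_eq_iff)
qed

lemma integrable_c_sq_mult: "integrable P (\<lambda>\<omega>. (cmod (c n \<omega>))\<^sup>2 * (cmod (c m \<omega>))\<^sup>2)"
proof -
  have "integrable P (\<lambda>\<omega>. cmod (c n \<omega> * c m \<omega>) ^ 2)"
    by (intro all_moments_power all_moments_mult all_moments_c)
  then show ?thesis by (simp add: norm_mult power_mult_distrib)
qed

text \<open>Relative to the square of its mean, the second moment of the truncated energy is bounded
  by a constant depending only on \<theta>. The truncation at J is removed afterwards by
  Fatou.\<close>

lemma
  assumes "0 \<le> x" "x \<le> 1"
  shows energy_L2: "(\<integral>\<omega>. (\<Sum>j<J. (cmod (c j \<omega>))\<^sup>2 * x ^ j)\<^sup>2 \<partial>P) \<le>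
      (\<Sum>k. (gbinom_wt \<theta> k)\<^sup>2) * (\<Sum>j<J. gbinom_wt \<theta> j * x ^ j)\<^sup>2"
    and integrable_energy_sq: "integrable P (\<lambda>\<omega>. (\<Sum>j<J. (cmod (c j \<omega>))\<^sup>2 * x ^ j)\<^sup>2)"
proof -
  have eq: "(\<Sum>j<J. (cmod (c j \<omega>))\<^sup>2 * x ^ j)\<^sup>2 =
    (\<Sum>n<J. \<Sum>m<J. x ^ n * x ^ m * ((cmod (c n \<omega>))\<^sup>2 * (cmod (c m \<omega>))\<^sup>2))" for \<omega>
    unfolding power2_eq_square[of "sum _ _"] sum_product by (intro sum.cong refl) (simp add: mult_ac)
  show "integrable P (\<lambda>\<omega>. (\<Sum>j<J. (cmod (c j \<omega>))\<^sup>2 * x ^ j)\<^sup>2)"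
    unfolding eq by (intro Bochner_Integration.integrable_sum integrable_mult_right integrable_c_sq_mult)
  have "(\<integral>\<omega>. (\<Sum>j<J. (cmod (c j \<omega>))\<^sup>2 * x ^ j)\<^sup>2 \<partial>P) = (\<Sum>n<J. \<Sum>m<J. x ^ n * x ^ m * four_wt \<theta> n n m m)"
    unfolding eq fourth_moment[symmetric]
    by (subst Bochner_Integration.integral_sum, intro Bochner_Integration.integrable_sum integrable_mult_right integrable_c_sq_mult,
        rule sum.cong[OF refl], subst Bochner_Integration.integral_sum)
       (auto intro!: integrable_mult_right integrable_c_sq_mult)
  also have "\<dots> \<le> (\<Sum>k. (gbinom_wt \<theta> k)\<^sup>2) * (\<Sum>j<J. gbinom_wt \<theta> j * x ^ j)\<^sup>2"
    by (rule four_wt_sum_le[OF theta_pos theta_lt assms])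
  finally show "(\<integral>\<omega>. (\<Sum>j<J. (cmod (c j \<omega>))\<^sup>2 * x ^ j)\<^sup>2 \<partial>P) \<le>
      (\<Sum>k. (gbinom_wt \<theta> k)\<^sup>2) * (\<Sum>j<J. gbinom_wt \<theta> j * x ^ j)\<^sup>2" .
qed

end

section \<open>The Stein bound\<close>

lemma norm_integral_le:
  fixes f :: "'a \<Rightarrow> 'b::{banach, second_countable_topology}"
  assumes "integrable M f" "integrable M g" "\<And>x. norm (f x) \<le> g x"
  shows "norm (\<integral>x. f x \<partial>M) \<le> (\<integral>x. g x \<partial>M)"
  using integral_norm_bound[of M f] integral_mono[OF integrable_norm[OF assms(1)] assms(2)] assms(3)
  by (meson order_trans)

lemma (in prob_space) expectation_increment_bound:
  fixes f f' :: "real \<Rightarrow> 'a \<Rightarrow> complex"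
  assumes der: "\<And>\<omega> s. ((\<lambda>s. f s \<omega>) has_vector_derivative f' s \<omega>) (at s)"
    and cont: "\<And>\<omega>. continuous_on UNIV (\<lambda>s. f' s \<omega>)"
    and meas [measurable]: "(\<lambda>(s, \<omega>). f' s \<omega>) \<in> borel_measurable (lborel \<Otimes>\<^sub>M M)"
    and bound: "\<And>s \<omega>. s \<in> {0..1} \<Longrightarrow> norm (f' s \<omega>) \<le> w \<omega>" and w: "integrable M w"
    and int: "integrable M (f 0)" "integrable M (f 1)"
    and B: "\<And>s. s \<in> {0..1} \<Longrightarrow> norm (\<integral>\<omega>. f' s \<omega> \<partial>M) \<le> B"
  shows "norm ((\<integral>\<omega>. f 1 \<omega> \<partial>M) - (\<integral>\<omega>. f 0 \<omega> \<partial>M)) \<le> B"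
proof -
  interpret pair_sigma_finite "lborel :: real measure" M ..
  let ?F = "\<lambda>s \<omega>. indicat_real {0..1} s *\<^sub>R f' s \<omega>"
  have [measurable]: "f' s \<in> borel_measurable M" for s
    using measurable_compose[OF measurable_Pair1' meas, of s] by simp
  have [measurable]: "w \<in> borel_measurable M" using w by simp
  have int_ind: "integrable lborel (indicat_real {0..1::real})" by (intro integrable_real_indicator) auto
  have intF: "integrable (lborel \<Otimes>\<^sub>M M) (\<lambda>(s, \<omega>). ?F s \<omega>)"
  proof (rule Bochner_Integration.integrable_bound)
    show "integrable (lborel \<Otimes>\<^sub>M M) (\<lambda>x. indicat_real {0..1::real} (fst x) * \<bar>w (snd x)\<bar>)"
    proof (rule Fubini_integrable)
      show "integrable lborel (\<lambda>s. \<integral>\<omega>. norm (indicat_real {0..1::real} (fst (s, \<omega>)) * \<bar>w (snd (s, \<omega>))\<bar>) \<partial>M)"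
        by (simp add: abs_mult)
    qed (use w in auto)
    show "AE x in lborel \<Otimes>\<^sub>M M. norm (case x of (s, \<omega>) \<Rightarrow> ?F s \<omega>) \<le>
        norm (indicat_real {0..1::real} (fst x) * \<bar>w (snd x)\<bar>)"
      by (rule AE_I2) (auto simp: indicator_def intro!: order_trans[OF bound abs_ge_self])
  qed measurable
  have "(\<integral>\<omega>. f 1 \<omega> \<partial>M) - (\<integral>\<omega>. f 0 \<omega> \<partial>M) = (\<integral>\<omega>. f 1 \<omega> - f 0 \<omega> \<partial>M)"
    using int by simp
  also have "\<dots> = (\<integral>\<omega>. (\<integral>s. ?F s \<omega> \<partial>lborel) \<partial>M)"
  proof (rule Bochner_Integration.integral_cong[OF refl])
    fix \<omega>
    show "f 1 \<omega> - f 0 \<omega> = (\<integral>s. ?F s \<omega> \<partial>lborel)"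
      by (rule integral_FTC_Icc[symmetric])
         (auto intro: has_vector_derivative_at_within der continuous_on_subset[OF cont])
  qed
  also have "\<dots> = (\<integral>s. (\<integral>\<omega>. ?F s \<omega> \<partial>M) \<partial>lborel)"
    by (rule Fubini_integral[OF intF])
  finally have eq: "(\<integral>\<omega>. f 1 \<omega> \<partial>M) - (\<integral>\<omega>. f 0 \<omega> \<partial>M) = (\<integral>s. (\<integral>\<omega>. ?F s \<omega> \<partial>M) \<partial>lborel)" .
  have "norm (\<integral>s. (\<integral>\<omega>. ?F s \<omega> \<partial>M) \<partial>lborel) \<le> (\<integral>s. indicat_real {0..1::real} s * B \<partial>lborel)"
  proof (rule norm_integral_le)
    show "integrable lborel (\<lambda>s. \<integral>\<omega>. ?F s \<omega> \<partial>M)" using integrable_fst[OF intF] .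
    show "integrable lborel (\<lambda>s. indicat_real {0..1::real} s * B)" using int_ind by simp
  qed (use B in \<open>auto simp: indicator_def\<close>)
  also have "\<dots> = B" by simp
  finally show ?thesis unfolding eq .
qed

section \<open>The interpolating functions and their Stein identity\<close>

context secular_chaos
begin

definition total :: "nat \<Rightarrow> real" where "total n = (\<Sum>j<n. gbinom_wt \<theta> j)"

text \<open>\<open>total n\<close> equals n * \<open>gbinom_wt\<close> \<theta> n / \<theta> by
  \<open>gbinom_wt_euler\<close>, so for n >= 1 this is V_n / E|c_n|^2, normalised to mean
  1.\<close>

definition mass :: "nat \<Rightarrow> 'a \<Rightarrow> real" where
  "mass n \<omega> = (\<Sum>j<n. (cmod (c j \<omega>))\<^sup>2) / total n"

definition nc :: "nat \<Rightarrow> 'a \<Rightarrow> complex" where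
  "nc n \<omega> = c n \<omega> / of_real (sqrt (gbinom_wt \<theta> n))"

lemma total_pos: "n \<ge> 1 \<Longrightarrow> total n \<ge> 1"
proof -
  assume n: "n \<ge> 1"
  have "(\<Sum>j<1. gbinom_wt \<theta> j) \<le> total n"
    unfolding total_def using n gbinom_wt_pos[OF theta_pos] by (intro sum_mono2) (auto intro: less_imp_le)
  then show ?thesis by simp
qed

lemma mass_nonneg: "mass n \<omega> \<ge> 0"
  unfolding mass_def total_def using gbinom_wt_pos[OF theta_pos]
  by (intro divide_nonneg_nonneg sum_nonneg) (auto intro: less_imp_le)

lemma mass_measurable [measurable]: "mass n \<in> borel_measurable P"
  unfolding mass_def[abs_def] by measurable

lemma nc_measurable [measurable]: "nc n \<in> borel_measurable P"
  unfolding nc_def[abs_def] by measurable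

lemma integrable_mass: "integrable P (mass n)"
  unfolding mass_def[abs_def] by (intro integrable_divide Bochner_Integration.integrable_sum integrable_c_sq)

lemma nc_sq: "(\<integral>\<omega>. (cmod (nc n \<omega>))\<^sup>2 \<partial>P) = 1" and integrable_nc_sq: "integrable P (\<lambda>\<omega>. (cmod (nc n \<omega>))\<^sup>2)"
  using gbinom_wt_pos[OF theta_pos, of n] integrable_c_sq[of n]
  by (simp_all add: nc_def norm_divide power_divide second_moment)

text \<open>The exponent of \<open>stein_fun\<close> as a function of the coordinates. Real parts
  and squared moduli are written through \<open>sec\<close> and its conjugate, hence the factor 1/2,
  so that the Wirtinger rules apply term by term.\<close>

definition stein_exponent :: "complex \<Rightarrow> real \<Rightarrow> real \<Rightarrow> nat \<Rightarrow> nat \<Rightarrow> (nat \<Rightarrow> complex) \<Rightarrow> complex" where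
  "stein_exponent \<xi> s \<tau> m n x =
     (\<i> * of_real s / (2 * of_real (sqrt (gbinom_wt \<theta> n)))) * (cnj \<xi> * sec \<theta> n x + \<xi> * cnj (sec \<theta> n x)) +
     (- of_real (\<tau> / total m)) * (\<Sum>j<m. sec \<theta> j x * cnj (sec \<theta> j x))"

definition stein_fun :: "complex \<Rightarrow> real \<Rightarrow> real \<Rightarrow> nat \<Rightarrow> nat \<Rightarrow> 'a \<Rightarrow> complex" where
  "stein_fun \<xi> s \<tau> m n \<omega> = exp (\<i> * of_real (s * Re (cnj \<xi> * nc n \<omega>)) - of_real (\<tau> * mass m \<omega>))"

lemma cnj_mult_add_mult_cnj: "cnj \<xi> * z + \<xi> * cnj z = of_real (2 * Re (cnj \<xi> * z))"
  using complex_add_cnj[of "cnj \<xi> * z"] by simp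

lemma stein_exponent_eq:
  "stein_exponent \<xi> s \<tau> m n x =
    \<i> * of_real (s * Re (cnj \<xi> * sec \<theta> n x) / sqrt (gbinom_wt \<theta> n)) - of_real (\<tau> * (\<Sum>j<m. (cmod (sec \<theta> j x))\<^sup>2) / total m)"
proof -
  have alg: "\<i> * of_real s / (2 * of_real \<sigma>) * of_real (2 * r) = \<i> * complex_of_real (s * r / \<sigma>)" for r \<sigma> :: real
    by simp
  show ?thesis
    unfolding stein_exponent_def cnj_mult_add_mult_cnj complex_norm_square[symmetric] of_real_sum[symmetric]
    by (subst alg) simp
qed

lemma stein_exponent_trunc:
  "exp (stein_exponent \<xi> s \<tau> m n (trunc (n + m) \<omega>)) = stein_fun \<xi> s \<tau> m n \<omega>"
  unfolding stein_exponent_eq stein_fun_def nc_def mass_def by (simp add: field_simps)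

lemma stein_exponent_Re: "\<tau> \<ge> 0 \<Longrightarrow> m \<ge> 1 \<Longrightarrow> Re (stein_exponent \<xi> s \<tau> m n x) \<le> 0"
  unfolding stein_exponent_eq using total_pos[of m] by (auto intro!: divide_nonneg_nonneg mult_nonneg_nonneg sum_nonneg)

lemma stein_fun_norm: "\<tau> \<ge> 0 \<Longrightarrow> cmod (stein_fun \<xi> s \<tau> m n \<omega>) \<le> 1"
  unfolding stein_fun_def using mass_nonneg[of m \<omega>] by (simp add: norm_exp_eq_Re)

lemma stein_fun_measurable [measurable]: "stein_fun \<xi> s \<tau> m n \<in> borel_measurable P"
  unfolding stein_fun_def[abs_def] by measurable

lemma all_moments_stein_fun: "\<tau> \<ge> 0 \<Longrightarrow> all_moments (stein_fun \<xi> s \<tau> m n)"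
  by (rule all_moments_bound[where g = "\<lambda>_. 1"]) (auto intro: stein_fun_norm)

text \<open>A crude bound for the terms produced by differentiating \<open>mass m\<close>. Only its
  independence of n and s matters.\<close>

definition stein_const :: "nat \<Rightarrow> real" where
  "stein_const m = (\<Sum>j<m. \<Sum>k=1..j. 1 + (\<integral>\<omega>. (cmod (c j \<omega>))\<^sup>2 * (cmod (c (j - k) \<omega>))\<^sup>2 \<partial>P))"

lemma stein_const_nonneg: "stein_const m \<ge> 0"
  unfolding stein_const_def by (intro sum_nonneg add_nonneg_nonneg Bochner_Integration.integral_nonneg) auto

text \<open>The first sum comes from the conjugate of c_n in the phase, the second from the squared
  moduli in \<open>mass m\<close>. In the second, differentiation in x_k leaves only the indices j
  >= k.\<close>

lemma stein_identity:
  assumes \<tau>: "\<tau> \<ge> 0" and m: "m \<ge> 1"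
  shows "of_nat n * (\<integral>\<omega>. c n \<omega> * stein_fun \<xi> s \<tau> m n \<omega> \<partial>P) =
    (\<i> * of_real s * \<xi> / (2 * of_real (sqrt (gbinom_wt \<theta> n)))) *
       (\<Sum>k=1..n. of_real \<theta> * (\<integral>\<omega>. of_real ((cmod (c (n - k) \<omega>))\<^sup>2) * stein_fun \<xi> s \<tau> m n \<omega> \<partial>P)) -
    of_real (\<tau> / total m) * (\<Sum>k=1..n. \<Sum>j<m. if k \<le> j then
       of_real \<theta> * (\<integral>\<omega>. c (n - k) \<omega> * c j \<omega> * cnj (c (j - k) \<omega>) * stein_fun \<xi> s \<tau> m n \<omega> \<partial>P) else 0)"
proof -
  let ?l = "n + m" and ?S = "stein_fun \<xi> s \<tau> m n"
  let ?H = "stein_exponent \<xi> s \<tau> m n"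
  let ?a = "\<i> * of_real s / (2 * of_real (sqrt (gbinom_wt \<theta> n)))" and ?b = "complex_of_real (\<tau> / total m)"
  define q where "q k x = exp (?H x) * (?a * (cnj \<xi> * 0 + \<xi> * cnj (dsec \<theta> k n x)) +
      (- ?b) * (\<Sum>j<m. 0 * cnj (sec \<theta> j x) + sec \<theta> j x * cnj (dsec \<theta> k j x)))" for k x
  define p where "p k x = exp (?H x) * (?a * (cnj \<xi> * dsec \<theta> k n x + \<xi> * cnj 0) +
      (- ?b) * (\<Sum>j<m. dsec \<theta> k j x * cnj (sec \<theta> j x) + sec \<theta> j x * cnj 0))" for k x
  have w: "wirtinger k (\<lambda>x. exp (?H x)) (p k) (q k)" if "k \<in> {1..n}" for k
    unfolding p_def q_def
  proof (rule wirtinger_exp)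
    show "wirtinger k ?H (\<lambda>x. ?a * (cnj \<xi> * dsec \<theta> k n x + \<xi> * cnj 0) +
      (- ?b) * (\<Sum>j<m. dsec \<theta> k j x * cnj (sec \<theta> j x) + sec \<theta> j x * cnj 0)) (\<lambda>x. ?a * (cnj \<xi> * 0 + \<xi> * cnj (dsec \<theta> k n x)) +
      (- ?b) * (\<Sum>j<m. 0 * cnj (sec \<theta> j x) + sec \<theta> j x * cnj (dsec \<theta> k j x)))"
      unfolding stein_exponent_def[abs_def] using that
      by (intro wirtinger_add wirtinger_cmult wirtinger_sum wirtinger_mult wirtinger_cnj wirtinger_sec) auto
  qed (use \<tau> m stein_exponent_Re in auto)
  have Hm: "?H \<in> borel_measurable (PiM {1..?l} (\<lambda>_. borel))"
    unfolding stein_exponent_def[abs_def]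
    by (intro borel_measurable_add borel_measurable_times borel_measurable_sum measurable_cnj measurable_sec
        borel_measurable_const) auto
  then have eHm: "(\<lambda>x. exp (?H x)) \<in> borel_measurable (PiM {1..?l} (\<lambda>_. borel))" by measurable
  have qm: "q k \<in> borel_measurable (PiM {1..?l} (\<lambda>_. borel))" for k
    unfolding q_def[abs_def]
    by (intro borel_measurable_times eHm borel_measurable_add borel_measurable_sum measurable_cnj
        measurable_sec measurable_dsec) auto
  have q_trunc: "q k (trunc ?l \<omega>) = ?S \<omega> * (?a * (\<xi> * cnj (dc k n \<omega>)) - ?b * (\<Sum>j<m. c j \<omega> * cnj (dc k j \<omega>)))" for k \<omega>
    unfolding q_def stein_exponent_trunc by (simp add: field_simps)
  have "of_nat n * (\<integral>\<omega>. c n \<omega> * exp (?H (trunc ?l \<omega>)) \<partial>P) =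
    (\<Sum>k=1..n. of_real (real k * sqrt (\<theta> / real k)) * (\<integral>\<omega>. c (n - k) \<omega> * q k (trunc ?l \<omega>) \<partial>P))"
  proof (rule ibp_euler[OF _ w])
    show "all_moments (\<lambda>\<omega>. exp (?H (trunc ?l \<omega>)))"
      unfolding stein_exponent_trunc by (rule all_moments_stein_fun[OF \<tau>])
    show "all_moments (\<lambda>\<omega>. q k (trunc ?l \<omega>))" for k
      unfolding q_trunc diff_conv_add_uminus mult_minus_left[symmetric]
      by (intro all_moments_mult all_moments_add all_moments_sum all_moments_cnj all_moments_dc all_moments_c
          all_moments_stein_fun[OF \<tau>] all_moments_const)
  qed (use eHm qm in auto)
  also have "\<dots> = (\<Sum>k=1..n. ?a * \<xi> * (of_real \<theta> * (\<integral>\<omega>. of_real ((cmod (c (n - k) \<omega>))\<^sup>2) * ?S \<omega> \<partial>P)) -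
      ?b * (\<Sum>j<m. if k \<le> j then of_real \<theta> * (\<integral>\<omega>. c (n - k) \<omega> * c j \<omega> * cnj (c (j - k) \<omega>) * ?S \<omega> \<partial>P) else 0))"
  proof (intro sum.cong refl)
    fix k assume k: "k \<in> {1..n}"
    let ?s = "complex_of_real (sqrt (\<theta> / real k))"
    let ?f = "\<lambda>\<omega>. of_real ((cmod (c (n - k) \<omega>))\<^sup>2) * ?S \<omega>"
    let ?g = "\<lambda>j \<omega>. if k \<le> j then c (n - k) \<omega> * c j \<omega> * cnj (c (j - k) \<omega>) * ?S \<omega> else 0"
    have f: "integrable P ?f"
      unfolding complex_norm_square
      by (intro all_moments_integrable all_moments_mult all_moments_cnj all_moments_c all_moments_stein_fun \<tau>)
    have g: "integrable P (?g j)" for j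
      by (cases "k \<le> j") (auto intro!: all_moments_integrable all_moments_mult all_moments_cnj all_moments_c all_moments_stein_fun \<tau>)
    have "(\<integral>\<omega>. c (n - k) \<omega> * q k (trunc ?l \<omega>) \<partial>P) = (\<integral>\<omega>. ?s * (?a * \<xi> * ?f \<omega> - ?b * (\<Sum>j<m. ?g j \<omega>)) \<partial>P)"
    proof (rule Bochner_Integration.integral_cong[OF refl])
      fix \<omega>
      have 1: "cnj (dc k n \<omega>) = ?s * cnj (c (n - k) \<omega>)" using k by (simp add: dc_def)
      have 2: "c (n - k) \<omega> * (\<Sum>j<m. c j \<omega> * cnj (dc k j \<omega>)) * ?S \<omega> = ?s * (\<Sum>j<m. ?g j \<omega>)"
        unfolding sum_distrib_left sum_distrib_right by (intro sum.cong) (auto simp: dc_def)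
      show "c (n - k) \<omega> * q k (trunc ?l \<omega>) = ?s * (?a * \<xi> * ?f \<omega> - ?b * (\<Sum>j<m. ?g j \<omega>))"
        unfolding q_trunc right_diff_distrib 1 complex_norm_square
        using arg_cong[OF 2, of "\<lambda>z. ?b * z"] by (simp only: mult_ac)
    qed
    also have "\<dots> = ?s * (?a * \<xi> * (\<integral>\<omega>. ?f \<omega> \<partial>P) - ?b * (\<Sum>j<m. \<integral>\<omega>. ?g j \<omega> \<partial>P))"
      by (subst integral_mult_right_zero, subst Bochner_Integration.integral_diff)
         (use f g in \<open>auto intro!: integrable_mult_right Bochner_Integration.integrable_sum simp: Bochner_Integration.integral_sum\<close>)
    finally have e: "(\<integral>\<omega>. c (n - k) \<omega> * q k (trunc ?l \<omega>) \<partial>P) = ?s * (?a * \<xi> * (\<integral>\<omega>. ?f \<omega> \<partial>P) - ?b * (\<Sum>j<m. \<integral>\<omega>. ?g j \<omega> \<partial>P))" .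
    have "of_real \<theta> * (\<Sum>j<m. \<integral>\<omega>. ?g j \<omega> \<partial>P) =
      (\<Sum>j<m. if k \<le> j then of_real \<theta> * (\<integral>\<omega>. c (n - k) \<omega> * c j \<omega> * cnj (c (j - k) \<omega>) * ?S \<omega> \<partial>P) else 0)"
      unfolding sum_distrib_left by (intro sum.cong) auto
    then show "of_real (real k * sqrt (\<theta> / real k)) * (\<integral>\<omega>. c (n - k) \<omega> * q k (trunc ?l \<omega>) \<partial>P) =
      ?a * \<xi> * (of_real \<theta> * (\<integral>\<omega>. ?f \<omega> \<partial>P)) -
      ?b * (\<Sum>j<m. if k \<le> j then of_real \<theta> * (\<integral>\<omega>. c (n - k) \<omega> * c j \<omega> * cnj (c (j - k) \<omega>) * ?S \<omega> \<partial>P) else 0)"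
      using k unfolding e by (subst coeff_sq_complex) (auto simp: right_diff_distrib mult_ac simp del: of_real_divide)
  qed
  finally show ?thesis
    unfolding stein_exponent_trunc sum_subtractf sum_distrib_left[symmetric] by simp
qed

text \<open>Reindexed by j = n - k, the first sum of \<open>stein_identity\<close> is \<theta> *
  \<open>total n\<close> = n * \<open>gbinom_wt\<close> \<theta> n times the expectation of
  \<open>mass n\<close> against the test function, the main term. The second sum is the error; its
  surviving pairs satisfy k <= j < m.\<close>

lemma stein_bound:
  assumes \<tau>: "\<tau> \<ge> 0" and m: "m \<ge> 1" and n: "n \<ge> 1"
  shows "cmod ((\<integral>\<omega>. nc n \<omega> * stein_fun \<xi> s \<tau> m n \<omega> \<partial>P) -
      \<i> * of_real s * \<xi> / 2 * (\<integral>\<omega>. of_real (mass n \<omega>) * stein_fun \<xi> s \<tau> m n \<omega> \<partial>P))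
    \<le> \<tau> * \<theta> * stein_const m / (real n * sqrt (gbinom_wt \<theta> n))"
proof -
  let ?S = "stein_fun \<xi> s \<tau> m n" and ?\<sigma> = "sqrt (gbinom_wt \<theta> n)"
  have \<sigma>: "?\<sigma> > 0" using gbinom_wt_pos[OF theta_pos] by simp
  have tot: "total n \<ge> 1" "total m \<ge> 1" using m n total_pos by auto
  define R where "R = (\<Sum>k=1..n. \<Sum>j<m. if k \<le> j then
       of_real \<theta> * (\<integral>\<omega>. c (n - k) \<omega> * c j \<omega> * cnj (c (j - k) \<omega>) * ?S \<omega> \<partial>P) else 0)"
  have Sint: "integrable P (\<lambda>\<omega>. of_real ((cmod (c j \<omega>))\<^sup>2) * ?S \<omega>)" for j
    unfolding complex_norm_square
    by (intro all_moments_integrable all_moments_mult all_moments_cnj all_moments_c all_moments_stein_fun \<tau>)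
  have "(\<Sum>k=1..n. of_real \<theta> * (\<integral>\<omega>. of_real ((cmod (c (n - k) \<omega>))\<^sup>2) * ?S \<omega> \<partial>P)) =
      of_real \<theta> * (\<Sum>j<n. \<integral>\<omega>. of_real ((cmod (c j \<omega>))\<^sup>2) * ?S \<omega> \<partial>P)"
    unfolding sum_distrib_left
    by (rule sum.reindex_bij_witness[of _ "\<lambda>k. n - k" "\<lambda>k. n - k"]) auto
  also have "\<dots> = of_real \<theta> * (\<integral>\<omega>. of_real (total n) * (of_real (mass n \<omega>) * ?S \<omega>) \<partial>P)"
    unfolding mass_def using tot Sint
    by (subst Bochner_Integration.integral_sum[symmetric]) (auto simp: sum_distrib_right)
  also have "\<dots> = of_real (\<theta> * total n) * (\<integral>\<omega>. of_real (mass n \<omega>) * ?S \<omega> \<partial>P)" by simp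
  also have "\<theta> * total n = real n * gbinom_wt \<theta> n" unfolding total_def by (rule gbinom_wt_euler[symmetric])
  also have "gbinom_wt \<theta> n = ?\<sigma> * ?\<sigma>" using gbinom_wt_pos[OF theta_pos, of n] by simp
  finally have main: "(\<Sum>k=1..n. of_real \<theta> * (\<integral>\<omega>. of_real ((cmod (c (n - k) \<omega>))\<^sup>2) * ?S \<omega> \<partial>P)) =
     of_real (real n * (?\<sigma> * ?\<sigma>)) * (\<integral>\<omega>. of_real (mass n \<omega>) * ?S \<omega> \<partial>P)" .
  have "(\<integral>\<omega>. nc n \<omega> * ?S \<omega> \<partial>P) = (\<integral>\<omega>. c n \<omega> * ?S \<omega> \<partial>P) / of_real ?\<sigma>"
    unfolding nc_def by simp
  also have "\<dots> = (of_nat n * (\<integral>\<omega>. c n \<omega> * ?S \<omega> \<partial>P)) / (of_nat n * of_real ?\<sigma>)" using n by simp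
  also have "\<dots> = \<i> * of_real s * \<xi> / 2 * (\<integral>\<omega>. of_real (mass n \<omega>) * ?S \<omega> \<partial>P) -
     of_real (\<tau> / total m) * R / (of_nat n * of_real ?\<sigma>)"
  proof -
    have "(\<i> * of_real s * \<xi> / (2 * of_real \<sigma>)) * (of_real (real n * (\<sigma> * \<sigma>)) * e) / (of_nat n * of_real \<sigma>) =
      \<i> * of_real s * \<xi> / 2 * e" if "\<sigma> > 0" for \<sigma> e using that n by simp
    from this[OF \<sigma>] show ?thesis
      unfolding stein_identity[OF \<tau> m] R_def[symmetric] main diff_divide_distrib by (simp only:)
  qed
  finally have "cmod ((\<integral>\<omega>. nc n \<omega> * ?S \<omega> \<partial>P) - \<i> * of_real s * \<xi> / 2 * (\<integral>\<omega>. of_real (mass n \<omega>) * ?S \<omega> \<partial>P))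
     = cmod (of_real (\<tau> / total m) * R / (of_nat n * of_real ?\<sigma>))" by (simp add: norm_minus_commute)
  also have "\<dots> = \<tau> / total m * cmod R / (real n * ?\<sigma>)"
    using \<tau> tot \<sigma> by (simp add: norm_mult norm_divide)
  also have "\<dots> \<le> \<tau> * (\<theta> * stein_const m) / (real n * ?\<sigma>)"
  proof -
    have "cmod R \<le> (\<Sum>k=1..n. \<Sum>j<m. if k \<le> j then \<theta> * (1 + (\<integral>\<omega>. (cmod (c j \<omega>))\<^sup>2 * (cmod (c (j - k) \<omega>))\<^sup>2 \<partial>P)) else 0)"
      unfolding R_def
    proof (intro sum_norm_le)
      fix k j
      have "cmod (\<integral>\<omega>. c (n - k) \<omega> * c j \<omega> * cnj (c (j - k) \<omega>) * ?S \<omega> \<partial>P) \<le>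
        (\<integral>\<omega>. (cmod (c (n - k) \<omega>))\<^sup>2 + (cmod (c j \<omega>))\<^sup>2 * (cmod (c (j - k) \<omega>))\<^sup>2 \<partial>P)"
      proof (rule norm_integral_le)
        show "integrable P (\<lambda>\<omega>. c (n - k) \<omega> * c j \<omega> * cnj (c (j - k) \<omega>) * ?S \<omega>)"
          by (intro all_moments_integrable all_moments_mult all_moments_cnj all_moments_c all_moments_stein_fun \<tau>)
        show "integrable P (\<lambda>\<omega>. (cmod (c (n - k) \<omega>))\<^sup>2 + (cmod (c j \<omega>))\<^sup>2 * (cmod (c (j - k) \<omega>))\<^sup>2)"
          by (intro Bochner_Integration.integrable_add integrable_c_sq integrable_c_sq_mult)
        fix \<omega>
        let ?u = "cmod (c (n - k) \<omega>)" and ?v = "cmod (c j \<omega>) * cmod (c (j - k) \<omega>)"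
        have "cmod (c (n - k) \<omega> * c j \<omega> * cnj (c (j - k) \<omega>) * ?S \<omega>) = (?u * ?v) * cmod (?S \<omega>)"
          by (simp add: norm_mult)
        also have "\<dots> \<le> (?u * ?v) * 1"
          by (intro mult_left_mono stein_fun_norm \<tau>) auto
        also have "\<dots> \<le> ?u\<^sup>2 + ?v\<^sup>2"
        proof -
          have "u * v \<le> u\<^sup>2 + v\<^sup>2" if "0 \<le> u * v" for u v :: real
            using that sum_squares_bound[of u v] unfolding mult.assoc by linarith
          then show ?thesis by simp
        qed
        finally show "cmod (c (n - k) \<omega> * c j \<omega> * cnj (c (j - k) \<omega>) * ?S \<omega>) \<le>
          (cmod (c (n - k) \<omega>))\<^sup>2 + (cmod (c j \<omega>))\<^sup>2 * (cmod (c (j - k) \<omega>))\<^sup>2" by (simp add: power_mult_distrib)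
      qed
      also have "\<dots> = gbinom_wt \<theta> (n - k) + (\<integral>\<omega>. (cmod (c j \<omega>))\<^sup>2 * (cmod (c (j - k) \<omega>))\<^sup>2 \<partial>P)"
        by (simp add: integrable_c_sq integrable_c_sq_mult second_moment)
      also have "\<dots> \<le> 1 + (\<integral>\<omega>. (cmod (c j \<omega>))\<^sup>2 * (cmod (c (j - k) \<omega>))\<^sup>2 \<partial>P)"
        using gbinom_wt_le_1[OF theta_pos theta_lt_1] by simp
      finally have "cmod (of_real \<theta> * (\<integral>\<omega>. c (n - k) \<omega> * c j \<omega> * cnj (c (j - k) \<omega>) * ?S \<omega> \<partial>P)) \<le>
        \<theta> * (1 + (\<integral>\<omega>. (cmod (c j \<omega>))\<^sup>2 * (cmod (c (j - k) \<omega>))\<^sup>2 \<partial>P))"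
        unfolding norm_mult using theta_pos by (simp add: mult_left_mono)
      then show "cmod (if k \<le> j then of_real \<theta> * (\<integral>\<omega>. c (n - k) \<omega> * c j \<omega> * cnj (c (j - k) \<omega>) * ?S \<omega> \<partial>P) else 0) \<le>
        (if k \<le> j then \<theta> * (1 + (\<integral>\<omega>. (cmod (c j \<omega>))\<^sup>2 * (cmod (c (j - k) \<omega>))\<^sup>2 \<partial>P)) else 0)" by simp
    qed
    also have "\<dots> = (\<Sum>j<m. \<Sum>k=1..n. if k \<le> j then \<theta> * (1 + (\<integral>\<omega>. (cmod (c j \<omega>))\<^sup>2 * (cmod (c (j - k) \<omega>))\<^sup>2 \<partial>P)) else 0)"
      by (rule sum.swap)
    \<comment> \<open>The condition k <= j replaces the range up to n by the range up to j, and the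
      bound becomes independent of n.\<close>
    also have "\<dots> \<le> (\<Sum>j<m. \<Sum>k=1..j. \<theta> * (1 + (\<integral>\<omega>. (cmod (c j \<omega>))\<^sup>2 * (cmod (c (j - k) \<omega>))\<^sup>2 \<partial>P)))"
    proof (rule sum_mono)
      fix j
      let ?t = "\<lambda>k. \<theta> * (1 + (\<integral>\<omega>. (cmod (c j \<omega>))\<^sup>2 * (cmod (c (j - k) \<omega>))\<^sup>2 \<partial>P))"
      have t: "?t k \<ge> 0" for k using theta_pos by (intro mult_nonneg_nonneg add_nonneg_nonneg Bochner_Integration.integral_nonneg) auto
      have "(\<Sum>k=1..n. if k \<le> j then ?t k else 0) = (\<Sum>k\<in>{1..n} \<inter> {..j}. ?t k)"
        by (rule sum.mono_neutral_cong_right) auto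
      also have "\<dots> \<le> (\<Sum>k=1..j. ?t k)" using t by (intro sum_mono2) auto
      finally show "(\<Sum>k=1..n. if k \<le> j then ?t k else 0) \<le> (\<Sum>k=1..j. ?t k)" .
    qed
    also have "\<dots> = \<theta> * stein_const m" unfolding stein_const_def sum_distrib_left ..
    finally have "cmod R \<le> \<theta> * stein_const m" .
    moreover have "\<tau> / total m \<le> \<tau>" using mult_left_mono[OF tot(2) \<tau>] tot by (simp add: divide_le_eq)
    ultimately have "\<tau> / total m * cmod R \<le> \<tau> * (\<theta> * stein_const m)" using \<tau> by (intro mult_mono) auto
    then show ?thesis using \<sigma> by (intro divide_right_mono) auto
  qed
  finally show ?thesis by (simp add: mult.assoc)
qed

lemma stein_fun_derivative:
  "((\<lambda>s. stein_fun \<xi> s ((1 - s\<^sup>2) * \<kappa>) m n \<omega>) has_vector_derivative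
    (\<i> * of_real (Re (cnj \<xi> * nc n \<omega>)) + of_real (2 * s * \<kappa> * mass m \<omega>)) * stein_fun \<xi> s ((1 - s\<^sup>2) * \<kappa>) m n \<omega>) (at s)"
proof -
  let ?u = "Re (cnj \<xi> * nc n \<omega>)" and ?v = "mass m \<omega>"
  have "((\<lambda>z. exp (\<i> * (z * of_real ?u) - (1 - z\<^sup>2) * of_real \<kappa> * of_real ?v)) has_field_derivative
     (\<i> * of_real ?u + of_real (2 * s * \<kappa> * ?v)) * exp (\<i> * (of_real s * of_real ?u) - (1 - (of_real s)\<^sup>2) * of_real \<kappa> * of_real ?v)) (at (of_real s))"
    by (auto intro!: derivative_eq_intros simp: algebra_simps)
  from has_vector_derivative_real_field[OF this] show ?thesis
    unfolding stein_fun_def by simp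
qed

text \<open>At s = 1 the damping vanishes and the characteristic function remains; at s = 0 the
  phase vanishes and the Laplace transform of \<open>mass m\<close> remains. In the derivative the
  damping contributes s|xi|^2/2 times \<open>mass m\<close> and the Stein identity minus the same
  multiple of \<open>mass n\<close>, so only the difference of the masses and the error of
  \<open>stein_bound\<close> survive.\<close>

lemma charfun_stein:
  assumes m: "m \<ge> 1" and n: "n \<ge> 1"
  shows "cmod ((\<integral>\<omega>. exp (\<i> * of_real (Re (cnj \<xi> * nc n \<omega>))) \<partial>P) - of_real (\<integral>\<omega>. exp (- ((cmod \<xi>)\<^sup>2 / 4 * mass m \<omega>)) \<partial>P))
    \<le> (cmod \<xi>)\<^sup>2 / 2 * (\<integral>\<omega>. \<bar>mass m \<omega> - mass n \<omega>\<bar> \<partial>P) +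
      cmod \<xi> * ((cmod \<xi>)\<^sup>2 / 4 * \<theta> * stein_const m / (real n * sqrt (gbinom_wt \<theta> n)))"
proof -
  define \<kappa> where "\<kappa> = (cmod \<xi>)\<^sup>2 / 4"
  have \<kappa>: "\<kappa> \<ge> 0" by (simp add: \<kappa>_def)
  let ?f = "\<lambda>s \<omega>. stein_fun \<xi> s ((1 - s\<^sup>2) * \<kappa>) m n \<omega>"
  let ?f' = "\<lambda>s \<omega>. (\<i> * of_real (Re (cnj \<xi> * nc n \<omega>)) + of_real (2 * s * \<kappa> * mass m \<omega>)) * ?f s \<omega>"
  let ?B = "(cmod \<xi>)\<^sup>2 / 2 * (\<integral>\<omega>. \<bar>mass m \<omega> - mass n \<omega>\<bar> \<partial>P) +
      cmod \<xi> * (\<kappa> * \<theta> * stein_const m / (real n * sqrt (gbinom_wt \<theta> n)))"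
  have sq: "(1 - s\<^sup>2) * \<kappa> \<ge> 0" "(1 - s\<^sup>2) * \<kappa> \<le> \<kappa>" if "s \<in> {0..1}" for s :: real
    using that \<kappa> by (auto intro!: mult_nonneg_nonneg mult_left_le_one_le simp: power_le_one)
  have mom_nc: "all_moments (nc n)"
    using all_moments_mult[OF all_moments_c all_moments_const, of n "1 / of_real (sqrt (gbinom_wt \<theta> n))"]
    by (simp add: nc_def[abs_def])
  have int_nc: "integrable P (\<lambda>\<omega>. cmod (nc n \<omega>))" using all_moments_integrable[OF mom_nc] by simp
  have "cmod ((\<integral>\<omega>. ?f 1 \<omega> \<partial>P) - (\<integral>\<omega>. ?f 0 \<omega> \<partial>P)) \<le> ?B"
  proof (rule expectation_increment_bound[where w = "\<lambda>\<omega>. cmod \<xi> * cmod (nc n \<omega>) + 2 * \<kappa> * mass m \<omega>"])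
    show "((\<lambda>s. ?f s \<omega>) has_vector_derivative ?f' s \<omega>) (at s)" for \<omega> s
      by (rule stein_fun_derivative)
    show "continuous_on UNIV (\<lambda>s. ?f' s \<omega>)" for \<omega>
      unfolding stein_fun_def by (intro continuous_intros)
    show "(\<lambda>(s, \<omega>). ?f' s \<omega>) \<in> borel_measurable (lborel \<Otimes>\<^sub>M P)"
      unfolding stein_fun_def by measurable
    show "integrable P (\<lambda>\<omega>. cmod \<xi> * cmod (nc n \<omega>) + 2 * \<kappa> * mass m \<omega>)"
      using int_nc integrable_mass by auto
    show "integrable P (?f 0)" "integrable P (?f 1)"
      using \<kappa> by (auto intro!: all_moments_integrable all_moments_stein_fun)
    fix s :: real assume s: "s \<in> {0..1}"
    show "cmod (?f' s \<omega>) \<le> cmod \<xi> * cmod (nc n \<omega>) + 2 * \<kappa> * mass m \<omega>" for \<omega>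
    proof -
      have "\<bar>Re (cnj \<xi> * nc n \<omega>)\<bar> \<le> cmod \<xi> * cmod (nc n \<omega>)"
        using abs_Re_le_cmod[of "cnj \<xi> * nc n \<omega>"] by (simp add: norm_mult)
      moreover have "\<bar>2 * s * \<kappa> * mass m \<omega>\<bar> \<le> 2 * \<kappa> * mass m \<omega>"
        using s \<kappa> mass_nonneg[of m \<omega>] mult_right_mono[of s 1 "2 * \<kappa> * mass m \<omega>"] by (simp add: abs_mult mult_ac)
      ultimately have "cmod (\<i> * of_real (Re (cnj \<xi> * nc n \<omega>)) + of_real (2 * s * \<kappa> * mass m \<omega>)) \<le>
          cmod \<xi> * cmod (nc n \<omega>) + 2 * \<kappa> * mass m \<omega>"
        using norm_triangle_ineq[of "\<i> * of_real (Re (cnj \<xi> * nc n \<omega>))" "complex_of_real (2 * s * \<kappa> * mass m \<omega>)"]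
        unfolding norm_mult norm_ii norm_of_real mult_1 by linarith
      then have "cmod (?f' s \<omega>) \<le> (cmod \<xi> * cmod (nc n \<omega>) + 2 * \<kappa> * mass m \<omega>) * 1"
        unfolding norm_mult[of _ "?f s \<omega>"] using stein_fun_norm[OF sq(1)[OF s]]
        by (intro mult_mono) (auto intro: order_trans[OF norm_ge_zero])
      then show ?thesis by simp
    qed
    let ?\<tau> = "(1 - s\<^sup>2) * \<kappa>"
    let ?r = "?\<tau> * \<theta> * stein_const m / (real n * sqrt (gbinom_wt \<theta> n))"
    let ?E = "\<integral>\<omega>. of_real (mass n \<omega>) * ?f s \<omega> \<partial>P" and ?E' = "\<integral>\<omega>. of_real (mass m \<omega>) * ?f s \<omega> \<partial>P"
    let ?A = "\<integral>\<omega>. nc n \<omega> * ?f s \<omega> \<partial>P" and ?A' = "\<integral>\<omega>. cnj (nc n \<omega>) * ?f s \<omega> \<partial>P"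
    have 1: "cmod (?A - \<i> * of_real s * \<xi> / 2 * ?E) \<le> ?r"
      by (rule stein_bound[OF sq(1)[OF s] m n])
    \<comment> \<open>The conjugate of \<open>nc n\<close> is treated by conjugating
      \<open>stein_bound\<close> at -s: conjugation reverses the phase and leaves the damping, which
      involves s only through its square.\<close>
    have cnj_f: "cnj (stein_fun \<xi> (- s) ?\<tau> m n \<omega>) = ?f s \<omega>" for \<omega>
      unfolding stein_fun_def by (simp add: exp_cnj)
    have "cnj (\<integral>\<omega>. nc n \<omega> * stein_fun \<xi> (- s) ?\<tau> m n \<omega> \<partial>P) = ?A'"
      "cnj (\<integral>\<omega>. of_real (mass n \<omega>) * stein_fun \<xi> (- s) ?\<tau> m n \<omega> \<partial>P) = ?E"
      by (simp_all only: Bochner_Integration.integral_cnj[symmetric] complex_cnj_mult cnj_f complex_cnj_complex_of_real)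
    then have "?A' - \<i> * of_real s * cnj \<xi> / 2 * ?E =
      cnj ((\<integral>\<omega>. nc n \<omega> * stein_fun \<xi> (- s) ?\<tau> m n \<omega> \<partial>P) -
        \<i> * of_real (- s) * \<xi> / 2 * (\<integral>\<omega>. of_real (mass n \<omega>) * stein_fun \<xi> (- s) ?\<tau> m n \<omega> \<partial>P))"
      by simp
    then have 2: "cmod (?A' - \<i> * of_real s * cnj \<xi> / 2 * ?E) \<le> ?r"
      using stein_bound[OF sq(1)[OF s] m n, of \<xi> "- s"] by (simp only: complex_mod_cnj)
    have iA: "integrable P (\<lambda>\<omega>. nc n \<omega> * ?f s \<omega>)" "integrable P (\<lambda>\<omega>. cnj (nc n \<omega>) * ?f s \<omega>)"
      by (intro all_moments_integrable all_moments_mult all_moments_cnj mom_nc all_moments_stein_fun sq s)+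
    have iE: "integrable P (\<lambda>\<omega>. of_real (mass l \<omega>) * ?f s \<omega>)" for l
    proof (rule Bochner_Integration.integrable_bound[OF integrable_mass[of l]])
      show "AE \<omega> in P. norm (of_real (mass l \<omega>) * ?f s \<omega>) \<le> norm (mass l \<omega>)"
        using stein_fun_norm[OF sq(1)[OF s]] by (intro AE_I2) (simp add: norm_mult mult_left_le)
    qed measurable
    have "(\<integral>\<omega>. ?f' s \<omega> \<partial>P) = (\<integral>\<omega>. (\<i> / 2) * (cnj \<xi> * (nc n \<omega> * ?f s \<omega>) + \<xi> * (cnj (nc n \<omega>) * ?f s \<omega>)) +
        of_real (2 * s * \<kappa>) * (of_real (mass m \<omega>) * ?f s \<omega>) \<partial>P)"
    proof (rule Bochner_Integration.integral_cong[OF refl])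
      fix \<omega>
      have "of_real (Re (cnj \<xi> * nc n \<omega>)) = (cnj \<xi> * nc n \<omega> + \<xi> * cnj (nc n \<omega>)) / 2"
        unfolding cnj_mult_add_mult_cnj by simp
      then show "?f' s \<omega> = (\<i> / 2) * (cnj \<xi> * (nc n \<omega> * ?f s \<omega>) + \<xi> * (cnj (nc n \<omega>) * ?f s \<omega>)) +
        of_real (2 * s * \<kappa>) * (of_real (mass m \<omega>) * ?f s \<omega>)"
        by (simp only: of_real_mult ring_distribs mult_ac times_divide_eq_left times_divide_eq_right add_divide_distrib)
    qed
    also have "\<dots> = (\<i> / 2) * (cnj \<xi> * ?A + \<xi> * ?A') + of_real (2 * s * \<kappa>) * ?E'"
      using iA iE by simp
    \<comment> \<open>The two inserted main terms add up to -s|xi|^2/2 times \<open>?E\<close>,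
      which is -2s\<kappa> times \<open>?E\<close>; hence the compensating difference
      \<open>?E' - ?E\<close>.\<close>
    also have "\<dots> = (\<i> / 2) * (cnj \<xi> * (?A - \<i> * of_real s * \<xi> / 2 * ?E) + \<xi> * (?A' - \<i> * of_real s * cnj \<xi> / 2 * ?E)) +
        of_real (2 * s * \<kappa>) * (?E' - ?E)"
    proof -
      have k: "complex_of_real (2 * s * \<kappa>) = of_real s * (\<xi> * cnj \<xi>) / 2"
        unfolding \<kappa>_def complex_norm_square[symmetric] by simp
      show ?thesis unfolding k by (simp add: field_simps)
    qed
    finally have eq: "(\<integral>\<omega>. ?f' s \<omega> \<partial>P) = (\<i> / 2) * (cnj \<xi> * (?A - \<i> * of_real s * \<xi> / 2 * ?E) + \<xi> * (?A' - \<i> * of_real s * cnj \<xi> / 2 * ?E)) +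
        of_real (2 * s * \<kappa>) * (?E' - ?E)" .
    have diff: "cmod (?E' - ?E) \<le> (\<integral>\<omega>. \<bar>mass m \<omega> - mass n \<omega>\<bar> \<partial>P)"
    proof -
      have "?E' - ?E = (\<integral>\<omega>. of_real (mass m \<omega> - mass n \<omega>) * ?f s \<omega> \<partial>P)"
        using iE by (simp add: left_diff_distrib)
      also have "cmod \<dots> \<le> (\<integral>\<omega>. \<bar>mass m \<omega> - mass n \<omega>\<bar> \<partial>P)"
      proof (rule norm_integral_le)
        show "integrable P (\<lambda>\<omega>. of_real (mass m \<omega> - mass n \<omega>) * ?f s \<omega>)"
          using iE by (simp add: left_diff_distrib)
        show "norm (of_real (mass m \<omega> - mass n \<omega>) * ?f s \<omega>) \<le> \<bar>mass m \<omega> - mass n \<omega>\<bar>" for \<omega>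
          unfolding norm_mult norm_of_real using stein_fun_norm[OF sq(1)[OF s]] by (intro mult_left_le) auto
      qed (auto intro!: integrable_abs integrable_mass)
      finally show ?thesis .
    qed
    have "cmod (\<integral>\<omega>. ?f' s \<omega> \<partial>P) \<le> (1 / 2) * (cmod \<xi> * ?r + cmod \<xi> * ?r) + 2 * s * \<kappa> * (\<integral>\<omega>. \<bar>mass m \<omega> - mass n \<omega>\<bar> \<partial>P)"
      unfolding eq
    proof (rule norm_triangle_le, rule add_mono)
      show "cmod ((\<i> / 2) * (cnj \<xi> * (?A - \<i> * of_real s * \<xi> / 2 * ?E) + \<xi> * (?A' - \<i> * of_real s * cnj \<xi> / 2 * ?E)))
         \<le> (1 / 2) * (cmod \<xi> * ?r + cmod \<xi> * ?r)"
      proof -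
        have "cmod (cnj \<xi> * U + \<xi> * V) \<le> cmod \<xi> * r + cmod \<xi> * r" if "cmod U \<le> r" "cmod V \<le> r" for U V r
          using that by (intro norm_triangle_le add_mono) (auto simp: norm_mult intro!: mult_left_mono)
        from mult_left_mono[OF this[OF 1 2], of "1 / 2"] show ?thesis
          unfolding norm_mult[of "\<i> / 2"] by simp
      qed
      show "cmod (of_real (2 * s * \<kappa>) * (?E' - ?E)) \<le> 2 * s * \<kappa> * (\<integral>\<omega>. \<bar>mass m \<omega> - mass n \<omega>\<bar> \<partial>P)"
        unfolding norm_mult norm_of_real using s \<kappa> diff by (intro mult_mono) auto
    qed
    also have "\<dots> \<le> cmod \<xi> * (\<kappa> * \<theta> * stein_const m / (real n * sqrt (gbinom_wt \<theta> n))) + 2 * \<kappa> * (\<integral>\<omega>. \<bar>mass m \<omega> - mass n \<omega>\<bar> \<partial>P)"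
    proof (rule add_mono)
      have "?r \<le> \<kappa> * \<theta> * stein_const m / (real n * sqrt (gbinom_wt \<theta> n))"
        using sq[OF s] theta_pos stein_const_nonneg gbinom_wt_pos[OF theta_pos, of n]
        by (intro divide_right_mono mult_right_mono) auto
      note le = mult_left_mono[OF this norm_ge_zero[of \<xi>]]
      have half: "1 / 2 * (x + x) = x" for x :: real by simp
      from le show "(1 / 2) * (cmod \<xi> * ?r + cmod \<xi> * ?r) \<le> cmod \<xi> * (\<kappa> * \<theta> * stein_const m / (real n * sqrt (gbinom_wt \<theta> n)))"
        unfolding half .
      show "2 * s * \<kappa> * (\<integral>\<omega>. \<bar>mass m \<omega> - mass n \<omega>\<bar> \<partial>P) \<le> 2 * \<kappa> * (\<integral>\<omega>. \<bar>mass m \<omega> - mass n \<omega>\<bar> \<partial>P)"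
        using s \<kappa> by (intro mult_right_mono) (auto simp: mult_left_le_one_le)
    qed
    also have "\<dots> = ?B" by (simp add: \<kappa>_def)
    finally show "cmod (\<integral>\<omega>. ?f' s \<omega> \<partial>P) \<le> ?B" .
  qed
  moreover have "?f 1 \<omega> = exp (\<i> * of_real (Re (cnj \<xi> * nc n \<omega>)))" for \<omega> by (simp add: stein_fun_def)
  moreover have "?f 0 \<omega> = of_real (exp (- (\<kappa> * mass m \<omega>)))" for \<omega> by (simp add: stein_fun_def flip: exp_of_real)
  ultimately show ?thesis unfolding \<kappa>_def[symmetric] by (simp only: integral_complex_of_real)
qed

section \<open>Power series of the holomorphic field\<close>

text \<open>At k = 0 the quotient is a division by zero, hence 0, so the constant coefficient
  vanishes whatever \<open>N 0\<close> is.\<close>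

definition field_fps :: "'a \<Rightarrow> complex fps" where
  "field_fps \<omega> = Abs_fps (\<lambda>k. N k \<omega> / of_real (sqrt (real k)))"

lemma field_fps_nth: "fps_nth (field_fps \<omega>) k = N k \<omega> / of_real (sqrt (real k))"
  by (simp add: field_fps_def)

lemma GC_sums:
  assumes "ereal (norm z) < fps_conv_radius (field_fps \<omega>)"
  shows "GC N \<omega> z = eval_fps (field_fps \<omega>) z"
proof -
  have "(\<lambda>k. fps_nth (field_fps \<omega>) k * z ^ k) sums eval_fps (field_fps \<omega>) z"
    using assms by (rule sums_eval_fps)
  then have "(\<lambda>k. fps_nth (field_fps \<omega>) (Suc k) * z ^ Suc k) sums eval_fps (field_fps \<omega>) z"
    using sums_Suc_iff[of "\<lambda>k. fps_nth (field_fps \<omega>) k * z ^ k"] by (simp add: field_fps_nth del: power_Suc)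
  then show ?thesis
    unfolding GC_def by (simp add: sums_iff field_fps_nth mult_ac)
qed

text \<open>Compare coefficients in E' = E B'. This is the recursion defining \<open>sec\<close>, so
  E is determined by B and its constant coefficient 1.\<close>

lemma exp_compose_nth:
  fixes B :: "complex fps"
  defines "E \<equiv> fps_compose (fps_exp 1) B"
  assumes B0: "fps_nth B 0 = 0"
  shows "fps_nth E 0 = 1" "of_nat n * fps_nth E n = (\<Sum>k=1..n. of_nat k * fps_nth B k * fps_nth E (n - k))"
proof -
  show "fps_nth E 0 = 1" unfolding E_def by simp
  have der: "fps_deriv E = E * fps_deriv B"
    unfolding E_def fps_compose_deriv[OF B0] by simp
  show "of_nat n * fps_nth E n = (\<Sum>k=1..n. of_nat k * fps_nth B k * fps_nth E (n - k))"
  proof (cases n)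
    case (Suc m)
    have "of_nat n * fps_nth E n = fps_nth (fps_deriv E) m" unfolding fps_deriv_nth Suc Suc_eq_plus1 ..
    also have "\<dots> = (\<Sum>i=0..m. fps_nth E i * (of_nat (Suc (m - i)) * fps_nth B (Suc (m - i))))"
      by (simp only: der fps_mult_nth fps_deriv_nth Suc_eq_plus1)
    also have "\<dots> = (\<Sum>k=1..n. of_nat k * fps_nth B k * fps_nth E (n - k))"
      by (rule sum.reindex_bij_witness[of _ "\<lambda>k. n - k" "\<lambda>i. n - i"]) (auto simp: Suc Suc_diff_le)
    finally show ?thesis .
  qed simp
qed

lemma exp_field_fps_nth: "fps_nth (fps_compose (fps_exp 1) (fps_const (of_real (sqrt \<theta>)) * field_fps \<omega>)) n = c n \<omega>"
proof (induction n rule: less_induct)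
  case (less n)
  let ?B = "fps_const (of_real (sqrt \<theta>)) * field_fps \<omega>"
  have B0: "fps_nth ?B 0 = 0" by (simp add: field_fps_nth)
  show ?case
  proof (cases "n = 0")
    case False
    have "of_nat n * fps_nth (fps_compose (fps_exp 1) ?B) n = of_nat n * c n \<omega>"
      unfolding exp_compose_nth(2)[OF B0] c_euler
      using less by (intro sum.cong) (auto simp: field_fps_nth real_sqrt_divide)
    then show ?thesis using False by simp
  qed simp
qed

lemma exp_GC_has_fps_expansion:
  assumes "fps_conv_radius (field_fps \<omega>) > 0"
  shows "(\<lambda>z. exp (of_real (sqrt \<theta>) * GC N \<omega> z)) has_fps_expansion
      fps_compose (fps_exp 1) (fps_const (of_real (sqrt \<theta>)) * field_fps \<omega>)"
proof -
  have "eventually (\<lambda>z. z \<in> eball 0 (fps_conv_radius (field_fps \<omega>))) (nhds 0)"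
    using assms by (intro eventually_nhds_in_open) (auto simp: zero_ereal_def)
  then have "eventually (\<lambda>z. eval_fps (field_fps \<omega>) z = GC N \<omega> z) (nhds 0)"
    by eventually_elim (simp add: in_eball_iff GC_sums)
  then have "GC N \<omega> has_fps_expansion field_fps \<omega>"
    using assms by (simp add: has_fps_expansion_def)
  then have "(\<lambda>z. of_real (sqrt \<theta>) * GC N \<omega> z) has_fps_expansion fps_const (of_real (sqrt \<theta>)) * field_fps \<omega>"
    by (rule has_fps_expansion_cmult_left)
  from has_fps_expansion_compose[OF has_fps_expansion_exp1 this] show ?thesis
    by (simp add: comp_def field_fps_nth)
qed

lemma secular_coeff_eq:
  assumes "fps_conv_radius (field_fps \<omega>) > 0"
  shows "secular_coeff N \<theta> n \<omega> = c n \<omega>"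
  using fps_nth_fps_expansion[OF exp_GC_has_fps_expansion[OF assms], of n]
  unfolding exp_field_fps_nth secular_coeff_def fps_expansion_def by simp

text \<open>Expresses positivity of the radius through countably many conditions on the N_k, which
  makes it a measurable event. The natural number B is essentially an upper bound for the inverse
  radius.\<close>

lemma conv_radius_pos_iff:
  "fps_conv_radius (field_fps \<omega>) > 0 \<longleftrightarrow> (\<exists>B::nat. \<forall>k\<ge>1. cmod (N k \<omega>) \<le> real B ^ k * sqrt (real k))"
proof
  assume R: "fps_conv_radius (field_fps \<omega>) > 0"
  obtain r where r: "ereal 0 < ereal r" "ereal r < fps_conv_radius (field_fps \<omega>)"
    using ereal_dense2[OF R] by (auto simp: zero_ereal_def)
  then have r0: "r > 0" by simp
  have "summable (\<lambda>k. fps_nth (field_fps \<omega>) k * of_real r ^ k)"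
    using r by (intro summable_fps) auto
  then have "Bseq (\<lambda>k. fps_nth (field_fps \<omega>) k * of_real r ^ k)"
    by (intro convergent_imp_Bseq convergentI[OF summable_LIMSEQ_zero])
  then obtain K where K: "K > 0" "\<And>k. norm (fps_nth (field_fps \<omega>) k * of_real r ^ k) \<le> K"
    by (auto simp: Bseq_def)
  obtain B :: nat where B: "max 1 K / r \<le> real B" using real_arch_simple by blast
  show "\<exists>B::nat. \<forall>k\<ge>1. cmod (N k \<omega>) \<le> real B ^ k * sqrt (real k)"
  proof (intro exI[of _ B] allI impI)
    fix k :: nat assume k: "k \<ge> 1"
    have "cmod (N k \<omega>) / sqrt (real k) * r ^ k \<le> K"
      using K(2)[of k] r0 by (simp add: field_fps_nth norm_mult norm_divide norm_power)
    also have "K \<le> max 1 K" by simp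
    \<comment> \<open>Since k >= 1, the constant can be absorbed into the k-th power.\<close>
    also have "\<dots> \<le> max 1 K ^ k" using k by (intro self_le_power) auto
    finally have "cmod (N k \<omega>) / sqrt (real k) \<le> (max 1 K / r) ^ k"
      using r0 by (simp add: power_divide field_simps)
    also have "\<dots> \<le> real B ^ k" using B r0 by (intro power_mono) auto
    finally show "cmod (N k \<omega>) \<le> real B ^ k * sqrt (real k)" using k by (simp add: field_simps)
  qed
next
  assume "\<exists>B::nat. \<forall>k\<ge>1. cmod (N k \<omega>) \<le> real B ^ k * sqrt (real k)"
  then obtain B :: nat where B: "\<And>k. k \<ge> 1 \<Longrightarrow> cmod (N k \<omega>) \<le> real B ^ k * sqrt (real k)" by blast
  \<comment> \<open>At this radius every term is at most (B / (2(B + 1)))^k, hence at most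
    2^(-k).\<close>
  define z where "z = complex_of_real (1 / (2 * (real B + 1)))"
  have nz: "norm z = 1 / (2 * (real B + 1))" unfolding z_def norm_of_real by simp
  have "summable (\<lambda>k. fps_nth (field_fps \<omega>) k * z ^ k)"
  proof (rule summable_comparison_test')
    show "summable (\<lambda>k. (1 / 2 :: real) ^ k)" by (rule summable_geometric) simp
    fix k :: nat
    show "norm (fps_nth (field_fps \<omega>) k * z ^ k) \<le> (1 / 2) ^ k"
    proof (cases "k = 0")
      case False
      have "cmod (N k \<omega>) / sqrt (real k) \<le> real B ^ k" using B[of k] False by (simp add: field_simps)
      then have "norm (fps_nth (field_fps \<omega>) k * z ^ k) \<le> real B ^ k * (1 / (2 * (real B + 1))) ^ k"
        unfolding field_fps_nth norm_mult norm_divide norm_power nz by (intro mult_mono) auto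
      also have "\<dots> = (real B / (2 * (real B + 1))) ^ k" by (simp add: power_divide power_mult_distrib)
      also have "\<dots> \<le> (1 / 2) ^ k" by (intro power_mono) (auto simp: field_simps)
      finally show ?thesis .
    qed (simp add: field_fps_nth)
  qed
  from conv_radius_geI[OF this] have "norm z \<le> fps_conv_radius (field_fps \<omega>)" by (simp add: fps_conv_radius_def)
  moreover have "norm z > 0" unfolding nz by simp
  ultimately show "fps_conv_radius (field_fps \<omega>) > 0"
    by (metis ereal_less(2) less_le_trans)
qed

text \<open>With radius zero the series diverges at every z other than 0, and \<open>suminf\<close>
  returns its default value. That value does not depend on \<omega>, which keeps the coefficient
  constant on this event.\<close>

lemma GC_divergent:
  assumes "\<not> fps_conv_radius (field_fps \<omega>) > 0"
  shows "GC N \<omega> = (\<lambda>z. if z = 0 then 0 else (THE s. False))"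
proof
  fix z
  show "GC N \<omega> z = (if z = 0 then 0 else (THE s. False))"
  proof (cases "z = 0")
    case False
    have "\<not> summable (\<lambda>k. fps_nth (field_fps \<omega>) k * z ^ k)"
    proof
      assume "summable (\<lambda>k. fps_nth (field_fps \<omega>) k * z ^ k)"
      from conv_radius_geI[OF this] have "norm z \<le> fps_conv_radius (field_fps \<omega>)" by (simp add: fps_conv_radius_def)
      moreover have "ereal (norm z) > 0" using False by simp
      ultimately show False using assms by (metis less_le_trans)
    qed
    then have "\<not> summable (\<lambda>k. fps_nth (field_fps \<omega>) (Suc k) * z ^ Suc k)"
      by (subst summable_Suc_iff[where f = "\<lambda>k. fps_nth (field_fps \<omega>) k * z ^ k"])
    then have "(\<lambda>s. (\<lambda>k. z ^ Suc k / complex_of_real (sqrt (real (Suc k))) * N (Suc k) \<omega>) sums s) = (\<lambda>s. False)"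
      by (auto simp: summable_def field_fps_nth mult_ac fun_eq_iff)
    then show ?thesis using False unfolding GC_def suminf_def by simp
  qed (simp add: GC_def)
qed

text \<open>Convergence in distribution asks for measurability on the whole space, so the
  exceptional null set cannot be ignored: there the coefficient is the fixed number
  \<open>K\<close>, elsewhere it is \<open>c n\<close>.\<close>

lemma secular_coeff_measurable [measurable]: "secular_coeff N \<theta> n \<in> borel_measurable P"
proof -
  define K where "K = fps_nth (fps_expansion (\<lambda>z::complex. exp (of_real (sqrt \<theta>) * (if z = 0 then 0 else (THE s. False)))) 0) n"
  have "secular_coeff N \<theta> n = (\<lambda>\<omega>. if \<exists>B::nat. \<forall>k\<in>{1..}. cmod (N k \<omega>) \<le> real B ^ k * sqrt (real k) then c n \<omega> else K)"
  proof
    fix \<omega>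
    show "secular_coeff N \<theta> n \<omega> = (if \<exists>B::nat. \<forall>k\<in>{1..}. cmod (N k \<omega>) \<le> real B ^ k * sqrt (real k) then c n \<omega> else K)"
      using secular_coeff_eq[of \<omega> n] GC_divergent[of \<omega>] conv_radius_pos_iff[of \<omega>]
      unfolding secular_coeff_def K_def by (auto simp: Ball_def)
  qed
  also have "\<dots> \<in> borel_measurable P" by measurable
  finally show ?thesis .
qed

text \<open>All |N_k| have the same mean, so the expected sum is a convergent geometric series. A
  series of nonnegative terms with finite expectation converges almost surely.\<close>

lemma AE_summable_N:
  assumes r: "0 \<le> r" "r < 1"
  shows "AE \<omega> in P. summable (\<lambda>k. cmod (N (Suc k) \<omega>) * r ^ Suc k)"
proof -
  let ?K = "\<integral>y. cmod y \<partial>cgauss"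
  have meas [measurable]: "N (Suc k) \<in> borel_measurable P" for k by simp
  have int: "integrable P (\<lambda>\<omega>. cmod (N (Suc k) \<omega>))" for k
    using all_moments_integrable[OF all_moments_N[of "Suc k"]] by simp
  have E: "(\<integral>\<omega>. cmod (N (Suc k) \<omega>) \<partial>P) = ?K" for k
    unfolding distr_N[of "Suc k", simplified, symmetric] by (subst integral_distr) auto
  have K0: "?K \<ge> 0" by simp
  have "(\<integral>\<^sup>+\<omega>. (\<Sum>k. ennreal (cmod (N (Suc k) \<omega>) * r ^ Suc k)) \<partial>P) = (\<Sum>k. \<integral>\<^sup>+\<omega>. ennreal (cmod (N (Suc k) \<omega>) * r ^ Suc k) \<partial>P)"
    by (rule nn_integral_suminf) measurable
  also have "\<dots> = (\<Sum>k. ennreal (?K * r ^ Suc k))"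
    using r int by (subst nn_integral_eq_integral) (auto simp: E)
  also have "\<dots> = ennreal (\<Sum>k. ?K * r ^ Suc k)"
    using r K0 by (intro suminf_ennreal2 summable_mult) (auto simp: summable_Suc_iff[where f = "\<lambda>k. r ^ k"] simp del: power_Suc)
  also have "\<dots> < \<infinity>" by simp
  finally have "AE \<omega> in P. (\<Sum>k. ennreal (cmod (N (Suc k) \<omega>) * r ^ Suc k)) \<noteq> \<infinity>"
    by (intro nn_integral_PInf_AE) auto
  then show ?thesis
    by eventually_elim (intro summable_suminf_not_top, use r in auto)
qed

text \<open>A single null set must serve all radii below 1; the countably many radii 1 - 1/(j+1)
  suffice.\<close>

lemma AE_conv_radius: "AE \<omega> in P. fps_conv_radius (field_fps \<omega>) \<ge> 1"
proof -
  have "AE \<omega> in P. \<forall>j::nat. summable (\<lambda>k. cmod (N (Suc k) \<omega>) * (1 - 1 / real (Suc j)) ^ Suc k)"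
    by (subst AE_all_countable, intro allI AE_summable_N) auto
  then show ?thesis
  proof eventually_elim
    case (elim \<omega>)
    have "ereal (1 - 1 / real (Suc j)) \<le> fps_conv_radius (field_fps \<omega>)" for j
    proof -
      let ?r = "1 - 1 / real (Suc j)"
      have r: "?r \<ge> 0" by simp
      have "summable (\<lambda>k. fps_nth (field_fps \<omega>) (Suc k) * of_real ?r ^ Suc k)"
      proof (rule summable_comparison_test'[OF elim[rule_format, of j]])
        fix k
        have "cmod (N (Suc k) \<omega>) / sqrt (real (Suc k)) \<le> cmod (N (Suc k) \<omega>) / 1"
          by (intro divide_left_mono) auto
        then show "norm (fps_nth (field_fps \<omega>) (Suc k) * of_real ?r ^ Suc k) \<le> cmod (N (Suc k) \<omega>) * ?r ^ Suc k"
          using r unfolding field_fps_nth norm_mult norm_divide norm_power norm_of_real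
          by (intro mult_mono) (auto simp del: power_Suc)
      qed
      then have "summable (\<lambda>k. fps_nth (field_fps \<omega>) k * of_real ?r ^ k)"
        by (subst (asm) summable_Suc_iff[where f = "\<lambda>k. fps_nth (field_fps \<omega>) k * of_real ?r ^ k"])
      from conv_radius_geI[OF this] show ?thesis
        using r unfolding fps_conv_radius_def norm_of_real by simp
    qed
    moreover have "(\<lambda>j. ereal (1 - 1 / real (Suc j))) \<longlonglongrightarrow> ereal 1"
      by (intro tendsto_intros) (real_asymp)
    ultimately show ?case
      by (intro LIMSEQ_le_const2[of "\<lambda>j. ereal (1 - 1 / real (Suc j))"]) (auto simp: one_ereal_def)
  qed
qed

lemma AE_secular_coeff: "AE \<omega> in P. \<forall>n. secular_coeff N \<theta> n \<omega> = c n \<omega>"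
  using AE_conv_radius
proof eventually_elim
  case (elim \<omega>)
  then have "fps_conv_radius (field_fps \<omega>) > 0" by (rule less_le_trans[rotated]) simp
  then show ?case using secular_coeff_eq by blast
qed

lemma expectation_secular_coeff: "expectation (\<lambda>\<omega>. (cmod (secular_coeff N \<theta> n \<omega>))\<^sup>2) = gbinom_wt \<theta> n"
proof -
  have "expectation (\<lambda>\<omega>. (cmod (secular_coeff N \<theta> n \<omega>))\<^sup>2) = expectation (\<lambda>\<omega>. (cmod (c n \<omega>))\<^sup>2)"
    by (rule integral_cong_AE) (use AE_secular_coeff in auto)
  then show ?thesis by (simp add: second_moment)
qed

end

section \<open>Parseval's identity and uniform integrability\<close>

abbreviation circle_measure :: "real measure" where
  "circle_measure \<equiv> restrict_space lborel {0..<2 * pi}"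

lemma emeasure_circle_measure: "emeasure circle_measure {0..<2 * pi} = ennreal (2 * pi)"
  by (simp add: emeasure_restrict_space)

interpretation circle: finite_measure circle_measure
  by standard (simp add: emeasure_circle_measure)

lemma integral_circle_cis:
  "(\<integral>\<phi>. cis (real_of_int k * \<phi>) \<partial>circle_measure) = (if k = 0 then of_real (2 * pi) else 0)"
proof (cases "k = 0")
  case True
  have "measure circle_measure (space circle_measure) = 2 * pi"
    by (simp add: measure_def emeasure_circle_measure)
  then show ?thesis using True by (simp add: scaleR_conv_of_real)
next
  case False
  have "(\<integral>\<phi>. cis (real_of_int k * \<phi>) \<partial>circle_measure) =
      (\<integral>x. indicator {0..<2 * pi} x *\<^sub>R cis (real_of_int k * x) \<partial>lborel)"
    by (subst integral_restrict_space) auto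
  \<comment> \<open>Passing to the closed interval adds one point of measure zero and permits the
    fundamental theorem of calculus.\<close>
  also have "\<dots> = (\<integral>x. indicator {0..2 * pi} x *\<^sub>R cis (real_of_int k * x) \<partial>lborel)"
  proof (rule integral_cong_AE)
    have meas: "(\<lambda>x. cis (real_of_int k * x)) \<in> borel_measurable borel"
      by (intro borel_measurable_continuous_onI continuous_intros)
    then show "(\<lambda>x. indicator {0..<2 * pi} x *\<^sub>R cis (real_of_int k * x)) \<in> borel_measurable lborel"
      "(\<lambda>x. indicator {0..2 * pi} x *\<^sub>R cis (real_of_int k * x)) \<in> borel_measurable lborel" by measurable
    show "AE x in lborel. indicat_real {0..<2 * pi} x *\<^sub>R cis (real_of_int k * x) = indicat_real {0..2 * pi} x *\<^sub>R cis (real_of_int k * x)"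
      using AE_lborel_singleton[of "2 * pi"] by eventually_elim (auto simp: indicator_def)
  qed
  also have "\<dots> = cis (real_of_int k * (2 * pi)) / (\<i> * of_int k) - cis (real_of_int k * 0) / (\<i> * of_int k)"
  proof (rule integral_FTC_Icc)
    fix x :: real
    have "((\<lambda>z. exp (\<i> * of_int k * z) / (\<i> * of_int k)) has_field_derivative exp (\<i> * of_int k * of_real x)) (at (of_real x))"
      using False by (auto intro!: derivative_eq_intros)
    from has_vector_derivative_real_field[OF this]
    show "((\<lambda>x. cis (real_of_int k * x) / (\<i> * of_int k)) has_vector_derivative cis (real_of_int k * x)) (at x within {0..2 * pi})"
      by (auto simp: cis_conv_exp mult_ac intro: has_vector_derivative_at_within)
  qed (auto intro!: continuous_intros)
  also have "cis (real_of_int k * (2 * pi)) = 1"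
    using cis_multiple_2pi[of "real_of_int k"] by (simp add: mult_ac)
  finally show ?thesis using False by simp
qed

lemma integral_circle_poly:
  fixes a :: "nat \<Rightarrow> complex"
  shows "(\<integral>\<phi>. (cmod (\<Sum>n<J. a n * cis (real n * \<phi>)))\<^sup>2 \<partial>circle_measure) = 2 * pi * (\<Sum>n<J. (cmod (a n))\<^sup>2)"
proof -
  have meas: "(\<lambda>x. cis (r * x)) \<in> borel_measurable borel" for r
    by (intro borel_measurable_continuous_onI continuous_intros)
  have int: "integrable circle_measure (\<lambda>\<phi>. d * cis (real_of_int k * \<phi>))" for d k
    by (rule circle.integrable_const_bound[where B = "cmod d"])
       (auto simp: norm_mult intro!: measurable_restrict_space1 borel_measurable_times meas)
  have "complex_of_real (\<integral>\<phi>. (cmod (\<Sum>n<J. a n * cis (real n * \<phi>)))\<^sup>2 \<partial>circle_measure) =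
    (\<integral>\<phi>. (\<Sum>n<J. \<Sum>m<J. (a n * cnj (a m)) * cis (real_of_int (int n - int m) * \<phi>)) \<partial>circle_measure)"
    unfolding integral_complex_of_real[symmetric]
  proof (rule Bochner_Integration.integral_cong[OF refl])
    fix \<phi>
    have "complex_of_real ((cmod (\<Sum>n<J. a n * cis (real n * \<phi>)))\<^sup>2) =
      (\<Sum>n<J. a n * cis (real n * \<phi>)) * (\<Sum>m<J. cnj (a m) * cis (- (real m * \<phi>)))"
      unfolding complex_norm_square cnj_sum by (simp add: cis_cnj)
    also have "\<dots> = (\<Sum>n<J. \<Sum>m<J. (a n * cnj (a m)) * cis (real_of_int (int n - int m) * \<phi>))"
      unfolding sum_product
    proof (intro sum.cong refl)
      fix n m
      have "cis (real n * \<phi>) * cis (- (real m * \<phi>)) = cis (real_of_int (int n - int m) * \<phi>)"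
        unfolding cis_mult by (simp add: algebra_simps)
      then show "a n * cis (real n * \<phi>) * (cnj (a m) * cis (- (real m * \<phi>))) = a n * cnj (a m) * cis (real_of_int (int n - int m) * \<phi>)"
        by (metis (no_types, opaque_lifting) mult.assoc mult.left_commute)
    qed
    finally show "complex_of_real ((cmod (\<Sum>n<J. a n * cis (real n * \<phi>)))\<^sup>2) =
      (\<Sum>n<J. \<Sum>m<J. (a n * cnj (a m)) * cis (real_of_int (int n - int m) * \<phi>))" .
  qed
  also have "\<dots> = (\<Sum>n<J. \<Sum>m<J. (a n * cnj (a m)) * (if int n - int m = 0 then of_real (2 * pi) else 0))"
    by (subst Bochner_Integration.integral_sum, intro Bochner_Integration.integrable_sum int, rule sum.cong[OF refl],
        subst Bochner_Integration.integral_sum, rule int, rule sum.cong[OF refl],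
        subst integral_mult_right_zero, subst integral_circle_cis, rule refl)
  also have "\<dots> = (\<Sum>n<J. (a n * cnj (a n)) * of_real (2 * pi))"
  proof (rule sum.cong[OF refl])
    fix n assume "n \<in> {..<J}"
    have "(\<Sum>m<J. (a n * cnj (a m)) * (if int n - int m = 0 then of_real (2 * pi) else 0)) =
      (\<Sum>m<J. if m = n then (a n * cnj (a m)) * complex_of_real (2 * pi) else 0)"
      by (intro sum.cong) auto
    then show "(\<Sum>m<J. (a n * cnj (a m)) * (if int n - int m = 0 then of_real (2 * pi) else 0)) = (a n * cnj (a n)) * of_real (2 * pi)"
      using \<open>n \<in> {..<J}\<close> by simp
  qed
  also have "\<dots> = complex_of_real (2 * pi * (\<Sum>n<J. (cmod (a n))\<^sup>2))"
    unfolding complex_norm_square[symmetric] by (simp add: sum_distrib_left sum_distrib_right mult_ac)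
  finally show ?thesis by (simp only: of_real_eq_iff)
qed

text \<open>The finite identity passes to the limit by dominated convergence, absolute summability
  providing the constant bound.\<close>

lemma Parseval_circle:
  fixes a :: "nat \<Rightarrow> complex"
  assumes sums: "\<And>\<phi>. (\<lambda>n. a n * cis (real n * \<phi>)) sums f \<phi>" and summ: "summable (\<lambda>n. cmod (a n))"
  shows "(\<lambda>n. 2 * pi * (cmod (a n))\<^sup>2) sums (\<integral>\<phi>. (cmod (f \<phi>))\<^sup>2 \<partial>circle_measure)"
proof -
  have meas [measurable]: "(\<lambda>x. cis (r * x)) \<in> borel_measurable borel" for r
    by (intro borel_measurable_continuous_onI continuous_intros)
  have f: "f = (\<lambda>\<phi>. \<Sum>n. a n * cis (real n * \<phi>))" using sums by (simp add: sums_iff fun_eq_iff)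
  have fm: "f \<in> borel_measurable borel" unfolding f by measurable
  have "(\<lambda>J. \<integral>\<phi>. (cmod (\<Sum>n<J. a n * cis (real n * \<phi>)))\<^sup>2 \<partial>circle_measure) \<longlonglongrightarrow> (\<integral>\<phi>. (cmod (f \<phi>))\<^sup>2 \<partial>circle_measure)"
  proof (rule integral_dominated_convergence[where w = "\<lambda>_. (\<Sum>n. cmod (a n))\<^sup>2"])
    show "(\<lambda>\<phi>. (cmod (f \<phi>))\<^sup>2) \<in> borel_measurable circle_measure"
      using fm by (intro measurable_restrict_space1) measurable
    show "(\<lambda>\<phi>. (cmod (\<Sum>n<J. a n * cis (real n * \<phi>)))\<^sup>2) \<in> borel_measurable circle_measure" for J
      by (intro measurable_restrict_space1) measurable
    show "AE \<phi> in circle_measure. (\<lambda>J. (cmod (\<Sum>n<J. a n * cis (real n * \<phi>)))\<^sup>2) \<longlonglongrightarrow> (cmod (f \<phi>))\<^sup>2"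
      using sums by (intro AE_I2 tendsto_intros) (auto simp: sums_def)
    show "AE \<phi> in circle_measure. norm ((cmod (\<Sum>n<J. a n * cis (real n * \<phi>)))\<^sup>2) \<le> (\<Sum>n. cmod (a n))\<^sup>2" for J
    proof (rule AE_I2)
      fix \<phi>
      have "cmod (\<Sum>n<J. a n * cis (real n * \<phi>)) \<le> (\<Sum>n<J. cmod (a n))"
        by (rule sum_norm_le) (simp add: norm_mult)
      also have "\<dots> \<le> (\<Sum>n. cmod (a n))" using summ by (intro sum_le_suminf) auto
      finally show "norm ((cmod (\<Sum>n<J. a n * cis (real n * \<phi>)))\<^sup>2) \<le> (\<Sum>n. cmod (a n))\<^sup>2"
        by (simp add: power_mono)
    qed
  qed simp
  then show ?thesis unfolding sums_def integral_circle_poly sum_distrib_left .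
qed

text \<open>The L^2 bound supplies uniform integrability. The limit is shown to be square integrable
  first, so that the difference is also bounded in L^2.\<close>

lemma (in prob_space) L1_convergence_of_L2_bounded:
  fixes X :: "nat \<Rightarrow> 'a \<Rightarrow> real" and Y :: "'a \<Rightarrow> real"
  assumes [measurable]: "\<And>n. X n \<in> borel_measurable M" "Y \<in> borel_measurable M"
    and X2: "\<And>n. integrable M (\<lambda>\<omega>. (X n \<omega>)\<^sup>2)" "\<And>n. (\<integral>\<omega>. (X n \<omega>)\<^sup>2 \<partial>M) \<le> S"
    and conv: "\<And>\<epsilon>. \<epsilon> > 0 \<Longrightarrow> (\<lambda>n. prob {\<omega> \<in> space M. \<epsilon> < \<bar>X n \<omega> - Y \<omega>\<bar>}) \<longlonglongrightarrow> 0"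
  shows "integrable M Y" "(\<lambda>n. \<integral>\<omega>. \<bar>X n \<omega> - Y \<omega>\<bar> \<partial>M) \<longlonglongrightarrow> 0"
proof -
  let ?A = "\<lambda>\<epsilon> n. {\<omega> \<in> space M. \<epsilon> < \<bar>X n \<omega> - Y \<omega>\<bar>}"
  have S: "S \<ge> 0" by (rule order_trans[OF Bochner_Integration.integral_nonneg X2(2)[of 0]]) simp
  have ind: "integrable M (indicat_real (?A \<epsilon> n))" for \<epsilon> n by (intro integrable_real_indicator) (auto simp: emeasure_eq_measure)
  \<comment> \<open>Where |X - Y| <= 1, Y^2 is at most 2 X^2 + 2; elsewhere the truncation at k
    bounds it, and that event has vanishing probability. The resulting bound is free of k, so
    monotone convergence removes the truncation.\<close>
  have trunc: "(\<integral>\<omega>. min ((Y \<omega>)\<^sup>2) (real k) \<partial>M) \<le> 2 * S + 2" for k :: nat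
  proof (rule LIMSEQ_le_const)
    have "(\<lambda>n. 2 * S + 2 + real k * prob (?A 1 n)) \<longlonglongrightarrow> 2 * S + 2 + real k * 0"
      by (intro tendsto_intros conv) simp
    then show "(\<lambda>n. 2 * S + 2 + real k * prob (?A 1 n)) \<longlonglongrightarrow> 2 * S + 2" by simp
    show "\<exists>N. \<forall>n\<ge>N. (\<integral>\<omega>. min ((Y \<omega>)\<^sup>2) (real k) \<partial>M) \<le> 2 * S + 2 + real k * prob (?A 1 n)"
    proof (intro exI[of _ 0] allI impI)
      fix n
      have "(\<integral>\<omega>. min ((Y \<omega>)\<^sup>2) (real k) \<partial>M) \<le> (\<integral>\<omega>. 2 * (X n \<omega>)\<^sup>2 + 2 + real k * indicat_real (?A 1 n) \<omega> \<partial>M)"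
      proof (rule integral_mono)
        show "integrable M (\<lambda>\<omega>. min ((Y \<omega>)\<^sup>2) (real k))"
          by (rule integrable_const_bound[where B = "real k"]) auto
        show "integrable M (\<lambda>\<omega>. 2 * (X n \<omega>)\<^sup>2 + 2 + real k * indicat_real (?A 1 n) \<omega>)"
          using X2(1) ind by simp
        fix \<omega> assume \<omega>: "\<omega> \<in> space M"
        show "min ((Y \<omega>)\<^sup>2) (real k) \<le> 2 * (X n \<omega>)\<^sup>2 + 2 + real k * indicat_real (?A 1 n) \<omega>"
        proof (cases "\<omega> \<in> ?A 1 n")
          case False
          then have "\<bar>X n \<omega> - Y \<omega>\<bar> \<le> 1" using \<omega> by auto
          then have "(X n \<omega> - Y \<omega>)\<^sup>2 \<le> 1" by (simp add: abs_square_le_1)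
          moreover have "(Y \<omega>)\<^sup>2 \<le> 2 * (X n \<omega>)\<^sup>2 + 2 * (X n \<omega> - Y \<omega>)\<^sup>2"
            using zero_le_power2[of "2 * X n \<omega> - Y \<omega>"] by (simp add: power2_eq_square algebra_simps)
          ultimately show ?thesis using False by simp
        qed (auto intro: order_trans[OF min.cobounded2] add_nonneg_nonneg)
      qed
      also have "\<dots> = 2 * (\<integral>\<omega>. (X n \<omega>)\<^sup>2 \<partial>M) + 2 + real k * prob (?A 1 n)"
        using X2(1) ind by (simp add: prob_space)
      also have "\<dots> \<le> 2 * S + 2 + real k * prob (?A 1 n)" using X2(2)[of n] by simp
      finally show "(\<integral>\<omega>. min ((Y \<omega>)\<^sup>2) (real k) \<partial>M) \<le> 2 * S + 2 + real k * prob (?A 1 n)" .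
    qed
  qed
  have "(\<integral>\<^sup>+\<omega>. ennreal ((Y \<omega>)\<^sup>2) \<partial>M) = (\<integral>\<^sup>+\<omega>. (SUP k. ennreal (min ((Y \<omega>)\<^sup>2) (real k))) \<partial>M)"
  proof (rule nn_integral_cong)
    fix \<omega>
    obtain k0 :: nat where k0: "(Y \<omega>)\<^sup>2 \<le> real k0" using real_arch_simple by blast
    show "ennreal ((Y \<omega>)\<^sup>2) = (SUP k. ennreal (min ((Y \<omega>)\<^sup>2) (real k)))"
      by (rule antisym, rule SUP_upper2[of k0], simp, use k0 in \<open>simp add: min_absorb1\<close>)
         (intro SUP_least ennreal_leI, simp)
  qed
  also have "\<dots> = (SUP k. \<integral>\<^sup>+\<omega>. ennreal (min ((Y \<omega>)\<^sup>2) (real k)) \<partial>M)"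
    by (intro nn_integral_monotone_convergence_SUP) (auto simp: incseq_def le_fun_def intro!: ennreal_leI min.mono)
  also have "\<dots> \<le> ennreal (2 * S + 2)"
  proof (rule SUP_least)
    fix k :: nat
    have "(\<integral>\<^sup>+\<omega>. ennreal (min ((Y \<omega>)\<^sup>2) (real k)) \<partial>M) = ennreal (\<integral>\<omega>. min ((Y \<omega>)\<^sup>2) (real k) \<partial>M)"
      by (intro nn_integral_eq_integral integrable_const_bound[where B = "real k"]) auto
    then show "(\<integral>\<^sup>+\<omega>. ennreal (min ((Y \<omega>)\<^sup>2) (real k)) \<partial>M) \<le> ennreal (2 * S + 2)"
      using trunc[of k] by (simp add: ennreal_leI)
  qed
  finally have nn: "(\<integral>\<^sup>+\<omega>. ennreal ((Y \<omega>)\<^sup>2) \<partial>M) \<le> ennreal (2 * S + 2)" .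
  then have "(\<integral>\<^sup>+\<omega>. ennreal ((Y \<omega>)\<^sup>2) \<partial>M) < \<infinity>" by (rule order.strict_trans1) simp
  then have Y2: "integrable M (\<lambda>\<omega>. (Y \<omega>)\<^sup>2)" by (simp add: integrable_iff_bounded)
  have Y2le: "(\<integral>\<omega>. (Y \<omega>)\<^sup>2 \<partial>M) \<le> 2 * S + 2"
    using nn S by (subst (asm) nn_integral_eq_integral[OF Y2]) (auto simp: ennreal_le_iff simp del: ennreal_plus)
  show intY: "integrable M Y" by (rule square_integrable_imp_integrable[OF assms(2) Y2])
  have intX: "integrable M (X n)" for n by (rule square_integrable_imp_integrable[OF assms(1) X2(1)])
  define C where "C = 2 * S + 2 * (2 * S + 2)"
  have C: "C > 0" using S by (simp add: C_def)
  \<comment> \<open>On the bad event |d| <= \<delta> d^2 + 1/(4\<delta>), from the square of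
    2\<delta>|d| - 1. The quadratic part is paid by the L^2 bounds, the constant part by the
    probability of the event.\<close>
  have bound: "(\<integral>\<omega>. \<bar>X n \<omega> - Y \<omega>\<bar> \<partial>M) \<le> \<epsilon> + \<delta> * C + prob (?A \<epsilon> n) / (4 * \<delta>)" if "\<epsilon> > 0" "\<delta> > 0" for n \<epsilon> \<delta>
  proof -
    have "(\<integral>\<omega>. \<bar>X n \<omega> - Y \<omega>\<bar> \<partial>M) \<le> (\<integral>\<omega>. \<epsilon> + \<delta> * (2 * (X n \<omega>)\<^sup>2 + 2 * (Y \<omega>)\<^sup>2) + (1 / (4 * \<delta>)) * indicat_real (?A \<epsilon> n) \<omega> \<partial>M)"
    proof (rule integral_mono)
      show "integrable M (\<lambda>\<omega>. \<bar>X n \<omega> - Y \<omega>\<bar>)" using intX intY by simp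
      show "integrable M (\<lambda>\<omega>. \<epsilon> + \<delta> * (2 * (X n \<omega>)\<^sup>2 + 2 * (Y \<omega>)\<^sup>2) + (1 / (4 * \<delta>)) * indicat_real (?A \<epsilon> n) \<omega>)"
        using X2(1) Y2 ind by simp
      fix \<omega> assume \<omega>: "\<omega> \<in> space M"
      let ?d = "X n \<omega> - Y \<omega>"
      have d2: "?d\<^sup>2 \<le> 2 * (X n \<omega>)\<^sup>2 + 2 * (Y \<omega>)\<^sup>2"
        using zero_le_power2[of "X n \<omega> + Y \<omega>"] by (simp add: power2_eq_square algebra_simps)
      show "\<bar>?d\<bar> \<le> \<epsilon> + \<delta> * (2 * (X n \<omega>)\<^sup>2 + 2 * (Y \<omega>)\<^sup>2) + (1 / (4 * \<delta>)) * indicat_real (?A \<epsilon> n) \<omega>"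
      proof (cases "\<omega> \<in> ?A \<epsilon> n")
        case True
        have "\<bar>?d\<bar> \<le> \<delta> * ?d\<^sup>2 + 1 / (4 * \<delta>)"
        proof -
          have "0 \<le> (2 * \<delta> * \<bar>?d\<bar> - 1)\<^sup>2" by simp
          also have "\<dots> = 4 * \<delta> * (\<delta> * ?d\<^sup>2 - \<bar>?d\<bar>) + 1" by (simp add: power2_diff power_mult_distrib) (simp add: power2_eq_square algebra_simps)
          finally have "4 * \<delta> * \<bar>?d\<bar> \<le> 4 * \<delta> * (\<delta> * ?d\<^sup>2) + 1" by (simp add: right_diff_distrib)
          then show ?thesis using that by (simp add: field_simps)
        qed
        also have "\<delta> * ?d\<^sup>2 \<le> \<delta> * (2 * (X n \<omega>)\<^sup>2 + 2 * (Y \<omega>)\<^sup>2)" using d2 that by (intro mult_left_mono) auto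
        finally show ?thesis using True that by simp
      next
        case False
        then have "\<bar>?d\<bar> \<le> \<epsilon>" using \<omega> by auto
        moreover have "0 \<le> \<delta> * (2 * (X n \<omega>)\<^sup>2 + 2 * (Y \<omega>)\<^sup>2)" using that by simp
        ultimately show ?thesis using False by simp
      qed
    qed
    also have "\<dots> = \<epsilon> + \<delta> * (2 * (\<integral>\<omega>. (X n \<omega>)\<^sup>2 \<partial>M) + 2 * (\<integral>\<omega>. (Y \<omega>)\<^sup>2 \<partial>M)) + (1 / (4 * \<delta>)) * prob (?A \<epsilon> n)"
      using X2(1) Y2 ind by (simp add: prob_space)
    also have "\<dots> \<le> \<epsilon> + \<delta> * C + prob (?A \<epsilon> n) / (4 * \<delta>)"
      using X2(2)[of n] Y2le that by (intro add_mono mult_left_mono) (auto simp: C_def)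
    finally show ?thesis .
  qed
  show "(\<lambda>n. \<integral>\<omega>. \<bar>X n \<omega> - Y \<omega>\<bar> \<partial>M) \<longlonglongrightarrow> 0"
  proof (rule LIMSEQ_I)
    fix e :: real assume e: "e > 0"
    \<comment> \<open>Makes \<delta> * C one third of e; the other two thirds are the threshold e/3
      and the probability term.\<close>
    define \<delta> where "\<delta> = e / (3 * C)"
    have \<delta>: "\<delta> > 0" using e C by (simp add: \<delta>_def)
    have "(\<lambda>n. prob (?A (e / 3) n) / (4 * \<delta>)) \<longlonglongrightarrow> 0 / (4 * \<delta>)" using \<delta> e by (intro tendsto_intros conv) auto
    then have "\<forall>\<^sub>F n in sequentially. prob (?A (e / 3) n) / (4 * \<delta>) < e / 3"
      by (rule order_tendstoD(2)) (use e in simp)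
    then obtain n0 where n0: "\<And>n. n \<ge> n0 \<Longrightarrow> prob (?A (e / 3) n) / (4 * \<delta>) < e / 3"
      by (auto simp: eventually_sequentially)
    show "\<exists>n0. \<forall>n\<ge>n0. norm ((\<integral>\<omega>. \<bar>X n \<omega> - Y \<omega>\<bar> \<partial>M) - 0) < e"
    proof (intro exI[of _ n0] allI impI)
      fix n assume "n \<ge> n0"
      have "(\<integral>\<omega>. \<bar>X n \<omega> - Y \<omega>\<bar> \<partial>M) < e"
        using bound[of "e / 3" \<delta> n] n0[OF \<open>n \<ge> n0\<close>] e \<delta> C by (simp add: \<delta>_def)
      then show "norm ((\<integral>\<omega>. \<bar>X n \<omega> - Y \<omega>\<bar> \<partial>M) - 0) < e" by simp
    qed
  qed
qed

lemma gbinom_wt_sums: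
  assumes "\<bar>x\<bar> < 1" shows "(\<lambda>n. gbinom_wt \<theta> n * x ^ n) sums (1 - x) powr (- \<theta>)"
proof -
  have "(\<lambda>n. (- \<theta> gchoose n) * (- x) ^ n) sums (1 + - x) powr (- \<theta>)"
    using assms by (intro gen_binomial_real) auto
  moreover have "(- \<theta> gchoose n) * (- x) ^ n = gbinom_wt \<theta> n * x ^ n" for n
    by (simp add: gbinomial_pochhammer gbinom_wt_def power_minus[of x] mult_ac)
  ultimately show ?thesis by simp
qed

section \<open>The total mass of the chaos as an Abel sum\<close>

context secular_chaos
begin

text \<open>The function is holomorphic on the unit disc, so its Taylor series converges on all of
  it; the composition of formal series alone gives only a germ at 0.\<close>

lemma sums_c:
  assumes good: "fps_conv_radius (field_fps \<omega>) \<ge> 1" and z: "norm z < 1"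
  shows "(\<lambda>n. c n \<omega> * z ^ n) sums exp (of_real (sqrt \<theta>) * GC N \<omega> z)"
proof -
  let ?f = "\<lambda>z. exp (of_real (sqrt \<theta>) * GC N \<omega> z)"
  have pos: "fps_conv_radius (field_fps \<omega>) > 0" using good by (rule less_le_trans[rotated]) simp
  have lt: "ereal (norm w) < fps_conv_radius (field_fps \<omega>)" if "w \<in> ball 0 1" for w
    using that good by (intro less_le_trans[OF _ good]) (simp add: one_ereal_def)
  have "(\<lambda>z. exp (of_real (sqrt \<theta>) * eval_fps (field_fps \<omega>) z)) holomorphic_on ball 0 1"
    using lt by (intro holomorphic_intros) (auto simp: in_eball_iff)
  then have hol: "?f holomorphic_on ball 0 1"
    by (rule holomorphic_transform) (simp add: GC_sums lt)
  have "(\<lambda>n. (deriv ^^ n) ?f 0 / fact n * (z - 0) ^ n) sums ?f z"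
    by (rule holomorphic_power_series[OF hol]) (use z in simp)
  moreover have "(deriv ^^ n) ?f 0 / fact n = c n \<omega>" for n
    using fps_nth_fps_expansion[OF exp_GC_has_fps_expansion[OF pos], of n] unfolding exp_field_fps_nth by simp
  ultimately show ?thesis by simp
qed

lemma summable_c:
  assumes good: "fps_conv_radius (field_fps \<omega>) \<ge> 1" and r: "0 \<le> r" "r < 1"
  shows "summable (\<lambda>n. cmod (c n \<omega>) * r ^ n)"
proof -
  \<comment> \<open>Convergence at the intermediate radius (1 + r)/2 gives absolute convergence at
    r.\<close>
  have "summable (\<lambda>n. c n \<omega> * of_real ((1 + r) / 2) ^ n)"
    using r by (intro sums_summable[OF sums_c[OF good]]) (simp add: norm_divide del: of_real_add)
  then have "summable (\<lambda>n. norm (c n \<omega> * of_real r ^ n))"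
    by (rule powser_insidea) (use r in \<open>simp add: norm_divide del: of_real_add\<close>)
  then show ?thesis using r by (simp add: norm_mult norm_power)
qed

definition energy :: "real \<Rightarrow> 'a \<Rightarrow> real" where
  "energy x \<omega> = (\<Sum>n. (cmod (c n \<omega>))\<^sup>2 * x ^ n)"

lemma energy_measurable [measurable]: "energy x \<in> borel_measurable P"
  unfolding energy_def[abs_def] by measurable

text \<open>Because |exp w|^2 = exp(2 Re w), the density of the approximating chaos is the squared
  modulus of the generating function of the c_n on the circle of radius r. Parseval therefore yields
  powers of r^2.\<close>

lemma energy_sums:
  assumes good: "fps_conv_radius (field_fps \<omega>) \<ge> 1" and r: "0 \<le> r" "r < 1"
  shows "summable (\<lambda>n. (cmod (c n \<omega>))\<^sup>2 * (r\<^sup>2) ^ n)"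
    and "(\<integral>\<phi>. exp (sqrt \<theta> * G_field N \<omega> (of_real r * cis \<phi>)) \<partial>circle_measure) = 2 * pi * energy (r\<^sup>2) \<omega>"
proof -
  let ?f = "\<lambda>\<phi>. exp (of_real (sqrt \<theta>) * GC N \<omega> (of_real r * cis \<phi>))"
  have "(\<lambda>n. 2 * pi * (cmod (c n \<omega> * of_real (r ^ n)))\<^sup>2) sums (\<integral>\<phi>. (cmod (?f \<phi>))\<^sup>2 \<partial>circle_measure)"
  proof (rule Parseval_circle)
    fix \<phi>
    have "(\<lambda>n. c n \<omega> * (of_real r * cis \<phi>) ^ n) sums ?f \<phi>"
      using r by (intro sums_c[OF good]) (simp add: norm_mult)
    then show "(\<lambda>n. c n \<omega> * of_real (r ^ n) * cis (real n * \<phi>)) sums ?f \<phi>"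
      by (simp add: power_mult_distrib mult.assoc Complex.DeMoivre)
  qed (use summable_c[OF good r] r in \<open>simp add: norm_mult norm_power\<close>)
  moreover have "(cmod (?f \<phi>))\<^sup>2 = exp (sqrt \<theta> * G_field N \<omega> (of_real r * cis \<phi>))" for \<phi>
    unfolding norm_exp_eq_Re G_field_def by (simp add: exp_double[symmetric] mult_ac)
  moreover have "2 * pi * (cmod (c n \<omega> * of_real (r ^ n)))\<^sup>2 = 2 * pi * ((cmod (c n \<omega>))\<^sup>2 * (r\<^sup>2) ^ n)" for n
    using r by (simp add: norm_mult norm_power power_mult_distrib power_mult[symmetric] mult.commute[of n])
  ultimately have "(\<lambda>n. 2 * pi * ((cmod (c n \<omega>))\<^sup>2 * (r\<^sup>2) ^ n)) sums
      (\<integral>\<phi>. exp (sqrt \<theta> * G_field N \<omega> (of_real r * cis \<phi>)) \<partial>circle_measure)" by simp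
  from sums_divide[OF this, of "2 * pi"]
  have s: "(\<lambda>n. (cmod (c n \<omega>))\<^sup>2 * (r\<^sup>2) ^ n) sums
      ((\<integral>\<phi>. exp (sqrt \<theta> * G_field N \<omega> (of_real r * cis \<phi>)) \<partial>circle_measure) / (2 * pi))"
    by simp
  then show "summable (\<lambda>n. (cmod (c n \<omega>))\<^sup>2 * (r\<^sup>2) ^ n)"
    "(\<integral>\<phi>. exp (sqrt \<theta> * G_field N \<omega> (of_real r * cis \<phi>)) \<partial>circle_measure) = 2 * pi * energy (r\<^sup>2) \<omega>"
    by (simp_all add: sums_iff energy_def)
qed

lemma G_field_measurable:
  "(\<lambda>(\<omega>, \<phi>). G_field N \<omega> (of_real r * cis \<phi>)) \<in> borel_measurable (P \<Otimes>\<^sub>M circle_measure)"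
proof -
  have [measurable]: "N (Suc k) \<in> borel_measurable P" for k by simp
  have c: "cis \<in> borel_measurable borel"
    by (intro borel_measurable_continuous_onI continuous_intros)
  have [measurable]: "(\<lambda>\<phi>. cis \<phi>) \<in> borel_measurable circle_measure"
    using c by (intro measurable_restrict_space1) auto
  show ?thesis unfolding G_field_def GC_def by measurable
qed

lemma GMC_approx_total:
  assumes "\<omega> \<in> space P"
  shows "(\<integral>\<phi>. (1::real) \<partial>GMC_approx N \<theta> r \<omega>) =
    (1 - r\<^sup>2) powr \<theta> * (\<integral>\<phi>. exp (sqrt \<theta> * G_field N \<omega> (of_real r * cis \<phi>)) \<partial>circle_measure)"
proof -
  have [measurable]: "(\<lambda>\<phi>. G_field N \<omega> (of_real r * cis \<phi>)) \<in> borel_measurable circle_measure"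
    using measurable_compose[OF measurable_Pair1'[OF assms] G_field_measurable[of r]] by simp
  show ?thesis unfolding GMC_approx_def
    by (subst integral_density) auto
qed

text \<open>Of the weak convergence only the constant test function 1 is used. The threshold is
  applied as 2 pi \<epsilon>, which matches the factor 1/(2 pi) in \<open>GMC_mass\<close>; the
  limit r to 1 from the left is then read along the sequence.\<close>

lemma GMC_mass_conv:
  assumes gmc: "is_GMC P N \<theta> GMC" and r: "\<And>n. 0 \<le> r n" "\<And>n. r n < 1" "r \<longlonglongrightarrow> 1" and \<epsilon>: "\<epsilon> > 0"
  shows "(\<lambda>n. prob {\<omega> \<in> space P. \<epsilon> < \<bar>(1 - (r n)\<^sup>2) powr \<theta> * energy ((r n)\<^sup>2) \<omega> - GMC_mass GMC \<omega>\<bar>}) \<longlonglongrightarrow> 0"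
    and "GMC_mass GMC \<in> borel_measurable P"
proof -
  let ?S = "restrict_space borel {0..<2 * pi}"
  have rf: "random_finite_measure P ?S GMC" using gmc by (simp add: is_GMC_def)
  have sp: "space (GMC \<omega>) = {0..<2 * pi}" if "\<omega> \<in> space P" for \<omega>
    using rf that sets_eq_imp_space_eq[of "GMC \<omega>" ?S] by (auto simp: random_finite_measure_def space_restrict_space)
  have "{0..<2 * pi} \<in> sets ?S" by (simp add: sets_restrict_space_iff)
  then have "(\<lambda>\<omega>. emeasure (GMC \<omega>) {0..<2 * pi}) \<in> borel_measurable P" using rf by (simp add: random_finite_measure_def)
  then show meas [measurable]: "GMC_mass GMC \<in> borel_measurable P"
    unfolding GMC_mass_def[abs_def] measure_def by measurable
  define X where "X r \<omega> = (\<integral>\<phi>. (1::real) \<partial>GMC_approx N \<theta> r \<omega>)" for r \<omega>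
  have X_eq: "X r \<omega> = (1 - r\<^sup>2) powr \<theta> * (\<integral>\<phi>. exp (sqrt \<theta> * G_field N \<omega> (of_real r * cis \<phi>)) \<partial>circle_measure)"
    if "\<omega> \<in> space P" for r \<omega> unfolding X_def by (rule GMC_approx_total[OF that])
  have [measurable]: "X r \<in> borel_measurable P" for r
  proof -
    have "(\<lambda>\<omega>. (1 - r\<^sup>2) powr \<theta> * (\<integral>\<phi>. exp (sqrt \<theta> * G_field N \<omega> (of_real r * cis \<phi>)) \<partial>circle_measure)) \<in> borel_measurable P"
    proof (intro borel_measurable_times borel_measurable_const circle.borel_measurable_lebesgue_integral)
      have "(\<lambda>g. exp (sqrt \<theta> * g)) \<in> borel_measurable borel" by measurable
      from measurable_compose[OF G_field_measurable[of r] this]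
      show "(\<lambda>(\<omega>, \<phi>). exp (sqrt \<theta> * G_field N \<omega> (of_real r * cis \<phi>))) \<in> borel_measurable (P \<Otimes>\<^sub>M circle_measure)"
        by (simp only: case_prod_beta')
    qed
    then show ?thesis by (rule measurable_cong[THEN iffD2, rotated]) (rule X_eq)
  qed
  have Y: "(\<integral>\<phi>. (1::real) \<partial>GMC \<omega>) = 2 * pi * GMC_mass GMC \<omega>" if "\<omega> \<in> space P" for \<omega>
    using sp[OF that] by (simp add: GMC_mass_def)
  have "((\<lambda>r. prob {\<omega> \<in> space P. 2 * pi * \<epsilon> < \<bar>X r \<omega> - (\<integral>\<phi>. (1::real) \<partial>GMC \<omega>)\<bar>}) \<longlongrightarrow> 0) (at_left 1)"
  proof -
    have "converges_in_probability P (\<lambda>r \<omega>. \<integral>\<phi>. (\<lambda>_::complex. 1) (cis \<phi>) \<partial>GMC_approx N \<theta> r \<omega>)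
          (\<lambda>\<omega>. \<integral>\<phi>. (\<lambda>_::complex. 1) (cis \<phi>) \<partial>GMC \<omega>) (at_left 1)"
      using gmc[unfolded is_GMC_def, THEN conjunct2, rule_format, of "\<lambda>_. 1"] by simp
    then show ?thesis unfolding converges_in_probability_def X_def
      using \<epsilon> by (auto intro: mult_pos_pos)
  qed
  moreover have "filterlim r (at_left 1) sequentially"
    using r less_imp_neq[OF r(2)] by (auto simp: filterlim_at)
  ultimately have "(\<lambda>n. prob {\<omega> \<in> space P. 2 * pi * \<epsilon> < \<bar>X (r n) \<omega> - (\<integral>\<phi>. (1::real) \<partial>GMC \<omega>)\<bar>}) \<longlonglongrightarrow> 0"
    by (rule filterlim_compose)
  moreover have "prob {\<omega> \<in> space P. 2 * pi * \<epsilon> < \<bar>X (r n) \<omega> - (\<integral>\<phi>. (1::real) \<partial>GMC \<omega>)\<bar>} =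
     prob {\<omega> \<in> space P. \<epsilon> < \<bar>(1 - (r n)\<^sup>2) powr \<theta> * energy ((r n)\<^sup>2) \<omega> - GMC_mass GMC \<omega>\<bar>}" for n
  proof -
    have "{\<omega> \<in> space P. 2 * pi * \<epsilon> < \<bar>X (r n) \<omega> - (\<integral>\<phi>. (1::real) \<partial>GMC \<omega>)\<bar>} = {\<omega> \<in> space P. 2 * pi * \<epsilon> < \<bar>X (r n) \<omega> - 2 * pi * GMC_mass GMC \<omega>\<bar>}"
      using Y by auto
    also have "prob \<dots> = prob {\<omega> \<in> space P. \<epsilon> < \<bar>(1 - (r n)\<^sup>2) powr \<theta> * energy ((r n)\<^sup>2) \<omega> - GMC_mass GMC \<omega>\<bar>}"
    proof (rule finite_measure_eq_AE)
      show "AE \<omega> in P. (\<omega> \<in> {\<omega> \<in> space P. 2 * pi * \<epsilon> < \<bar>X (r n) \<omega> - 2 * pi * GMC_mass GMC \<omega>\<bar>}) \<longleftrightarrow>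
        (\<omega> \<in> {\<omega> \<in> space P. \<epsilon> < \<bar>(1 - (r n)\<^sup>2) powr \<theta> * energy ((r n)\<^sup>2) \<omega> - GMC_mass GMC \<omega>\<bar>})"
        using AE_conv_radius AE_space
      proof eventually_elim
        case (elim \<omega>)
        have "X (r n) \<omega> - 2 * pi * GMC_mass GMC \<omega> = 2 * pi * ((1 - (r n)\<^sup>2) powr \<theta> * energy ((r n)\<^sup>2) \<omega> - GMC_mass GMC \<omega>)"
          unfolding X_eq[OF elim(2)] energy_sums(2)[OF elim(1) r(1) r(2)] by (simp add: algebra_simps)
        then show ?case by (simp add: abs_mult)
      qed
    qed measurable
    finally show ?thesis .
  qed
  ultimately show "(\<lambda>n. prob {\<omega> \<in> space P. \<epsilon> < \<bar>(1 - (r n)\<^sup>2) powr \<theta> * energy ((r n)\<^sup>2) \<omega> - GMC_mass GMC \<omega>\<bar>}) \<longlonglongrightarrow> 0"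
    by simp
qed

definition sq_const :: real where "sq_const = (\<Sum>k. (gbinom_wt \<theta> k)\<^sup>2)"

text \<open>The mean energy is (1 - r^2)^(-\<theta>), so the normalising factor turns the bound of
  \<open>energy_L2\<close> into one uniform in r.\<close>

lemma energy_sq_bound:
  assumes r: "0 \<le> r" "r < 1"
  shows "integrable P (\<lambda>\<omega>. ((1 - r\<^sup>2) powr \<theta> * energy (r\<^sup>2) \<omega>)\<^sup>2)"
    and "(\<integral>\<omega>. ((1 - r\<^sup>2) powr \<theta> * energy (r\<^sup>2) \<omega>)\<^sup>2 \<partial>P) \<le> sq_const"
proof -
  let ?x = "r\<^sup>2" and ?w = "(1 - r\<^sup>2) powr \<theta>"
  have x: "0 \<le> ?x" "?x < 1" using r by (auto simp: power_less_one_iff abs_square_less_1)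
  have g0: "gbinom_wt \<theta> j \<ge> 0" for j using gbinom_wt_pos[OF theta_pos, of j] by simp
  have K0: "sq_const \<ge> 0" unfolding sq_const_def using summable_gbinom_wt_sq[OF theta_pos theta_lt] by (intro suminf_nonneg) auto
  have fin: "(\<integral>\<^sup>+\<omega>. ennreal ((?w * (\<Sum>j<J. (cmod (c j \<omega>))\<^sup>2 * ?x ^ j))\<^sup>2) \<partial>P) \<le> ennreal sq_const" for J
  proof -
    have int: "integrable P (\<lambda>\<omega>. (?w * (\<Sum>j<J. (cmod (c j \<omega>))\<^sup>2 * ?x ^ j))\<^sup>2)"
      unfolding power_mult_distrib using integrable_energy_sq[of ?x J] x by simp
    have "(\<Sum>j<J. gbinom_wt \<theta> j * ?x ^ j) \<le> (1 - ?x) powr (- \<theta>)"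
      using gbinom_wt_sums[of ?x \<theta>] sum_le_suminf[of "\<lambda>j. gbinom_wt \<theta> j * ?x ^ j" "{..<J}"] x g0
      by (simp add: sums_iff)
    then have "?w * (\<Sum>j<J. gbinom_wt \<theta> j * ?x ^ j) \<le> ?w * (1 - ?x) powr (- \<theta>)" by (intro mult_left_mono) auto
    also have "\<dots> = 1" using x unfolding powr_add[symmetric] by simp
    finally have le1: "?w * (\<Sum>j<J. gbinom_wt \<theta> j * ?x ^ j) \<le> 1" .
    have "(\<integral>\<omega>. (?w * (\<Sum>j<J. (cmod (c j \<omega>))\<^sup>2 * ?x ^ j))\<^sup>2 \<partial>P) = ?w\<^sup>2 * (\<integral>\<omega>. (\<Sum>j<J. (cmod (c j \<omega>))\<^sup>2 * ?x ^ j)\<^sup>2 \<partial>P)"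
      unfolding power_mult_distrib by simp
    also have "\<dots> \<le> ?w\<^sup>2 * (sq_const * (\<Sum>j<J. gbinom_wt \<theta> j * ?x ^ j)\<^sup>2)"
      unfolding sq_const_def using x by (intro mult_left_mono energy_L2) auto
    also have "\<dots> = sq_const * (?w * (\<Sum>j<J. gbinom_wt \<theta> j * ?x ^ j))\<^sup>2" by (simp add: power_mult_distrib)
    also have "\<dots> \<le> sq_const * 1"
      using le1 x g0 K0 by (intro mult_left_mono power_le_one mult_nonneg_nonneg sum_nonneg) auto
    finally show ?thesis using int by (subst nn_integral_eq_integral) (auto intro: ennreal_leI)
  qed
  \<comment> \<open>Fatou: almost surely the truncated sums converge to the energy, and their second
    moments have a common bound.\<close>
  have "(\<integral>\<^sup>+\<omega>. ennreal ((?w * energy ?x \<omega>)\<^sup>2) \<partial>P) \<le>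
     (\<integral>\<^sup>+\<omega>. liminf (\<lambda>J. ennreal ((?w * (\<Sum>j<J. (cmod (c j \<omega>))\<^sup>2 * ?x ^ j))\<^sup>2)) \<partial>P)"
  proof (rule nn_integral_mono_AE)
    show "AE \<omega> in P. ennreal ((?w * energy ?x \<omega>)\<^sup>2) \<le> liminf (\<lambda>J. ennreal ((?w * (\<Sum>j<J. (cmod (c j \<omega>))\<^sup>2 * ?x ^ j))\<^sup>2))"
      using AE_conv_radius
    proof eventually_elim
      case (elim \<omega>)
      have "(\<lambda>J. ennreal ((?w * (\<Sum>j<J. (cmod (c j \<omega>))\<^sup>2 * ?x ^ j))\<^sup>2)) \<longlonglongrightarrow> ennreal ((?w * energy ?x \<omega>)\<^sup>2)"
        unfolding energy_def by (intro tendsto_ennrealI tendsto_intros summable_LIMSEQ energy_sums(1)[OF elim r])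
      from lim_imp_Liminf[OF trivial_limit_sequentially this] show ?case by (simp only: order_refl)
    qed
  qed
  also have "\<dots> \<le> liminf (\<lambda>J. \<integral>\<^sup>+\<omega>. ennreal ((?w * (\<Sum>j<J. (cmod (c j \<omega>))\<^sup>2 * ?x ^ j))\<^sup>2) \<partial>P)"
    by (rule nn_integral_liminf) measurable
  also have "\<dots> \<le> liminf (\<lambda>J. ennreal sq_const)"
    by (intro Liminf_mono always_eventually allI fin)
  also have "\<dots> = ennreal sq_const" by (simp add: Liminf_const)
  finally have nn: "(\<integral>\<^sup>+\<omega>. ennreal ((?w * energy ?x \<omega>)\<^sup>2) \<partial>P) \<le> ennreal sq_const" .
  then have "(\<integral>\<^sup>+\<omega>. ennreal ((?w * energy ?x \<omega>)\<^sup>2) \<partial>P) < \<infinity>" by (rule order.strict_trans1) simp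
  then show int: "integrable P (\<lambda>\<omega>. (?w * energy ?x \<omega>)\<^sup>2)" by (simp add: integrable_iff_bounded)
  show "(\<integral>\<omega>. (?w * energy ?x \<omega>)\<^sup>2 \<partial>P) \<le> sq_const"
    using nn K0 by (subst (asm) nn_integral_eq_integral[OF int]) auto
qed

lemma GMC_mass_L1:
  assumes gmc: "is_GMC P N \<theta> GMC" and r: "\<And>n. 0 \<le> r n" "\<And>n. r n < 1" "r \<longlonglongrightarrow> 1"
  shows "integrable P (GMC_mass GMC)"
    and "(\<lambda>n. \<integral>\<omega>. \<bar>(1 - (r n)\<^sup>2) powr \<theta> * energy ((r n)\<^sup>2) \<omega> - GMC_mass GMC \<omega>\<bar> \<partial>P) \<longlonglongrightarrow> 0"
proof -
  note conv = GMC_mass_conv(1)[OF assms] and meas = GMC_mass_conv(2)[OF assms zero_less_one]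
  note L1 = L1_convergence_of_L2_bounded[OF _ meas energy_sq_bound(1)[OF r(1,2)] energy_sq_bound(2)[OF r(1,2)] conv]
  show "integrable P (GMC_mass GMC)"
    by (rule L1(1)) measurable
  show "(\<lambda>n. \<integral>\<omega>. \<bar>(1 - (r n)\<^sup>2) powr \<theta> * energy ((r n)\<^sup>2) \<omega> - GMC_mass GMC \<omega>\<bar> \<partial>P) \<longlonglongrightarrow> 0"
    by (rule L1(2)) measurable
qed

section \<open>A Tauberian argument\<close>

definition wsum :: "(nat \<Rightarrow> real) \<Rightarrow> 'a \<Rightarrow> real" where
  "wsum w \<omega> = (\<Sum>j. (cmod (c j \<omega>))\<^sup>2 * w j)"

lemma wsum_measurable [measurable]: "wsum w \<in> borel_measurable P"
  unfolding wsum_def[abs_def] by measurable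

lemma wsum_summable:
  assumes good: "fps_conv_radius (field_fps \<omega>) \<ge> 1"
    and w: "\<And>j. \<bar>w j\<bar> \<le> C * x ^ j" and x: "0 \<le> x" "x < 1"
  shows "summable (\<lambda>j. (cmod (c j \<omega>))\<^sup>2 * \<bar>w j\<bar>)" "summable (\<lambda>j. (cmod (c j \<omega>))\<^sup>2 * w j)"
proof -
  have "summable (\<lambda>j. C * ((cmod (c j \<omega>))\<^sup>2 * x ^ j))"
    using energy_sums(1)[OF good, of "sqrt x"] x by (intro summable_mult) (simp add: real_sqrt_lt_1_iff)
  then have s: "summable (\<lambda>j. (cmod (c j \<omega>))\<^sup>2 * (C * x ^ j))" by (simp add: mult_ac)
  show "summable (\<lambda>j. (cmod (c j \<omega>))\<^sup>2 * \<bar>w j\<bar>)"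
    by (rule summable_comparison_test'[OF s]) (use w in \<open>simp add: abs_mult mult_left_mono\<close>)
  then show "summable (\<lambda>j. (cmod (c j \<omega>))\<^sup>2 * w j)"
    by (intro summable_rabs_cancel[of "\<lambda>j. (cmod (c j \<omega>))\<^sup>2 * w j"]) (simp add: abs_mult)
qed

lemma gbinom_wt_weight_summable:
  assumes w: "\<And>j. \<bar>w j\<bar> \<le> C * x ^ j" and x: "0 \<le> x" "x < 1"
  shows "summable (\<lambda>j. gbinom_wt \<theta> j * \<bar>w j\<bar>)"
proof (rule summable_comparison_test')
  have "summable (\<lambda>j. C * (gbinom_wt \<theta> j * x ^ j))"
    using gbinom_wt_sums[of x \<theta>] x by (intro summable_mult) (auto simp: sums_iff)
  then show "summable (\<lambda>j. gbinom_wt \<theta> j * (C * x ^ j))" by (simp add: mult_ac)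
  show "norm (gbinom_wt \<theta> j * \<bar>w j\<bar>) \<le> gbinom_wt \<theta> j * (C * x ^ j)" for j
    using w[of j] gbinom_wt_pos[OF theta_pos, of j] by (simp add: abs_mult mult_left_mono)
qed

text \<open>Since E|c_j|^2 is the weight \<open>gbinom_wt\<close> \<theta> j, comparing two weighted
  sums of |c_j|^2 in L^1 reduces to a deterministic series. This carries Karamata's deterministic
  argument over to random sequences.\<close>

lemma wsum_L1:
  assumes w: "\<And>j. \<bar>w j\<bar> \<le> C * x ^ j" and x: "0 \<le> x" "x < 1"
  shows "integrable P (wsum w)" "(\<integral>\<omega>. \<bar>wsum w \<omega>\<bar> \<partial>P) \<le> (\<Sum>j. gbinom_wt \<theta> j * \<bar>w j\<bar>)"
proof -
  let ?B = "\<Sum>j. gbinom_wt \<theta> j * \<bar>w j\<bar>"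
  have pos: "gbinom_wt \<theta> j * \<bar>w j\<bar> \<ge> 0" for j using gbinom_wt_pos[OF theta_pos, of j] by simp
  note summ = gbinom_wt_weight_summable[OF assms]
  have "(\<integral>\<^sup>+\<omega>. ennreal \<bar>wsum w \<omega>\<bar> \<partial>P) \<le> (\<integral>\<^sup>+\<omega>. (\<Sum>j. ennreal ((cmod (c j \<omega>))\<^sup>2 * \<bar>w j\<bar>)) \<partial>P)"
  proof (rule nn_integral_mono_AE)
    show "AE \<omega> in P. ennreal \<bar>wsum w \<omega>\<bar> \<le> (\<Sum>j. ennreal ((cmod (c j \<omega>))\<^sup>2 * \<bar>w j\<bar>))"
      using AE_conv_radius
    proof eventually_elim
      case (elim \<omega>)
      note s = wsum_summable[OF elim assms]
      have "\<bar>wsum w \<omega>\<bar> \<le> (\<Sum>j. \<bar>(cmod (c j \<omega>))\<^sup>2 * w j\<bar>)"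
        unfolding wsum_def using s(1) by (intro summable_rabs) (simp add: abs_mult)
      also have "\<dots> = (\<Sum>j. (cmod (c j \<omega>))\<^sup>2 * \<bar>w j\<bar>)" by (simp add: abs_mult)
      finally show ?case
        using s(1) by (subst suminf_ennreal2) (auto intro: ennreal_leI)
    qed
  qed
  also have "\<dots> = (\<Sum>j. \<integral>\<^sup>+\<omega>. ennreal ((cmod (c j \<omega>))\<^sup>2 * \<bar>w j\<bar>) \<partial>P)"
    by (rule nn_integral_suminf) measurable
  also have "\<dots> = (\<Sum>j. ennreal (gbinom_wt \<theta> j * \<bar>w j\<bar>))"
    by (subst nn_integral_eq_integral) (auto simp: integrable_c_sq second_moment)
  also have "\<dots> = ennreal ?B"
    using pos summ by (intro suminf_ennreal2) auto
  finally have nn: "(\<integral>\<^sup>+\<omega>. ennreal \<bar>wsum w \<omega>\<bar> \<partial>P) \<le> ennreal ?B" .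
  then have "(\<integral>\<^sup>+\<omega>. ennreal (norm (wsum w \<omega>)) \<partial>P) < \<infinity>" unfolding real_norm_def by (rule order.strict_trans1) simp
  then show int: "integrable P (wsum w)" by (intro integrableI_bounded) auto
  have "?B \<ge> 0" using pos summ by (intro suminf_nonneg) auto
  then show "(\<integral>\<omega>. \<bar>wsum w \<omega>\<bar> \<partial>P) \<le> ?B"
    using nn int by (subst (asm) nn_integral_eq_integral) auto
qed

lemma mass_Suc_wsum:
  "s * (\<Sum>j<m. (cmod (c j \<omega>))\<^sup>2) = wsum (\<lambda>j. if j < m then s else 0) \<omega>"
proof -
  have "wsum (\<lambda>j. if j < m then s else 0) \<omega> = (\<Sum>j<m. (cmod (c j \<omega>))\<^sup>2 * (if j < m then s else 0))"
    unfolding wsum_def by (rule suminf_finite) auto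
  then show ?thesis by (simp add: sum_distrib_left mult.commute)
qed

lemma exp_ratio_less_1: "exp (- real (Suc i) / real (Suc n)) < 1"
  by (simp add: divide_less_0_iff del: of_nat_Suc)

text \<open>With x = exp(-(i+1)/(n+1)), this converts the Abel normalisation (1 - x)^\<theta> into
  the normalisation (n+1)^(-\<theta>) of partial sums, see \<open>kappa_eq\<close>.\<close>

definition kappa :: "nat \<Rightarrow> nat \<Rightarrow> real" where
  "kappa i n = (real (Suc n) * (1 - exp (- real (Suc i) / real (Suc n)))) powr (- \<theta>)"

lemma kappa_limit: "kappa i \<longlonglongrightarrow> real (Suc i) powr (- \<theta>)"
proof -
  have "((\<lambda>n. real (Suc n) * (1 - exp (- real (Suc i) / real (Suc n)))) \<longlongrightarrow> real (Suc i)) at_top"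
    by real_asymp
  then show ?thesis unfolding kappa_def by (intro tendsto_powr tendsto_const) auto
qed

lemma kappa_eq:
  "real (Suc n) powr (- \<theta>) = kappa i n * (1 - exp (- real (Suc i) / real (Suc n))) powr \<theta>"
proof -
  have "1 - exp (- real (Suc i) / real (Suc n)) > 0" using exp_ratio_less_1[of i n] by simp
  then have "kappa i n * (1 - exp (- real (Suc i) / real (Suc n))) powr \<theta> =
    real (Suc n) powr (- \<theta>) * ((1 - exp (- real (Suc i) / real (Suc n))) powr (- \<theta>) * (1 - exp (- real (Suc i) / real (Suc n))) powr \<theta>)"
    unfolding kappa_def by (subst powr_mult) (auto simp: mult_ac)
  also have "\<dots> = real (Suc n) powr (- \<theta>)"
    unfolding powr_add[symmetric] by (simp add: less_imp_neq[THEN not_sym])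
  finally show ?thesis ..
qed

lemma energy_kappa_L1:
  assumes gmc: "is_GMC P N \<theta> GMC"
  shows "(\<lambda>n. \<integral>\<omega>. \<bar>real (Suc n) powr (- \<theta>) * energy (exp (- real (Suc i) / real (Suc n))) \<omega> - kappa i n * GMC_mass GMC \<omega>\<bar> \<partial>P) \<longlonglongrightarrow> 0"
proof -
  \<comment> \<open>Half the exponent, because the energy is evaluated at r^2.\<close>
  define r where "r n = exp (- real (Suc i) / (2 * real (Suc n)))" for n
  have r2: "(r n)\<^sup>2 = exp (- real (Suc i) / real (Suc n))" for n
    unfolding r_def by (simp add: exp_double[symmetric] field_simps)
  have "r \<longlonglongrightarrow> 1" unfolding r_def by real_asymp
  moreover have "0 \<le> r n" "r n < 1" for n by (auto simp: r_def divide_less_0_iff)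
  ultimately have lim: "(\<lambda>n. \<integral>\<omega>. \<bar>(1 - (r n)\<^sup>2) powr \<theta> * energy ((r n)\<^sup>2) \<omega> - GMC_mass GMC \<omega>\<bar> \<partial>P) \<longlonglongrightarrow> 0"
    by (intro GMC_mass_L1(2)[OF gmc])
  have "(\<lambda>n. \<bar>kappa i n\<bar> * (\<integral>\<omega>. \<bar>(1 - (r n)\<^sup>2) powr \<theta> * energy ((r n)\<^sup>2) \<omega> - GMC_mass GMC \<omega>\<bar> \<partial>P)) \<longlonglongrightarrow> \<bar>real (Suc i) powr (- \<theta>)\<bar> * 0"
    by (intro tendsto_mult lim tendsto_rabs kappa_limit)
  moreover have "\<bar>kappa i n\<bar> * (\<integral>\<omega>. \<bar>(1 - (r n)\<^sup>2) powr \<theta> * energy ((r n)\<^sup>2) \<omega> - GMC_mass GMC \<omega>\<bar> \<partial>P) =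
     (\<integral>\<omega>. \<bar>real (Suc n) powr (- \<theta>) * energy (exp (- real (Suc i) / real (Suc n))) \<omega> - kappa i n * GMC_mass GMC \<omega>\<bar> \<partial>P)" for n
    unfolding r2 integral_mult_right_zero[symmetric] abs_mult[symmetric] kappa_eq[of n i]
    by (simp only: right_diff_distrib mult.assoc)
  ultimately show ?thesis by simp
qed

text \<open>Karamata's device: the indicator of \<open>j < n + 1\<close> is approximated by a polynomial without constant term
  in \<open>exp (- 1 / (n + 1)) ^ j\<close>, up to a window of \<open>O(\<eta> n)\<close> indices.\<close>

lemma Karamata_weight:
  assumes \<eta>: "\<eta> > 0"
  obtains a :: "nat \<Rightarrow> real" and K :: nat where
    "\<And>n j. \<bar>(\<Sum>i\<le>K. a i * exp (- real (Suc i) / real (Suc n)) ^ j) - (if j < Suc n then 1 else 0)\<bar> \<le>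
       (if Suc n \<le> j \<and> real j < (1 + \<eta>) * real (Suc n) then 1 else 0) + \<eta> * exp (- 1 / real (Suc n)) ^ j"
proof -
  define lo where "lo = exp (- (1 + \<eta>))"
  define hi where "hi = exp (- 1 :: real)"
  have lohi: "0 < lo" "lo < hi" using \<eta> by (auto simp: lo_def hi_def)
  \<comment> \<open>A continuous ramp in y = exp(-j/(n+1)): it is 1 for j <= n + 1 and 0 for j >= (1
    + \<eta>)(n + 1), so it differs from the indicator only on the window.\<close>
  define \<phi> where "\<phi> y = max 0 (min 1 ((y - lo) / (hi - lo)))" for y
  have \<phi>: "\<phi> y = 0" if "y \<le> lo" for y
  proof -
    have "(y - lo) / (hi - lo) \<le> 0" using that lohi by (simp add: divide_le_0_iff)
    then show ?thesis by (simp add: \<phi>_def)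
  qed
  have \<phi>1: "\<phi> y = 1" if "y \<ge> hi" for y using that lohi by (auto simp: \<phi>_def max_def min_def field_simps)
  have \<phi>01: "0 \<le> \<phi> y" "\<phi> y \<le> 1" for y by (auto simp: \<phi>_def)
  \<comment> \<open>The ramp divided by y is approximated and multiplied by y afterwards, which
    removes the constant term. Replacing y by max y lo in the denominator changes nothing, as the
    ramp vanishes below lo, and avoids the singularity at 0.\<close>
  have "continuous_on {0..1} (\<lambda>y. \<phi> y / max y lo)"
    unfolding \<phi>_def using lohi by (intro continuous_intros) (auto simp: max_def)
  then obtain g where g: "real_polynomial_function g" "\<And>y. y \<in> {0..1} \<Longrightarrow> \<bar>\<phi> y / max y lo - g y\<bar> < \<eta>"
    using Stone_Weierstrass_real_polynomial_function[of "{0..1}" "\<lambda>y. \<phi> y / max y lo" \<eta>] \<eta> by auto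
  from g(1) obtain a K where gK: "g = (\<lambda>y. \<Sum>i\<le>K. a i * y ^ i)"
    by (auto simp: real_polynomial_function_iff_sum)
  show ?thesis
  proof (rule that[of a K])
    fix n j :: nat
    define y where "y = exp (- 1 / real (Suc n)) ^ j"
    have y_exp: "y = exp (- (real j / real (Suc n)))"
      unfolding y_def exp_of_nat_mult[symmetric] by simp
    have y01: "0 < y" "y \<le> 1" by (auto simp: y_exp)
    have pow: "exp (- real (Suc i) / real (Suc n)) ^ j = y * y ^ i" for i
    proof -
      have "exp (- real (Suc i) / real (Suc n)) = exp (- 1 / real (Suc n)) ^ Suc i"
        unfolding exp_of_nat_mult[symmetric] by (simp del: of_nat_Suc)
      then have "exp (- real (Suc i) / real (Suc n)) ^ j = y ^ Suc i"
        unfolding y_def by (simp only: power_mult[symmetric] mult.commute)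
      then show ?thesis by simp
    qed
    have sum: "(\<Sum>i\<le>K. a i * exp (- real (Suc i) / real (Suc n)) ^ j) = y * g y"
      unfolding pow gK by (simp add: sum_distrib_left mult_ac)
    have lo_iff: "y \<le> lo \<longleftrightarrow> (1 + \<eta>) * real (Suc n) \<le> real j"
      unfolding y_exp lo_def by (simp add: field_simps)
    have hi_iff: "hi < y \<longleftrightarrow> j < Suc n"
      unfolding y_exp hi_def by (simp add: field_simps del: of_nat_Suc)
    have "\<bar>y * g y - y * (\<phi> y / max y lo)\<bar> = y * \<bar>\<phi> y / max y lo - g y\<bar>"
      unfolding right_diff_distrib[symmetric] abs_mult using y01 by (simp add: abs_minus_commute)
    also have "\<dots> \<le> y * \<eta>" using g(2)[of y] y01 by (intro mult_left_mono) auto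
    finally have 1: "\<bar>y * g y - y * (\<phi> y / max y lo)\<bar> \<le> \<eta> * y" by (simp add: mult.commute)
    have "y * (\<phi> y / max y lo) = \<phi> y"
      using \<phi>[of y] y01 by (cases "y \<le> lo") (auto simp: max_def)
    then have 2: "\<bar>y * (\<phi> y / max y lo) - (if j < Suc n then 1 else 0)\<bar> \<le>
        (if Suc n \<le> j \<and> real j < (1 + \<eta>) * real (Suc n) then 1 else 0)"
      using \<phi>[of y] \<phi>1[of y] \<phi>01[of y] lo_iff hi_iff by (auto simp: not_le not_less)
    show "\<bar>(\<Sum>i\<le>K. a i * exp (- real (Suc i) / real (Suc n)) ^ j) - (if j < Suc n then 1 else 0)\<bar> \<le>
       (if Suc n \<le> j \<and> real j < (1 + \<eta>) * real (Suc n) then 1 else 0) + \<eta> * exp (- 1 / real (Suc n)) ^ j"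
      unfolding sum y_def[symmetric] using abs_triangle_ineq[of "y * g y - y * (\<phi> y / max y lo)"
          "y * (\<phi> y / max y lo) - (if j < Suc n then 1 else 0)"] add_mono[OF 2 1] by simp
  qed
qed

text \<open>The window contains at most \<eta>(n+1) + 1 indices, and each contributes at most
  (n+1)^(\<theta>-1) (n+1)^(-\<theta>) = 1/(n+1).\<close>

lemma gbinom_wt_window:
  assumes \<eta>: "\<eta> > 0"
  shows "(\<Sum>j. gbinom_wt \<theta> j * (real (Suc n) powr (- \<theta>) * (if Suc n \<le> j \<and> real j < (1 + \<eta>) * real (Suc n) then 1 else 0)))
     \<le> \<eta> + 1 / real (Suc n)"
    and "summable (\<lambda>j. gbinom_wt \<theta> j * (real (Suc n) powr (- \<theta>) * (if Suc n \<le> j \<and> real j < (1 + \<eta>) * real (Suc n) then 1 else 0)))"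
proof -
  let ?m = "real (Suc n)"
  let ?J = "{j. Suc n \<le> j \<and> real j < (1 + \<eta>) * ?m}"
  let ?f = "\<lambda>j. gbinom_wt \<theta> j * (?m powr (- \<theta>) * (if Suc n \<le> j \<and> real j < (1 + \<eta>) * ?m then 1 else 0))"
  have sub: "?J \<subseteq> {Suc n..<Suc n + nat \<lceil>\<eta> * ?m\<rceil>}"
  proof
    fix j assume "j \<in> ?J"
    then have "real j < ?m + \<eta> * ?m" "Suc n \<le> j" by (auto simp: algebra_simps)
    moreover have "\<eta> * ?m \<le> real (nat \<lceil>\<eta> * ?m\<rceil>)" by (rule of_nat_ceiling)
    ultimately have "real j < real (Suc n + nat \<lceil>\<eta> * ?m\<rceil>)" unfolding of_nat_add by linarith
    then show "j \<in> {Suc n..<Suc n + nat \<lceil>\<eta> * ?m\<rceil>}" using \<open>Suc n \<le> j\<close> by (simp only: of_nat_less_iff atLeastLessThan_iff)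
  qed
  then have fin: "finite ?J" by (rule finite_subset) simp
  have "card ?J \<le> nat \<lceil>\<eta> * ?m\<rceil>" using card_mono[OF _ sub] by simp
  then have "real (card ?J) \<le> real (nat \<lceil>\<eta> * ?m\<rceil>)" by simp
  also have "\<dots> \<le> \<eta> * ?m + 1" using \<eta> by (simp add: of_nat_nat)
  finally have card: "real (card ?J) \<le> \<eta> * ?m + 1" .
  show "summable ?f" by (rule summable_finite[OF fin]) auto
  have "(\<Sum>j. ?f j) = (\<Sum>j\<in>?J. ?f j)" by (rule suminf_finite[OF fin]) auto
  also have "\<dots> \<le> (\<Sum>j\<in>?J. ?m powr (\<theta> - 1) * ?m powr (- \<theta>))"
  proof (rule sum_mono)
    fix j assume j: "j \<in> ?J"
    have "gbinom_wt \<theta> j \<le> real (Suc j) powr (\<theta> - 1)" by (rule gbinom_wt_le[OF theta_pos theta_lt_1])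
    also have "\<dots> \<le> ?m powr (\<theta> - 1)" using j theta_lt_1 by (intro powr_mono2') auto
    finally show "?f j \<le> ?m powr (\<theta> - 1) * ?m powr (- \<theta>)" using j by (auto intro: mult_right_mono)
  qed
  also have "\<dots> = real (card ?J) * (1 / ?m)"
    unfolding powr_add[symmetric] by (simp add: powr_minus_divide)
  also have "\<dots> \<le> (\<eta> * ?m + 1) * (1 / ?m)" using card by (intro mult_right_mono) auto
  also have "\<dots> = \<eta> + 1 / ?m" by (simp add: field_simps)
  finally show "(\<Sum>j. ?f j) \<le> \<eta> + 1 / ?m" .
qed

text \<open>The polynomial weight replaces the indicator of j < n + 1 twice: in the sum of |c_j|^2
  and, as \<open>det\<close>, in its mean. Each replacement costs at most \<open>?B\<close>, the
  window plus \<eta> times the normalised mean Abel sum \<open>kappa 0 n\<close>. What is left is a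
  finite combination of Abel sums compared with \<open>kappa\<close> times the total mass, collected
  in \<open>T\<close>.\<close>

lemma mass_Suc_bound:
  assumes gmc: "is_GMC P N \<theta> GMC" and \<eta>: "\<eta> > 0"
  obtains T where "T \<longlonglongrightarrow> 0"
    "\<And>n. (\<integral>\<omega>. \<bar>mass (Suc n) \<omega> - GMC_mass GMC \<omega>\<bar> \<partial>P) \<le>
      (\<eta> + 1 / real (Suc n) + \<eta> * kappa 0 n) * (1 + (\<integral>\<omega>. \<bar>GMC_mass GMC \<omega>\<bar> \<partial>P)) + T n"
proof -
  obtain a K where aK: "\<And>n j. \<bar>(\<Sum>i\<le>K. a i * exp (- real (Suc i) / real (Suc n)) ^ j) - (if j < Suc n then 1 else 0)\<bar> \<le>
       (if Suc n \<le> j \<and> real j < (1 + \<eta>) * real (Suc n) then 1 else 0) + \<eta> * exp (- 1 / real (Suc n)) ^ j"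
    using Karamata_weight[OF \<eta>] by blast
  let ?M = "GMC_mass GMC"
  let ?e = "\<lambda>i n \<omega>. real (Suc n) powr (- \<theta>) * energy (exp (- real (Suc i) / real (Suc n))) \<omega>"
  define T where "T n = (\<Sum>i\<le>K. \<bar>a i\<bar> * (\<integral>\<omega>. \<bar>?e i n \<omega> - kappa i n * ?M \<omega>\<bar> \<partial>P))" for n
  have "T \<longlonglongrightarrow> (\<Sum>i\<le>K. \<bar>a i\<bar> * 0)"
    unfolding T_def by (intro tendsto_sum tendsto_mult tendsto_const energy_kappa_L1[OF gmc])
  then have T: "T \<longlonglongrightarrow> 0" by simp
  have intM: "integrable P ?M"
    by (rule GMC_mass_L1(1)[OF gmc, of "\<lambda>n. 1 - 1 / real (Suc n)"]) (simp, simp, real_asymp)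
  show ?thesis
  proof (rule that[OF T])
    fix n
    let ?m = "real (Suc n)" and ?s = "real (Suc n) powr (- \<theta>)"
    let ?x = "\<lambda>i. exp (- real (Suc i) / real (Suc n))"
    let ?w0 = "\<lambda>j. if j < Suc n then ?s else 0"
    let ?wp = "\<lambda>j. ?s * (\<Sum>i\<le>K. a i * ?x i ^ j)"
    let ?B = "\<eta> + 1 / ?m + \<eta> * kappa 0 n"
    have x: "0 < ?x i" "?x i < 1" for i using exp_ratio_less_1[of i n] by auto
    have x0: "?x i \<le> ?x 0" for i
      unfolding exp_le_cancel_iff by (intro divide_right_mono) auto
    have s0: "?s > 0" by simp
    have g0: "gbinom_wt \<theta> j \<ge> 0" for j using gbinom_wt_pos[OF theta_pos, of j] by simp
    have wp_bd: "\<bar>?wp j\<bar> \<le> (?s * (\<Sum>i\<le>K. \<bar>a i\<bar>)) * ?x 0 ^ j" for j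
    proof -
      have "\<bar>\<Sum>i\<le>K. a i * ?x i ^ j\<bar> \<le> (\<Sum>i\<le>K. \<bar>a i\<bar> * ?x 0 ^ j)"
        by (rule order_trans[OF sum_abs], rule sum_mono) (use x0 in \<open>auto simp: abs_mult intro!: mult_left_mono power_mono\<close>)
      then show ?thesis using s0 by (simp add: abs_mult sum_distrib_right mult.assoc mult_left_mono)
    qed
    \<comment> \<open>For j <= n the power is at least exp(-1), so the cut-off weight is
      geometrically dominated, as the summability lemmas require.\<close>
    have w0_bd: "\<bar>?w0 j\<bar> \<le> (?s * exp 1) * ?x 0 ^ j" for j
    proof (cases "j < Suc n")
      case True
      have "?x 0 ^ j = exp (- (real j / ?m))" unfolding exp_of_nat_mult[symmetric] by (simp add: one_add_one)
      also have "\<dots> \<ge> exp (- 1)" using True by simp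
      finally have "1 \<le> exp 1 * ?x 0 ^ j" by (simp add: exp_minus field_simps)
      then have "?s * 1 \<le> ?s * (exp 1 * ?x 0 ^ j)" using s0 by (intro mult_left_mono) auto
      then show ?thesis using True s0 by (simp add: mult.assoc)
    qed auto
    define C where "C = ?s * exp 1 + ?s * (\<Sum>i\<le>K. \<bar>a i\<bar>)"
    have wd_bd: "\<bar>?wp j - ?w0 j\<bar> \<le> C * ?x 0 ^ j" for j
      using abs_triangle_ineq4[of "?wp j" "?w0 j"] wp_bd[of j] w0_bd[of j] unfolding C_def distrib_right by linarith
    have B: "(\<Sum>j. gbinom_wt \<theta> j * \<bar>?wp j - ?w0 j\<bar>) \<le> ?B"
    proof -
      let ?v = "\<lambda>j. gbinom_wt \<theta> j * (?s * (if Suc n \<le> j \<and> real j < (1 + \<eta>) * ?m then 1 else 0))"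
      let ?u = "\<lambda>j. (\<eta> * ?s) * (gbinom_wt \<theta> j * ?x 0 ^ j)"
      have us: "(\<lambda>j. gbinom_wt \<theta> j * ?x 0 ^ j) sums (1 - ?x 0) powr (- \<theta>)"
        using x[of 0] by (intro gbinom_wt_sums) auto
      have su: "summable ?u" using us by (intro summable_mult) (simp add: sums_iff)
      have "(\<Sum>j. gbinom_wt \<theta> j * \<bar>?wp j - ?w0 j\<bar>) \<le> (\<Sum>j. ?v j + ?u j)"
      proof (rule suminf_le)
        fix j
        have "?wp j - ?w0 j = ?s * ((\<Sum>i\<le>K. a i * ?x i ^ j) - (if j < Suc n then 1 else 0))"
          by (simp add: right_diff_distrib)
        then have "\<bar>?wp j - ?w0 j\<bar> = ?s * \<bar>(\<Sum>i\<le>K. a i * ?x i ^ j) - (if j < Suc n then 1 else 0)\<bar>"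
          using s0 by (simp add: abs_mult)
        also have "\<dots> \<le> ?s * ((if Suc n \<le> j \<and> real j < (1 + \<eta>) * ?m then 1 else 0) + \<eta> * ?x 0 ^ j)"
          using aK[of n j] s0 by (intro mult_left_mono) (auto simp: one_add_one)
        finally have "gbinom_wt \<theta> j * \<bar>?wp j - ?w0 j\<bar> \<le>
            gbinom_wt \<theta> j * (?s * ((if Suc n \<le> j \<and> real j < (1 + \<eta>) * ?m then 1 else 0) + \<eta> * ?x 0 ^ j))"
          using g0 by (intro mult_left_mono)
        also have "\<dots> = ?v j + ?u j" by (simp only: distrib_left mult_ac)
        finally show "gbinom_wt \<theta> j * \<bar>?wp j - ?w0 j\<bar> \<le> ?v j + ?u j" .
      next
        show "summable (\<lambda>j. gbinom_wt \<theta> j * \<bar>?wp j - ?w0 j\<bar>)"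
          by (rule gbinom_wt_weight_summable[OF wd_bd]) (use x[of 0] in auto)
        show "summable (\<lambda>j. ?v j + ?u j)" by (intro summable_add gbinom_wt_window(2)[OF \<eta>] su)
      qed
      also have "\<dots> = (\<Sum>j. ?v j) + (\<Sum>j. ?u j)" by (intro suminf_add[symmetric] gbinom_wt_window(2)[OF \<eta>] su)
      also have "(\<Sum>j. ?u j) = \<eta> * (?s * (1 - ?x 0) powr (- \<theta>))"
        using us by (subst suminf_mult) (auto simp: sums_iff)
      also have "?s * (1 - ?x 0) powr (- \<theta>) = kappa 0 n"
      proof -
        have "?s * (1 - ?x 0) powr (- \<theta>) = kappa 0 n * ((1 - ?x 0) powr \<theta> * (1 - ?x 0) powr (- \<theta>))"
          unfolding kappa_eq[of n 0] by (simp only: mult.assoc)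
        also have "(1 - ?x 0) powr \<theta> * (1 - ?x 0) powr (- \<theta>) = 1"
          unfolding powr_add[symmetric] using x[of 0] by simp
        finally show ?thesis by simp
      qed
      finally show ?thesis using gbinom_wt_window(1)[OF \<eta>, of n] by linarith
    qed
    have AE: "AE \<omega> in P. (\<Sum>i\<le>K. a i * ?e i n \<omega>) - ?s * (\<Sum>j<Suc n. (cmod (c j \<omega>))\<^sup>2) = wsum (\<lambda>j. ?wp j - ?w0 j) \<omega>"
      using AE_conv_radius
    proof eventually_elim
      case (elim \<omega>)
      have e: "summable (\<lambda>j. (cmod (c j \<omega>))\<^sup>2 * ?x i ^ j)" for i
        by (rule wsum_summable(2)[OF elim, of _ 1 "?x i"]) (use x[of i] in auto)
      have "(\<Sum>i\<le>K. a i * ?e i n \<omega>) = (\<Sum>i\<le>K. \<Sum>j. a i * (?s * ((cmod (c j \<omega>))\<^sup>2 * ?x i ^ j)))"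
        unfolding energy_def using e by (intro sum.cong refl) (simp add: suminf_mult summable_mult)
      also have "\<dots> = (\<Sum>j. \<Sum>i\<le>K. a i * (?s * ((cmod (c j \<omega>))\<^sup>2 * ?x i ^ j)))"
        using e by (intro suminf_sum[symmetric] summable_mult)
      also have "\<dots> = wsum ?wp \<omega>"
        unfolding wsum_def by (intro suminf_cong) (simp add: sum_distrib_left mult_ac)
      finally have 1: "(\<Sum>i\<le>K. a i * ?e i n \<omega>) = wsum ?wp \<omega>" .
      have "wsum ?wp \<omega> - wsum ?w0 \<omega> = wsum (\<lambda>j. ?wp j - ?w0 j) \<omega>"
        unfolding wsum_def right_diff_distrib
        using wsum_summable(2)[OF elim wp_bd] wsum_summable(2)[OF elim w0_bd] x[of 0]
        by (intro suminf_diff) auto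
      then show ?case unfolding 1 mass_Suc_wsum .
    qed
    have L1a: "integrable P (\<lambda>\<omega>. (\<Sum>i\<le>K. a i * ?e i n \<omega>) - ?s * (\<Sum>j<Suc n. (cmod (c j \<omega>))\<^sup>2))"
      "(\<integral>\<omega>. \<bar>(\<Sum>i\<le>K. a i * ?e i n \<omega>) - ?s * (\<Sum>j<Suc n. (cmod (c j \<omega>))\<^sup>2)\<bar> \<partial>P) \<le> ?B"
    proof -
      have *: "integrable P (wsum (\<lambda>j. ?wp j - ?w0 j))"
        by (rule wsum_L1(1)[OF wd_bd]) (use x[of 0] in auto)
      show "integrable P (\<lambda>\<omega>. (\<Sum>i\<le>K. a i * ?e i n \<omega>) - ?s * (\<Sum>j<Suc n. (cmod (c j \<omega>))\<^sup>2))"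
        by (rule integrable_cong_AE_imp[OF *]) (use AE in \<open>auto elim: eventually_mono\<close>)
      have "(\<integral>\<omega>. \<bar>(\<Sum>i\<le>K. a i * ?e i n \<omega>) - ?s * (\<Sum>j<Suc n. (cmod (c j \<omega>))\<^sup>2)\<bar> \<partial>P) =
        (\<integral>\<omega>. \<bar>wsum (\<lambda>j. ?wp j - ?w0 j) \<omega>\<bar> \<partial>P)"
        by (rule integral_cong_AE) (use AE in \<open>auto elim: eventually_mono\<close>)
      also have "\<dots> \<le> (\<Sum>j. gbinom_wt \<theta> j * \<bar>?wp j - ?w0 j\<bar>)"
        by (rule wsum_L1(2)[OF wd_bd]) (use x[of 0] in auto)
      also have "\<dots> \<le> ?B" by (rule B)
      finally show "(\<integral>\<omega>. \<bar>(\<Sum>i\<le>K. a i * ?e i n \<omega>) - ?s * (\<Sum>j<Suc n. (cmod (c j \<omega>))\<^sup>2)\<bar> \<partial>P) \<le> ?B" .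
    qed
    \<comment> \<open>The same comparison with |c_j|^2 replaced by its mean. It ties
      \<open>total\<close> to the \<open>kappa\<close> terms without an asymptotic formula for
      \<open>total\<close>.\<close>
    have det: "\<bar>(\<Sum>i\<le>K. a i * kappa i n) - ?s * total (Suc n)\<bar> \<le> ?B"
    proof -
      have k: "(\<lambda>j. ?s * (gbinom_wt \<theta> j * ?x i ^ j)) sums kappa i n" for i
      proof -
        have "?s * (1 - ?x i) powr (- \<theta>) = kappa i n * ((1 - ?x i) powr \<theta> * (1 - ?x i) powr (- \<theta>))"
          unfolding kappa_eq[of n i] by (simp only: mult.assoc)
        also have "(1 - ?x i) powr \<theta> * (1 - ?x i) powr (- \<theta>) = 1"
          unfolding powr_add[symmetric] using x[of i] by simp
        finally show ?thesis
          using sums_mult[OF gbinom_wt_sums[of "?x i" \<theta>], of ?s] x[of i] by simp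
      qed
      have "(\<lambda>j. \<Sum>i\<le>K. a i * (?s * (gbinom_wt \<theta> j * ?x i ^ j))) sums (\<Sum>i\<le>K. a i * kappa i n)"
        by (intro sums_sum sums_mult k)
      moreover have "(\<lambda>j. gbinom_wt \<theta> j * ?w0 j) sums (\<Sum>j<Suc n. gbinom_wt \<theta> j * ?w0 j)"
        by (rule sums_finite) auto
      ultimately have "(\<lambda>j. (\<Sum>i\<le>K. a i * (?s * (gbinom_wt \<theta> j * ?x i ^ j))) - gbinom_wt \<theta> j * ?w0 j) sums
         ((\<Sum>i\<le>K. a i * kappa i n) - (\<Sum>j<Suc n. gbinom_wt \<theta> j * ?w0 j))" by (rule sums_diff)
      moreover have "(\<Sum>i\<le>K. a i * (?s * (gbinom_wt \<theta> j * ?x i ^ j))) - gbinom_wt \<theta> j * ?w0 j = gbinom_wt \<theta> j * (?wp j - ?w0 j)" for j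
        by (simp add: sum_distrib_left right_diff_distrib mult_ac)
      moreover have "(\<Sum>j<Suc n. gbinom_wt \<theta> j * ?w0 j) = ?s * total (Suc n)"
        unfolding total_def sum_distrib_left by (intro sum.cong) auto
      ultimately have eq: "(\<lambda>j. gbinom_wt \<theta> j * (?wp j - ?w0 j)) sums ((\<Sum>i\<le>K. a i * kappa i n) - ?s * total (Suc n))" by simp
      have summ: "summable (\<lambda>j. gbinom_wt \<theta> j * \<bar>?wp j - ?w0 j\<bar>)"
        by (rule gbinom_wt_weight_summable[OF wd_bd]) (use x[of 0] in auto)
      have "\<bar>\<Sum>j. gbinom_wt \<theta> j * (?wp j - ?w0 j)\<bar> \<le> (\<Sum>j. \<bar>gbinom_wt \<theta> j * (?wp j - ?w0 j)\<bar>)"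
        using summ g0 by (intro summable_rabs) (simp add: abs_mult)
      also have "\<dots> \<le> ?B" using B g0 by (simp add: abs_mult)
      finally show ?thesis using eq by (simp add: sums_iff)
    qed
    \<comment> \<open>Allows the denominator in \<open>mass\<close> to be multiplied away: the
      scaled difference dominates the original one.\<close>
    have tot: "?s * total (Suc n) \<ge> 1"
    proof -
      have "?m powr (- \<theta>) * ?m powr \<theta> \<le> ?s * total (Suc n)"
        unfolding total_def using s0 sum_gbinom_wt_ge[OF theta_pos theta_lt_1, of "Suc n"] by (intro mult_left_mono) auto
      then show ?thesis unfolding powr_add[symmetric] by simp
    qed
    have int_e: "integrable P (\<lambda>\<omega>. \<bar>?e i n \<omega> - kappa i n * ?M \<omega>\<bar>)" for i
    proof -
      have "integrable P (wsum (\<lambda>j. ?x i ^ j))" by (rule wsum_L1(1)[of _ 1 "?x i"]) (use x[of i] in auto)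
      then have "integrable P (energy (?x i))" by (simp add: wsum_def[abs_def] energy_def[abs_def])
      then show ?thesis using intM by simp
    qed
    have "(\<integral>\<omega>. \<bar>mass (Suc n) \<omega> - ?M \<omega>\<bar> \<partial>P) \<le>
      (\<integral>\<omega>. \<bar>(\<Sum>i\<le>K. a i * ?e i n \<omega>) - ?s * (\<Sum>j<Suc n. (cmod (c j \<omega>))\<^sup>2)\<bar> +
        (\<Sum>i\<le>K. \<bar>a i\<bar> * \<bar>?e i n \<omega> - kappa i n * ?M \<omega>\<bar>) + ?B * \<bar>?M \<omega>\<bar> \<partial>P)"
    proof (rule integral_mono)
      show "integrable P (\<lambda>\<omega>. \<bar>mass (Suc n) \<omega> - ?M \<omega>\<bar>)" using intM integrable_mass by simp
      show "integrable P (\<lambda>\<omega>. \<bar>(\<Sum>i\<le>K. a i * ?e i n \<omega>) - ?s * (\<Sum>j<Suc n. (cmod (c j \<omega>))\<^sup>2)\<bar> +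
        (\<Sum>i\<le>K. \<bar>a i\<bar> * \<bar>?e i n \<omega> - kappa i n * ?M \<omega>\<bar>) + ?B * \<bar>?M \<omega>\<bar>)"
        by (intro Bochner_Integration.integrable_add integrable_abs L1a(1) Bochner_Integration.integrable_sum
            integrable_mult_right int_e intM)
      fix \<omega>
      let ?E = "\<Sum>i\<le>K. a i * ?e i n \<omega>" and ?S = "\<Sum>j<Suc n. (cmod (c j \<omega>))\<^sup>2" and ?k = "\<Sum>i\<le>K. a i * kappa i n"
      have tp: "total (Suc n) > 0" using total_pos[of "Suc n"] by simp
      have "\<bar>mass (Suc n) \<omega> - ?M \<omega>\<bar> * 1 \<le> \<bar>mass (Suc n) \<omega> - ?M \<omega>\<bar> * (?s * total (Suc n))"
        using tot by (intro mult_left_mono) auto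
      also have "\<dots> = \<bar>?s * ?S - ?s * total (Suc n) * ?M \<omega>\<bar>"
      proof -
        have "(mass (Suc n) \<omega> - ?M \<omega>) * (?s * total (Suc n)) = ?s * ?S - ?s * total (Suc n) * ?M \<omega>"
          using tp by (simp add: mass_def field_simps)
        then show ?thesis using tot by (metis abs_mult abs_of_nonneg order_trans zero_le_one)
      qed
      also have "\<dots> = \<bar>(?s * ?S - ?E) + (?E - ?k * ?M \<omega>) + (?k - ?s * total (Suc n)) * ?M \<omega>\<bar>" by (simp add: algebra_simps)
      also have "\<dots> \<le> \<bar>?E - ?s * ?S\<bar> + \<bar>?E - ?k * ?M \<omega>\<bar> + \<bar>?k - ?s * total (Suc n)\<bar> * \<bar>?M \<omega>\<bar>"
        unfolding abs_mult[symmetric] by linarith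
      also have "\<dots> \<le> \<bar>?E - ?s * ?S\<bar> + (\<Sum>i\<le>K. \<bar>a i\<bar> * \<bar>?e i n \<omega> - kappa i n * ?M \<omega>\<bar>) + ?B * \<bar>?M \<omega>\<bar>"
      proof (intro add_mono order_refl mult_right_mono det abs_ge_zero)
        have "?E - ?k * ?M \<omega> = (\<Sum>i\<le>K. a i * (?e i n \<omega> - kappa i n * ?M \<omega>))"
          by (simp add: sum_subtractf sum_distrib_right right_diff_distrib mult.assoc)
        then show "\<bar>?E - ?k * ?M \<omega>\<bar> \<le> (\<Sum>i\<le>K. \<bar>a i\<bar> * \<bar>?e i n \<omega> - kappa i n * ?M \<omega>\<bar>)"
          by (simp only: abs_mult[symmetric] sum_abs)
      qed
      finally show "\<bar>mass (Suc n) \<omega> - ?M \<omega>\<bar> \<le> \<bar>?E - ?s * ?S\<bar> + (\<Sum>i\<le>K. \<bar>a i\<bar> * \<bar>?e i n \<omega> - kappa i n * ?M \<omega>\<bar>) + ?B * \<bar>?M \<omega>\<bar>" by simp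
    qed
    also have "\<dots> = (\<integral>\<omega>. \<bar>(\<Sum>i\<le>K. a i * ?e i n \<omega>) - ?s * (\<Sum>j<Suc n. (cmod (c j \<omega>))\<^sup>2)\<bar> \<partial>P) + T n + ?B * (\<integral>\<omega>. \<bar>?M \<omega>\<bar> \<partial>P)"
    proof -
      have i1: "integrable P (\<lambda>\<omega>. \<bar>(\<Sum>i\<le>K. a i * ?e i n \<omega>) - ?s * (\<Sum>j<Suc n. (cmod (c j \<omega>))\<^sup>2)\<bar>)" by (intro integrable_abs L1a(1))
      have i2: "integrable P (\<lambda>\<omega>. \<Sum>i\<le>K. \<bar>a i\<bar> * \<bar>?e i n \<omega> - kappa i n * ?M \<omega>\<bar>)"
        by (intro Bochner_Integration.integrable_sum integrable_mult_right int_e)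
      have i3: "integrable P (\<lambda>\<omega>. ?B * \<bar>?M \<omega>\<bar>)" by (intro integrable_mult_right integrable_abs intM)
      have T: "(\<integral>\<omega>. (\<Sum>i\<le>K. \<bar>a i\<bar> * \<bar>?e i n \<omega> - kappa i n * ?M \<omega>\<bar>) \<partial>P) = T n"
        unfolding T_def by (subst Bochner_Integration.integral_sum) (intro integrable_mult_right int_e, simp only: integral_mult_right_zero)
      show ?thesis
        unfolding Bochner_Integration.integral_add[OF Bochner_Integration.integrable_add[OF i1 i2] i3]
          Bochner_Integration.integral_add[OF i1 i2] T integral_mult_right_zero ..
    qed
    also have "\<dots> \<le> ?B + T n + ?B * (\<integral>\<omega>. \<bar>?M \<omega>\<bar> \<partial>P)" using L1a(2) by simp
    also have "\<dots> = ?B * (1 + (\<integral>\<omega>. \<bar>?M \<omega>\<bar> \<partial>P)) + T n" by (simp add: algebra_simps)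
    finally show "(\<integral>\<omega>. \<bar>mass (Suc n) \<omega> - ?M \<omega>\<bar> \<partial>P) \<le> ?B * (1 + (\<integral>\<omega>. \<bar>?M \<omega>\<bar> \<partial>P)) + T n" .
  qed
qed

lemma mass_L1:
  assumes gmc: "is_GMC P N \<theta> GMC"
  shows "(\<lambda>n. \<integral>\<omega>. \<bar>mass n \<omega> - GMC_mass GMC \<omega>\<bar> \<partial>P) \<longlonglongrightarrow> 0"
proof (rule LIMSEQ_imp_Suc, rule LIMSEQ_I)
  fix e :: real assume e: "e > 0"
  let ?I = "\<integral>\<omega>. \<bar>GMC_mass GMC \<omega>\<bar> \<partial>P"
  have I: "?I \<ge> 0" by simp
  \<comment> \<open>As \<open>kappa 0\<close> tends to 1, the bound tends to 2\<eta>(1 +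
    \<open>?I\<close>), which is e/2 for this choice.\<close>
  define \<eta> where "\<eta> = e / (4 * (1 + ?I))"
  have \<eta>: "\<eta> > 0" unfolding \<eta>_def using e I by (intro divide_pos_pos mult_pos_pos add_pos_nonneg) auto
  obtain T where T: "T \<longlonglongrightarrow> 0" and bd: "\<And>n. (\<integral>\<omega>. \<bar>mass (Suc n) \<omega> - GMC_mass GMC \<omega>\<bar> \<partial>P) \<le>
      (\<eta> + 1 / real (Suc n) + \<eta> * kappa 0 n) * (1 + ?I) + T n"
    using mass_Suc_bound[OF gmc \<eta>] by blast
  have k0: "kappa 0 \<longlonglongrightarrow> 1" using kappa_limit[of 0] by (simp add: One_nat_def[symmetric])
  have "(\<lambda>n. (\<eta> + 1 / real (Suc n) + \<eta> * kappa 0 n) * (1 + ?I) + T n) \<longlonglongrightarrow> (\<eta> + 0 + \<eta> * 1) * (1 + ?I) + 0"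
    by (intro tendsto_intros T k0) real_asymp
  moreover have "(\<eta> + 0 + \<eta> * 1) * (1 + ?I) + 0 < e"
  proof -
    have "e / (4 * t) * t = e / 4" if "t > 0" for t using that by simp
    from this[of "1 + ?I"] have "\<eta> * (1 + ?I) = e / 4" using I unfolding \<eta>_def by simp
    then show ?thesis using e by (simp add: distrib_right)
  qed
  ultimately have "\<forall>\<^sub>F n in sequentially. (\<eta> + 1 / real (Suc n) + \<eta> * kappa 0 n) * (1 + ?I) + T n < e"
    by (rule order_tendstoD(2))
  then obtain n0 where n0: "\<And>n. n \<ge> n0 \<Longrightarrow> (\<eta> + 1 / real (Suc n) + \<eta> * kappa 0 n) * (1 + ?I) + T n < e"
    by (auto simp: eventually_sequentially)
  show "\<exists>n0. \<forall>n\<ge>n0. norm ((\<integral>\<omega>. \<bar>mass (Suc n) \<omega> - GMC_mass GMC \<omega>\<bar> \<partial>P) - 0) < e"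
  proof (intro exI[of _ n0] allI impI)
    fix n assume "n \<ge> n0"
    then show "norm ((\<integral>\<omega>. \<bar>mass (Suc n) \<omega> - GMC_mass GMC \<omega>\<bar> \<partial>P) - 0) < e"
      using bd[of n] n0[of n] by simp
  qed
qed

end

section \<open>Continuity theorem for complex random variables\<close>

abbreviation torus :: "(complex \<times> complex) set" where
  "torus \<equiv> sphere 0 1 \<times> sphere 0 1"

text \<open>Finite sums of characters of the torus. Composed with \<open>torus_map\<close> a
  character becomes a multiple of exp(i Re(conj xi z)), whose expectation is a value of the
  characteristic function.\<close>

inductive_set trig_poly :: "(complex \<times> complex \<Rightarrow> complex) set" where
  monom: "(\<lambda>(u, v). a * (u powi k * v powi l)) \<in> trig_poly"
| add: "p \<in> trig_poly \<Longrightarrow> q \<in> trig_poly \<Longrightarrow> (\<lambda>x. p x + q x) \<in> trig_poly"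

lemma trig_poly_mult_monom:
  assumes "q \<in> trig_poly"
  shows "\<exists>r\<in>trig_poly. \<forall>x\<in>torus. r x = (case x of (u, v) \<Rightarrow> a * (u powi k * v powi l)) * q x"
  using assms
proof induction
  case (monom b k' l')
  show ?case
  proof (rule bexI[OF _ trig_poly.monom[of "a * b" "k + k'" "l + l'"]], rule ballI)
    fix x assume "x \<in> torus"
    then have "fst x \<noteq> 0" "snd x \<noteq> 0" by auto
    then show "(case x of (u, v) \<Rightarrow> a * b * (u powi (k + k') * v powi (l + l'))) =
        (case x of (u, v) \<Rightarrow> a * (u powi k * v powi l)) * (case x of (u, v) \<Rightarrow> b * (u powi k' * v powi l'))"
      by (cases x) (simp add: power_int_add)
  qed
next
  case (add p q)
  then obtain r r' where "r \<in> trig_poly" "r' \<in> trig_poly"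
    "\<forall>x\<in>torus. r x = (case x of (u, v) \<Rightarrow> a * (u powi k * v powi l)) * p x"
    "\<forall>x\<in>torus. r' x = (case x of (u, v) \<Rightarrow> a * (u powi k * v powi l)) * q x" by blast
  then show ?case
    by (intro bexI[OF _ trig_poly.add[of r r']]) (auto simp: distrib_left)
qed

text \<open>Equality is asked only on the torus, where both coordinates are nonzero: adding integer
  exponents fails at 0.\<close>

lemma trig_poly_mult:
  assumes "p \<in> trig_poly" "q \<in> trig_poly"
  shows "\<exists>r\<in>trig_poly. \<forall>x\<in>torus. r x = p x * q x"
  using assms(1)
proof induction
  case (monom a k l)
  then show ?case using trig_poly_mult_monom[OF assms(2)] by blast
next
  case (add p p')
  then obtain r r' where "r \<in> trig_poly" "r' \<in> trig_poly"
    "\<forall>x\<in>torus. r x = p x * q x" "\<forall>x\<in>torus. r' x = p' x * q x" by blast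
  then show ?case
    by (intro bexI[OF _ trig_poly.add[of r r']]) (auto simp: distrib_right)
qed

text \<open>The bridge between real polynomials in the coordinates, which Stone-Weierstrass
  delivers, and characters, whose expectations are controlled.\<close>

definition real_trig :: "(complex \<times> complex \<Rightarrow> real) \<Rightarrow> bool" where
  "real_trig r \<longleftrightarrow> (\<exists>p\<in>trig_poly. \<forall>x\<in>torus. p x = of_real (r x))"

lemma real_trig_const: "real_trig (\<lambda>_. a)"
  unfolding real_trig_def by (rule bexI[OF _ trig_poly.monom[of "of_real a" 0 0]]) auto

lemma real_trig_add:
  assumes "real_trig f" "real_trig g" shows "real_trig (\<lambda>x. f x + g x)"
proof -
  obtain p q where "p \<in> trig_poly" "q \<in> trig_poly"
    "\<forall>x\<in>torus. p x = of_real (f x)" "\<forall>x\<in>torus. q x = of_real (g x)"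
    using assms unfolding real_trig_def by blast
  then show ?thesis unfolding real_trig_def
    by (intro bexI[OF _ trig_poly.add[of p q]]) simp_all
qed

lemma real_trig_mult:
  assumes "real_trig f" "real_trig g" shows "real_trig (\<lambda>x. f x * g x)"
proof -
  obtain p q where pq: "p \<in> trig_poly" "q \<in> trig_poly"
    "\<forall>x\<in>torus. p x = of_real (f x)" "\<forall>x\<in>torus. q x = of_real (g x)"
    using assms unfolding real_trig_def by blast
  obtain r where "r \<in> trig_poly" "\<forall>x\<in>torus. r x = p x * q x"
    using trig_poly_mult[OF pq(1,2)] by blast
  with pq(3,4) show ?thesis unfolding real_trig_def by (intro bexI[of _ r]) simp_all
qed

lemma unit_inverse: "cmod u = 1 \<Longrightarrow> inverse u = cnj u"
  by (rule inverse_unique) (metis complex_norm_square of_real_1 power_one)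

text \<open>On the unit circle the conjugate is the inverse, so real and imaginary parts are
  combinations of the characters with exponents 1 and -1.\<close>

lemma real_trig_coord:
  "real_trig (\<lambda>x. Re (fst x))" "real_trig (\<lambda>x. Im (fst x))" "real_trig (\<lambda>x. Re (snd x))" "real_trig (\<lambda>x. Im (snd x))"
proof -
  have re: "(1 / 2) * u + (1 / 2) * inverse u = complex_of_real (Re u)" and
    im: "(- \<i> / 2) * u + (\<i> / 2) * inverse u = complex_of_real (Im u)" if "cmod u = 1" for u
    unfolding unit_inverse[OF that] by (auto simp: complex_eq_iff)
  show "real_trig (\<lambda>x. Re (fst x))" unfolding real_trig_def
    by (rule bexI[OF _ trig_poly.add[OF trig_poly.monom[of "1 / 2" 1 0] trig_poly.monom[of "1 / 2" "- 1" 0]]])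
       (use re in \<open>auto simp: power_int_minus\<close>)
  show "real_trig (\<lambda>x. Im (fst x))" unfolding real_trig_def
    by (rule bexI[OF _ trig_poly.add[OF trig_poly.monom[of "- \<i> / 2" 1 0] trig_poly.monom[of "\<i> / 2" "- 1" 0]]])
       (use im in \<open>auto simp: power_int_minus\<close>)
  show "real_trig (\<lambda>x. Re (snd x))" unfolding real_trig_def
    by (rule bexI[OF _ trig_poly.add[OF trig_poly.monom[of "1 / 2" 0 1] trig_poly.monom[of "1 / 2" 0 "- 1"]]])
       (use re in \<open>auto simp: power_int_minus\<close>)
  show "real_trig (\<lambda>x. Im (snd x))" unfolding real_trig_def
    by (rule bexI[OF _ trig_poly.add[OF trig_poly.monom[of "- \<i> / 2" 0 1] trig_poly.monom[of "\<i> / 2" 0 "- 1"]]])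
       (use im in \<open>auto simp: power_int_minus\<close>)
qed

lemma real_trig_polynomial:
  fixes f :: "complex \<times> complex \<Rightarrow> real"
  assumes "real_polynomial_function f" shows "real_trig f"
  using assms
proof induction
  case (linear f)
  then interpret bounded_linear f .
  have "f x = Re (fst x) * f (1, 0) + Im (fst x) * f (\<i>, 0) + Re (snd x) * f (0, 1) + Im (snd x) * f (0, \<i>)" for x
  proof -
    have "x = Re (fst x) *\<^sub>R (1, 0) + Im (fst x) *\<^sub>R (\<i>, 0) + Re (snd x) *\<^sub>R (0, 1) + Im (snd x) *\<^sub>R (0, \<i>)"
      by (cases x) (auto simp: complex_eq_iff)
    then show ?thesis by (metis add scaleR real_scaleR_def)
  qed
  then have "f = (\<lambda>x. Re (fst x) * f (1, 0) + Im (fst x) * f (\<i>, 0) + Re (snd x) * f (0, 1) + Im (snd x) * f (0, \<i>))" by blast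
  then show ?case
    by (subst \<open>f = _\<close>) (intro real_trig_add real_trig_mult real_trig_coord real_trig_const)
qed (auto intro: real_trig_const real_trig_add real_trig_mult)

definition torus_map :: "real \<Rightarrow> complex \<Rightarrow> complex \<times> complex" where
  "torus_map R z = (cis (Re z / R), cis (Im z / R))"

lemma torus_map_in: "torus_map R z \<in> torus"
  by (simp add: torus_map_def)

text \<open>After a cutoff at radius R the function lives where both angles Re z / R and Im z / R
  have modulus at most 1 < pi, so it extends by 0 to a continuous function on the torus and can be
  approximated there. Outside radius R/2 only the bound 2B, with an extra \<epsilon>, is
  claimed.\<close>

lemma torus_approx:
  fixes f :: "complex \<Rightarrow> real"
  assumes f: "continuous_on UNIV f" and bd: "\<And>z. \<bar>f z\<bar> \<le> B" and R: "R > 0" and \<epsilon>: "\<epsilon> > 0"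
  obtains r where "real_trig r" "\<And>z. \<bar>f z - r (torus_map R z)\<bar> \<le> \<epsilon> + 2 * B * indicator {z. R / 2 < cmod z} z"
proof -
  \<comment> \<open>Equal to 1 up to radius R/2, where the error must be small, and to 0 from radius
    R on.\<close>
  define \<psi> where "\<psi> z = max 0 (min 1 (2 - 2 * cmod z / R))" for z :: complex
  have \<psi>: "\<psi> z = 1" if "cmod z \<le> R / 2" for z using that R by (auto simp: \<psi>_def max_def min_def field_simps)
  have \<psi>0: "\<psi> z = 0" if "cmod z \<ge> R" for z
  proof -
    have "2 - 2 * cmod z / R \<le> 0" using that R by (simp add: field_simps)
    then show ?thesis by (simp add: \<psi>_def)
  qed
  have \<psi>01: "0 \<le> \<psi> z" "\<psi> z \<le> 1" for z by (auto simp: \<psi>_def)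
  define g where "g z = f z * \<psi> z" for z
  have g: "continuous_on UNIV g" unfolding g_def \<psi>_def using R by (intro continuous_intros f) auto
  define ang where "ang x = Complex (R * Arg (fst x)) (R * Arg (snd x))" for x
  define G where "G x = g (ang x)" for x
  \<comment> \<open>On \<open>?U\<close> both arguments are continuous. On \<open>?V\<close> some
    argument has modulus at least 1, so the cutoff makes \<open>G\<close> vanish; this covers the
    branch cut at -1.\<close>
  let ?U = "torus \<inter> {x. fst x \<noteq> - 1 \<and> snd x \<noteq> - 1}" and ?V = "torus \<inter> {x. Re (fst x) < 0 \<or> Re (snd x) < 0}"
  have UV: "?U \<union> ?V = torus" by auto
  have "continuous_on (?U \<union> ?V) G"
  proof (rule continuous_on_Un_local_open)
    have "open {x::complex \<times> complex. fst x \<noteq> - 1 \<and> snd x \<noteq> - 1}"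
      by (intro open_Collect_conj open_Collect_neq continuous_intros)
    then show "openin (top_of_set (?U \<union> ?V)) ?U" unfolding UV by (rule openin_open_Int)
    have "open {x::complex \<times> complex. Re (fst x) < 0 \<or> Re (snd x) < 0}"
      by (intro open_Collect_disj open_Collect_less continuous_intros)
    then show "openin (top_of_set (?U \<union> ?V)) ?V" unfolding UV by (rule openin_open_Int)
    have neg: "u \<notin> \<real>\<^sub>\<le>\<^sub>0" if "cmod u = 1" "u \<noteq> - 1" for u
    proof
      assume "u \<in> \<real>\<^sub>\<le>\<^sub>0"
      then obtain t where "u = of_real t" "t \<le> 0" by (auto elim!: nonpos_Reals_cases)
      with that show False by auto
    qed
    have "continuous_on ?U ang" unfolding ang_def Complex_eq
      by (intro continuous_intros) (use neg in auto)
    then show "continuous_on ?U G" unfolding G_def by (intro continuous_on_compose2[OF g]) auto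
    have "G x = 0" if "x \<in> ?V" for x
    proof -
      have "\<bar>Arg (fst x)\<bar> \<ge> 1 \<or> \<bar>Arg (snd x)\<bar> \<ge> 1"
      proof -
        have "\<bar>Arg u\<bar> \<ge> 1" if "Re u < 0" for u
        proof (rule ccontr)
          assume "\<not> \<bar>Arg u\<bar> \<ge> 1"
          then have "\<bar>Arg u\<bar> < pi / 2" using pi_gt3 by linarith
          then have "cos (Arg u) \<ge> 0" by (intro cos_ge_zero) auto
          moreover have "Re u = cmod u * cos (Arg u)" using Re_rcis[of "cmod u" "Arg u"] by (simp only: rcis_cmod_Arg)
          ultimately have "Re u \<ge> 0" by simp
          then show False using that by simp
        qed
        then show ?thesis using that by auto
      qed
      then have "cmod (ang x) \<ge> R"
      proof
        assume "\<bar>Arg (fst x)\<bar> \<ge> 1"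
        then have "R * 1 \<le> R * \<bar>Arg (fst x)\<bar>" using R by (intro mult_left_mono) auto
        moreover have "R * \<bar>Arg (fst x)\<bar> \<le> cmod (ang x)"
          using abs_Re_le_cmod[of "ang x"] R by (simp add: ang_def abs_mult)
        ultimately show ?thesis by linarith
      next
        assume "\<bar>Arg (snd x)\<bar> \<ge> 1"
        then have "R * 1 \<le> R * \<bar>Arg (snd x)\<bar>" using R by (intro mult_left_mono) auto
        moreover have "R * \<bar>Arg (snd x)\<bar> \<le> cmod (ang x)"
          using abs_Im_le_cmod[of "ang x"] R by (simp add: ang_def abs_mult)
        ultimately show ?thesis by linarith
      qed
      then show ?thesis by (simp add: G_def g_def \<psi>0)
    qed
    then have "continuous_on ?V G \<longleftrightarrow> continuous_on ?V (\<lambda>_. 0::real)" by (intro continuous_on_cong) auto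
    then show "continuous_on ?V G" by simp
  qed
  then have "continuous_on torus G" unfolding UV .
  moreover have "compact torus" by (intro compact_Times compact_sphere)
  ultimately obtain r where r: "real_polynomial_function r" "\<And>x. x \<in> torus \<Longrightarrow> \<bar>G x - r x\<bar> < \<epsilon>"
    using Stone_Weierstrass_real_polynomial_function[of torus G \<epsilon>] \<epsilon> by blast
  show ?thesis
  proof (rule that[OF real_trig_polynomial[OF r(1)]])
    fix z
    have 1: "\<bar>G (torus_map R z) - r (torus_map R z)\<bar> \<le> \<epsilon>" using r(2)[OF torus_map_in] by (rule less_imp_le)
    have "\<bar>f z - G (torus_map R z)\<bar> \<le> 2 * B * indicator {z. R / 2 < cmod z} z"
    proof (cases "cmod z \<le> R / 2")
      case True
      have ac: "Arg (cis t) = t" if "\<bar>t\<bar> \<le> 1" for t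
        by (rule Arg_cis, unfold greaterThanAtMost_iff) (use that pi_gt3 in linarith)
      have "\<bar>Re z / R\<bar> \<le> 1" "\<bar>Im z / R\<bar> \<le> 1"
        using True abs_Re_le_cmod[of z] abs_Im_le_cmod[of z] R by (simp_all add: field_simps)
      then have "Arg (cis (Re z / R)) = Re z / R" "Arg (cis (Im z / R)) = Im z / R"
        by (auto intro!: ac)
      then have "ang (torus_map R z) = z" using R by (simp add: ang_def torus_map_def complex_eq_iff)
      then show ?thesis using True \<psi>[OF True] by (simp add: G_def g_def)
    next
      case False
      have "\<bar>G (torus_map R z)\<bar> \<le> B * 1"
        unfolding G_def g_def abs_mult using bd \<psi>01 by (intro mult_mono) (auto intro: order_trans[OF abs_ge_zero])
      then show ?thesis using False bd[of z] by simp
    qed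
    with 1 show "\<bar>f z - r (torus_map R z)\<bar> \<le> \<epsilon> + 2 * B * indicator {z. R / 2 < cmod z} z" by linarith
  qed
qed

lemma (in prob_space) trig_poly_integrable:
  assumes [measurable]: "X \<in> borel_measurable M" and R: "R > 0" and "p \<in> trig_poly"
  shows "integrable M (\<lambda>\<omega>. p (torus_map R (X \<omega>)))"
  using assms(3)
proof induction
  case (monom a k l)
  have "continuous_on UNIV (\<lambda>z. case torus_map R z of (u, v) \<Rightarrow> a * (u powi k * v powi l))"
    unfolding torus_map_def prod.case using R by (intro continuous_intros) auto
  then have [measurable]: "(\<lambda>z. case torus_map R z of (u, v) \<Rightarrow> a * (u powi k * v powi l)) \<in> borel_measurable borel"
    by (rule borel_measurable_continuous_onI)
  have "(\<lambda>\<omega>. case torus_map R (X \<omega>) of (u, v) \<Rightarrow> a * (u powi k * v powi l)) \<in> borel_measurable M" by measurable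
  then show ?case
    by (intro integrable_const_bound[where B = "cmod a"]) (auto simp: torus_map_def norm_mult norm_power_int)
qed auto

text \<open>The character with exponents k, l corresponds to the frequency xi = (k + i l)/R, so the
  claim is the hypothesis extended by linearity.\<close>

lemma trig_poly_convergence:
  assumes P: "prob_space P" and X: "\<And>n. X n \<in> borel_measurable P"
    and Q: "prob_space Q" and Y: "Y \<in> borel_measurable Q"
    and conv: "\<And>\<xi>. (\<lambda>n. \<integral>\<omega>. exp (\<i> * of_real (Re (cnj \<xi> * X n \<omega>))) \<partial>P) \<longlonglongrightarrow> (\<integral>\<omega>. exp (\<i> * of_real (Re (cnj \<xi> * Y \<omega>))) \<partial>Q)"
    and R: "R > 0" and p: "p \<in> trig_poly"
  shows "(\<lambda>n. \<integral>\<omega>. p (torus_map R (X n \<omega>)) \<partial>P) \<longlonglongrightarrow> (\<integral>\<omega>. p (torus_map R (Y \<omega>)) \<partial>Q)"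
  using p
proof induction
  case (monom a k l)
  let ?\<xi> = "Complex (of_int k / R) (of_int l / R)"
  have "(case torus_map R z of (u, v) \<Rightarrow> a * (u powi k * v powi l)) = a * exp (\<i> * of_real (Re (cnj ?\<xi> * z)))" for z
  proof -
    have "cis (Re z / R) powi k * cis (Im z / R) powi l = cis (of_int k * (Re z / R) + of_int l * (Im z / R))"
      by (simp add: cis_power_int cis_mult)
    then show ?thesis by (simp add: torus_map_def cis_conv_exp)
  qed
  then show ?case using tendsto_mult[OF tendsto_const conv[of ?\<xi>], of a] by simp
next
  case (add p q)
  interpret P: prob_space P by fact
  interpret Q: prob_space Q by fact
  show ?case
    using tendsto_add[OF add.IH] P.trig_poly_integrable[OF X R add.hyps(1)] P.trig_poly_integrable[OF X R add.hyps(2)]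
      Q.trig_poly_integrable[OF Y R add.hyps(1)] Q.trig_poly_integrable[OF Y R add.hyps(2)] by simp
qed

lemma (in prob_space) torus_approx_expectation:
  fixes X :: "'a \<Rightarrow> complex" and f r :: "_ \<Rightarrow> real"
  assumes X [measurable]: "X \<in> borel_measurable M" and f: "continuous_on UNIV f" and bd: "\<And>z. \<bar>f z\<bar> \<le> B"
    and R: "R > 0" and p: "p \<in> trig_poly" "\<forall>x\<in>torus. p x = of_real (r x)"
    and r: "\<And>z. \<bar>f z - r (torus_map R z)\<bar> \<le> \<epsilon> + 2 * B * indicator {z. R / 2 < cmod z} z"
  shows "cmod (of_real (expectation (\<lambda>\<omega>. f (X \<omega>))) - (\<integral>\<omega>. p (torus_map R (X \<omega>)) \<partial>M))
    \<le> \<epsilon> + 2 * B * prob {\<omega> \<in> space M. R / 2 < cmod (X \<omega>)}"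
proof -
  have fm [measurable]: "f \<in> borel_measurable borel" using f by (rule borel_measurable_continuous_onI)
  have int: "integrable M (\<lambda>\<omega>. complex_of_real (f (X \<omega>)))"
    by (intro integrable_of_real integrable_const_bound[where B = B]) (use bd in auto)
  note intp = trig_poly_integrable[OF X R p(1)]
  let ?A = "{\<omega> \<in> space M. R / 2 < cmod (X \<omega>)}"
  have A: "integrable M (indicat_real ?A)" by (intro integrable_real_indicator) (auto simp: emeasure_eq_measure)
  have "of_real (expectation (\<lambda>\<omega>. f (X \<omega>))) - (\<integral>\<omega>. p (torus_map R (X \<omega>)) \<partial>M) = (\<integral>\<omega>. of_real (f (X \<omega>)) - p (torus_map R (X \<omega>)) \<partial>M)"
    using int intp by simp
  also have "cmod \<dots> \<le> (\<integral>\<omega>. cmod (of_real (f (X \<omega>)) - p (torus_map R (X \<omega>))) \<partial>M)"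
    by (rule integral_norm_bound)
  also have "\<dots> \<le> (\<integral>\<omega>. \<epsilon> + 2 * B * indicat_real ?A \<omega> \<partial>M)"
  proof (rule integral_mono)
    show "integrable M (\<lambda>\<omega>. cmod (of_real (f (X \<omega>)) - p (torus_map R (X \<omega>))))"
      by (intro integrable_norm Bochner_Integration.integrable_diff int intp)
    show "integrable M (\<lambda>\<omega>. \<epsilon> + 2 * B * indicat_real ?A \<omega>)" using A by simp
    fix \<omega> assume "\<omega> \<in> space M"
    have "p (torus_map R (X \<omega>)) = of_real (r (torus_map R (X \<omega>)))" using p(2) torus_map_in by blast
    then have "cmod (of_real (f (X \<omega>)) - p (torus_map R (X \<omega>))) = \<bar>f (X \<omega>) - r (torus_map R (X \<omega>))\<bar>"
      by (simp flip: of_real_diff)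
    also have "\<dots> \<le> \<epsilon> + 2 * B * indicat_real ?A \<omega>"
      using r[of "X \<omega>"] \<open>\<omega> \<in> space M\<close> by (simp add: indicator_def)
    finally show "cmod (of_real (f (X \<omega>)) - p (torus_map R (X \<omega>))) \<le> \<epsilon> + 2 * B * indicat_real ?A \<omega>" .
  qed
  also have "\<dots> = \<epsilon> + 2 * B * prob ?A" using A by (simp add: prob_space)
  finally show ?thesis .
qed

lemma (in prob_space) tight_single:
  fixes Y :: "'a \<Rightarrow> complex"
  assumes [measurable]: "Y \<in> borel_measurable M"
  shows "(\<lambda>k. prob {\<omega> \<in> space M. real k < cmod (Y \<omega>)}) \<longlonglongrightarrow> 0"
proof -
  have "(\<lambda>k. prob {\<omega> \<in> space M. real k < cmod (Y \<omega>)}) \<longlonglongrightarrow> prob (\<Inter>k. {\<omega> \<in> space M. real k < cmod (Y \<omega>)})"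
    by (rule finite_Lim_measure_decseq) (auto simp: decseq_def intro: le_less_trans)
  moreover have "(\<Inter>k::nat. {\<omega> \<in> space M. real k < cmod (Y \<omega>)}) = {}"
  proof (rule equals0I)
    fix \<omega> assume \<omega>: "\<omega> \<in> (\<Inter>k::nat. {\<omega> \<in> space M. real k < cmod (Y \<omega>)})"
    obtain k :: nat where "cmod (Y \<omega>) \<le> real k" using real_arch_simple by blast
    moreover have "real k < cmod (Y \<omega>)" using \<omega> by blast
    ultimately show False by simp
  qed
  ultimately show ?thesis by simp
qed

text \<open>Tightness is immediate from the second moments by Markov, uniformly in n. The error
  splits into five parts of size e/5: approximation and tail for \<open>X n\<close>, the same two
  for \<open>Y\<close>, and the convergence for one fixed trigonometric polynomial.\<close>

lemma Levy_complex:
  fixes X :: "nat \<Rightarrow> 'a \<Rightarrow> complex" and Y :: "'b \<Rightarrow> complex" and f :: "complex \<Rightarrow> real"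
  assumes P: "prob_space P" and X: "\<And>n. X n \<in> borel_measurable P"
    and Q: "prob_space Q" and Y: "Y \<in> borel_measurable Q"
    and X2: "\<And>n. integrable P (\<lambda>\<omega>. (cmod (X n \<omega>))\<^sup>2)" "\<And>n. (\<integral>\<omega>. (cmod (X n \<omega>))\<^sup>2 \<partial>P) \<le> 1"
    and conv: "\<And>\<xi>. (\<lambda>n. \<integral>\<omega>. exp (\<i> * of_real (Re (cnj \<xi> * X n \<omega>))) \<partial>P) \<longlonglongrightarrow> (\<integral>\<omega>. exp (\<i> * of_real (Re (cnj \<xi> * Y \<omega>))) \<partial>Q)"
    and f: "continuous_on UNIV f" "bounded (range f)"
  shows "(\<lambda>n. \<integral>\<omega>. f (X n \<omega>) \<partial>P) \<longlonglongrightarrow> (\<integral>\<omega>. f (Y \<omega>) \<partial>Q)"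
proof (rule LIMSEQ_I)
  interpret P: prob_space P by fact
  interpret Q: prob_space Q by fact
  fix e :: real assume e: "e > 0"
  obtain B where B: "B > 0" "\<And>z. \<bar>f z\<bar> \<le> B" using f(2) by (auto simp: bounded_pos)
  have "(\<lambda>k. 2 * B * Q.prob {\<omega> \<in> space Q. real k < cmod (Y \<omega>)}) \<longlonglongrightarrow> 2 * B * 0"
    by (intro tendsto_mult tendsto_const Q.tight_single Y)
  moreover have "(\<lambda>k. 2 * B * (1 / (real k)\<^sup>2)) \<longlonglongrightarrow> 2 * B * 0"
    by (intro tendsto_mult tendsto_const) real_asymp
  ultimately have "\<forall>\<^sub>F k in sequentially. 2 * B * Q.prob {\<omega> \<in> space Q. real k < cmod (Y \<omega>)} < e / 5 \<and>
      2 * B * (1 / (real k)\<^sup>2) < e / 5 \<and> k \<ge> 1"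
    using e by (intro eventually_conj order_tendstoD(2) eventually_ge_at_top) auto
  then obtain k where k: "2 * B * Q.prob {\<omega> \<in> space Q. real k < cmod (Y \<omega>)} < e / 5"
      "2 * B * (1 / (real k)\<^sup>2) < e / 5" "k \<ge> 1"
    by (auto simp: eventually_sequentially)
  \<comment> \<open>Twice k, because the approximation is accurate up to half the cutoff radius
    while the tails are controlled beyond k.\<close>
  let ?R = "2 * real k"
  have R: "?R > 0" using k(3) by simp
  obtain r where r: "real_trig r" "\<And>z. \<bar>f z - r (torus_map ?R z)\<bar> \<le> e / 5 + 2 * B * indicator {z. ?R / 2 < cmod z} z"
    using torus_approx[OF f(1) B(2), of ?R "e / 5"] e k(3) by auto
  then obtain p where p: "p \<in> trig_poly" "\<forall>x\<in>torus. p x = of_real (r x)" by (auto simp: real_trig_def)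
  have Pk: "2 * B * P.prob {\<omega> \<in> space P. ?R / 2 < cmod (X n \<omega>)} < e / 5" for n
  proof -
    have [measurable]: "X n \<in> borel_measurable P" by (rule X)
    have "P.prob {\<omega> \<in> space P. (real k)\<^sup>2 \<le> (cmod (X n \<omega>))\<^sup>2} \<le> (\<integral>\<omega>. (cmod (X n \<omega>))\<^sup>2 \<partial>P) / (real k)\<^sup>2"
      by (rule integral_Markov_inequality_measure[OF X2(1), where A = "{}"]) (use k(3) in auto)
    also have "\<dots> \<le> 1 / (real k)\<^sup>2" by (intro divide_right_mono X2(2)) auto
    finally have "P.prob {\<omega> \<in> space P. (real k)\<^sup>2 \<le> (cmod (X n \<omega>))\<^sup>2} \<le> 1 / (real k)\<^sup>2" .
    moreover have "P.prob {\<omega> \<in> space P. ?R / 2 < cmod (X n \<omega>)} \<le> P.prob {\<omega> \<in> space P. (real k)\<^sup>2 \<le> (cmod (X n \<omega>))\<^sup>2}"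
      by (intro P.finite_measure_mono) (auto intro!: power_mono)
    ultimately have "2 * B * P.prob {\<omega> \<in> space P. ?R / 2 < cmod (X n \<omega>)} \<le> 2 * B * (1 / (real k)\<^sup>2)"
      using B by (intro mult_left_mono) auto
    then show ?thesis using k(2) by simp
  qed
  let ?E = "\<lambda>n. \<integral>\<omega>. p (torus_map ?R (X n \<omega>)) \<partial>P" and ?E' = "\<integral>\<omega>. p (torus_map ?R (Y \<omega>)) \<partial>Q"
  have 1: "cmod (of_real (P.expectation (\<lambda>\<omega>. f (X n \<omega>))) - ?E n) < e / 5 + e / 5" for n
    using P.torus_approx_expectation[OF X f(1) B(2) R p r(2), of n] Pk[of n] by linarith
  have 2: "cmod (of_real (Q.expectation (\<lambda>\<omega>. f (Y \<omega>))) - ?E') < e / 5 + e / 5"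
    using Q.torus_approx_expectation[OF Y f(1) B(2) R p r(2)] k(1) by simp
  have "?E \<longlonglongrightarrow> ?E'" by (rule trig_poly_convergence[OF P X Q Y conv R p(1)])
  from LIMSEQ_D[OF this, of "e / 5"] e obtain n0 where n0: "\<And>n. n \<ge> n0 \<Longrightarrow> cmod (?E n - ?E') < e / 5" by auto
  show "\<exists>n0. \<forall>n\<ge>n0. norm (P.expectation (\<lambda>\<omega>. f (X n \<omega>)) - Q.expectation (\<lambda>\<omega>. f (Y \<omega>))) < e"
  proof (intro exI[of _ n0] allI impI)
    fix n assume n: "n \<ge> n0"
    let ?a = "complex_of_real (P.expectation (\<lambda>\<omega>. f (X n \<omega>)))" and ?b = "complex_of_real (Q.expectation (\<lambda>\<omega>. f (Y \<omega>)))"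
    have tri: "cmod (a - b) \<le> cmod (a - x) + cmod (x - y) + cmod (b - y)" for a b x y
      using dist_triangle[of a b x] dist_triangle[of x b y] by (simp add: dist_norm norm_minus_commute)
    have "cmod (?a - ?b) \<le> cmod (?a - ?E n) + cmod (?E n - ?E') + cmod (?b - ?E')" by (rule tri)
    also have "\<dots> < e" using 1[of n] 2 n0[OF n] by linarith
    finally show "norm (P.expectation (\<lambda>\<omega>. f (X n \<omega>)) - Q.expectation (\<lambda>\<omega>. f (Y \<omega>))) < e"
      by (simp only: of_real_diff[symmetric] norm_of_real real_norm_def)
  qed
qed

section \<open>Characteristic functions of the Gaussian and of the mixture\<close>

lemma char_gmeas: "(\<integral>x. exp (\<i> * of_real (t * x)) \<partial>gmeas) = of_real (exp (- t\<^sup>2 / 4))"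
proof -
  have dens: "gdens (x / sqrt 2) = sqrt 2 * std_normal_density x" for x
    by (simp add: normal_density_def real_sqrt_divide real_sqrt_mult power_divide field_simps)
  have m: "(\<lambda>x. exp (\<i> * of_real (t * x))) \<in> borel_measurable borel" for t :: real
    by (intro borel_measurable_continuous_onI continuous_intros)
  have "(\<integral>x. exp (\<i> * of_real (t * x)) \<partial>gmeas) = (\<integral>x. gdens x *\<^sub>R exp (\<i> * of_real (t * x)) \<partial>lborel)"
    unfolding gmeas_def using m by (subst integral_density) auto
  also have "\<dots> = \<bar>1 / sqrt 2\<bar> *\<^sub>R (\<integral>x. gdens (0 + 1 / sqrt 2 * x) *\<^sub>R exp (\<i> * of_real (t * (0 + 1 / sqrt 2 * x))) \<partial>lborel)"
    by (rule lborel_integral_real_affine) simp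
  also have "\<dots> = (\<integral>x. std_normal_density x *\<^sub>R exp (\<i> * of_real (t / sqrt 2 * x)) \<partial>lborel)"
    unfolding integral_scaleR_right[symmetric] using dens
    by (intro Bochner_Integration.integral_cong) (auto simp: scaleR_conv_of_real)
  also have "\<dots> = char std_normal_distribution (t / sqrt 2)"
    unfolding char_def using m by (subst integral_density) (auto simp: mult_ac)
  also have "\<dots> = of_real (exp (- t\<^sup>2 / 4))"
    unfolding char_std_normal_distribution by (simp add: power_divide)
  finally show ?thesis .
qed

lemma char_cgauss: "(\<integral>y. exp (\<i> * of_real (Re (cnj \<eta> * y))) \<partial>cgauss) = of_real (exp (- (cmod \<eta>)\<^sup>2 / 4))"
proof -
  have "poly_growth (\<lambda>y. exp (\<i> * of_real (Re (cnj \<eta> * y))))"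
    by (rule poly_growthI[where C = 1 and d = 0]) (auto intro!: continuous_intros simp: norm_exp_eq_Re)
  from integral_cgauss_fst[OF this]
  have "(\<integral>y. exp (\<i> * of_real (Re (cnj \<eta> * y))) \<partial>cgauss) =
    (\<integral>a. (\<integral>b. exp (\<i> * of_real (Re \<eta> * a)) * exp (\<i> * of_real (Im \<eta> * b)) \<partial>gmeas) \<partial>gmeas)"
    by (simp add: exp_add[symmetric] algebra_simps)
  also have "\<dots> = of_real (exp (- (Re \<eta>)\<^sup>2 / 4)) * of_real (exp (- (Im \<eta>)\<^sup>2 / 4))"
    unfolding integral_mult_right_zero integral_mult_left_zero char_gmeas ..
  also have "\<dots> = of_real (exp (- (cmod \<eta>)\<^sup>2 / 4))"
    unfolding of_real_mult[symmetric] exp_add[symmetric] cmod_power2 by (simp add: add_divide_distrib)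
  finally show ?thesis .
qed

text \<open>Conditionally on M, the product is a complex Gaussian scaled by
  \<open>sqrt (M \<omega>)\<close>. The absolute value is there because nothing is assumed about the
  sign of M here.\<close>

lemma indep_rvs_char:
  assumes Q: "prob_space Q" and ind: "indep_rvs Q M Z" and Z: "std_complex_normal Q Z"
  shows "(\<integral>\<omega>. exp (\<i> * of_real (Re (cnj \<xi> * (of_real (sqrt (M \<omega>)) * Z \<omega>)))) \<partial>Q) =
    of_real (\<integral>\<omega>. exp (- ((cmod \<xi>)\<^sup>2 / 4 * \<bar>M \<omega>\<bar>)) \<partial>Q)"
proof -
  interpret prob_space Q by fact
  have [measurable]: "M \<in> borel_measurable Q" "Z \<in> borel_measurable Q"
    and iset: "indep_set (sets (vimage_algebra (space Q) M borel)) (sets (vimage_algebra (space Q) Z borel))"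
    using ind by (auto simp: indep_rvs_def)
  \<comment> \<open>M is embedded into the complex plane so that both variables have one type and
    \<open>indep_var\<close>, with its product law, applies.\<close>
  define X where "X \<omega> = complex_of_real (M \<omega>)" for \<omega>
  have [measurable]: "X \<in> borel_measurable Q" unfolding X_def by measurable
  have "indep_var borel X borel Z"
    unfolding indep_var_eq
  proof (intro conjI)
    have sub: "sigma_sets (space Q) {X -` A \<inter> space Q |A. A \<in> sets borel} \<subseteq> sets (vimage_algebra (space Q) M borel)"
    proof -
      have "{X -` A \<inter> space Q |A. A \<in> sets borel} \<subseteq> {M -` A \<inter> space Q |A. A \<in> sets borel}"
      proof safe
        fix A :: "complex set" assume A: "A \<in> sets borel"
        have "complex_of_real -` A \<in> sets borel" 
          by (rule measurable_sets_borel[OF _ A]) (intro borel_measurable_continuous_onI continuous_intros)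
        moreover have "X -` A \<inter> space Q = M -` (complex_of_real -` A) \<inter> space Q" by (auto simp: X_def)
        ultimately show "\<exists>A'. X -` A \<inter> space Q = M -` A' \<inter> space Q \<and> A' \<in> sets borel" by blast
      qed
      then show ?thesis unfolding sets_vimage_algebra by (rule sigma_sets_mono')
    qed
    show "indep_set (sigma_sets (space Q) {X -` A \<inter> space Q |A. A \<in> sets borel})
       (sigma_sets (space Q) {Z -` A \<inter> space Q |A. A \<in> sets borel})"
      using iset unfolding indep_set_def
      by (rule indep_sets_mono_sets) (use sub in \<open>auto split: bool.split simp: sets_vimage_algebra\<close>)
  qed measurable
  then have prod: "distr Q (borel \<Otimes>\<^sub>M borel) (\<lambda>\<omega>. (X \<omega>, Z \<omega>)) = distr Q borel X \<Otimes>\<^sub>M cgauss"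
    unfolding indep_var_distribution_eq std_complex_normal_distr[OF Q Z] by simp
  interpret D: prob_space "distr Q borel X" by (rule prob_space_distr) measurable
  interpret DC: pair_sigma_finite "distr Q borel X" cgauss ..
  let ?F = "\<lambda>m z. exp (\<i> * of_real (Re (cnj \<xi> * (of_real (sqrt (Re m)) * z))))"
  have Fm [measurable]: "(\<lambda>(m, z). ?F m z) \<in> borel_measurable (borel \<Otimes>\<^sub>M borel)"
    unfolding Re_complex_of_real by measurable
  interpret DCp: prob_space "distr Q borel X \<Otimes>\<^sub>M cgauss"
    unfolding prod[symmetric] by (rule prob_space_distr) measurable
  have Fint: "integrable (distr Q borel X \<Otimes>\<^sub>M cgauss) (\<lambda>(m, z). ?F m z)"
    by (rule DCp.integrable_const_bound[where B = 1]) (auto simp: norm_exp_eq_Re)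
  have "(\<integral>\<omega>. exp (\<i> * of_real (Re (cnj \<xi> * (of_real (sqrt (M \<omega>)) * Z \<omega>)))) \<partial>Q) =
     (\<integral>x. (case x of (m, z) \<Rightarrow> ?F m z) \<partial>distr Q (borel \<Otimes>\<^sub>M borel) (\<lambda>\<omega>. (X \<omega>, Z \<omega>)))"
    by (subst integral_distr) (auto simp: X_def)
  also have "\<dots> = (\<integral>m. (\<integral>z. ?F m z \<partial>cgauss) \<partial>distr Q borel X)"
    unfolding prod by (rule DC.integral_fst[OF Fint, symmetric])
  also have "\<dots> = (\<integral>m. of_real (exp (- ((cmod \<xi>)\<^sup>2 / 4 * \<bar>Re m\<bar>))) \<partial>distr Q borel X)"
  proof (rule Bochner_Integration.integral_cong[OF refl])
    fix m
    \<comment> \<open>The real \<open>sqrt\<close> is odd, so the square of its value is the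
      absolute value of the argument also for negative arguments.\<close>
    have sq: "(sqrt (Re m))\<^sup>2 = \<bar>Re m\<bar>"
      by (simp only: power2_eq_square real_sqrt_mult_self)
    have "(\<integral>z. ?F m z \<partial>cgauss) = (\<integral>z. exp (\<i> * of_real (Re (cnj (\<xi> * of_real (sqrt (Re m))) * z))) \<partial>cgauss)"
      by (simp add: mult_ac)
    also have "\<dots> = of_real (exp (- ((cmod \<xi>)\<^sup>2 / 4 * \<bar>Re m\<bar>)))"
      unfolding char_cgauss by (simp add: norm_mult power_mult_distrib sq)
    finally show "(\<integral>z. ?F m z \<partial>cgauss) = of_real (exp (- ((cmod \<xi>)\<^sup>2 / 4 * \<bar>Re m\<bar>)))" .
  qed
  also have "\<dots> = (\<integral>\<omega>. of_real (exp (- ((cmod \<xi>)\<^sup>2 / 4 * \<bar>M \<omega>\<bar>))) \<partial>Q)"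
    by (subst integral_distr) (auto simp: X_def)
  finally show ?thesis by simp
qed

section \<open>Passage to the limit\<close>

context secular_chaos
begin

lemma exp_neg_Lipschitz: "0 \<le> a \<Longrightarrow> 0 \<le> b \<Longrightarrow> \<bar>exp (- a) - exp (- b)\<bar> \<le> \<bar>a - b :: real\<bar>"
proof (induction a b rule: linorder_wlog)
  case (le a b)
  have "exp (- a) - exp (- b) = exp (- a) * (1 - exp (- (b - a)))" by (simp add: right_diff_distrib exp_add[symmetric])
  also have "\<dots> \<le> 1 * (b - a)"
  proof (rule mult_mono)
    show "1 - exp (- (b - a)) \<le> b - a" using exp_ge_add_one_self[of "- (b - a)"] by linarith
  qed (use le in auto)
  finally show ?case using le by simp
qed (simp add: abs_minus_commute)

text \<open>First m is fixed so that \<open>mass m\<close> is close to the total mass in L^1; then n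
  is taken large for this m, since the constant in the Stein error depends on m and cannot be
  controlled with both growing together.\<close>

lemma charfun_limit:
  assumes gmc: "is_GMC P N \<theta> GMC"
  shows "(\<lambda>n. \<integral>\<omega>. exp (\<i> * of_real (Re (cnj \<xi> * nc n \<omega>))) \<partial>P) \<longlonglongrightarrow>
    of_real (\<integral>\<omega>. exp (- ((cmod \<xi>)\<^sup>2 / 4 * GMC_mass GMC \<omega>)) \<partial>P)"
proof (rule LIMSEQ_I)
  fix e :: real assume e: "e > 0"
  let ?M = "GMC_mass GMC" and ?k = "(cmod \<xi>)\<^sup>2 / 4"
  let ?d = "\<lambda>n. \<integral>\<omega>. \<bar>mass n \<omega> - ?M \<omega>\<bar> \<partial>P"
  have M0: "?M \<omega> \<ge> 0" for \<omega> by (simp add: GMC_mass_def)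
  have intM: "integrable P ?M"
    by (rule GMC_mass_L1(1)[OF gmc, of "\<lambda>n. 1 - 1 / real (Suc n)"]) (simp, simp, real_asymp)
  then have [measurable]: "?M \<in> borel_measurable P" by simp
  have d: "?d \<longlonglongrightarrow> 0" by (rule mass_L1[OF gmc])
  \<comment> \<open>Two of the three units come from comparing \<open>mass m\<close> with
    \<open>mass n\<close> through the total mass, the third from replacing \<open>mass m\<close> by
    the total mass in the Laplace transform.\<close>
  have "(\<lambda>m. 3 * ?k * ?d m) \<longlonglongrightarrow> 3 * ?k * 0" by (intro tendsto_intros d)
  then have "\<forall>\<^sub>F m in sequentially. 3 * ?k * ?d m < e / 2"
    by (rule order_tendstoD(2)) (use e in simp)
  then have "\<forall>\<^sub>F m in sequentially. 3 * ?k * ?d m < e / 2 \<and> m \<ge> 1"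
    by (intro eventually_conj eventually_ge_at_top)
  then obtain m where m: "3 * ?k * ?d m < e / 2" "m \<ge> 1" by (auto simp: eventually_sequentially)
  let ?C = "cmod \<xi> * (?k * \<theta> * stein_const m)"
  have C: "?C \<ge> 0" using stein_const_nonneg theta_pos by (intro mult_nonneg_nonneg) auto
  have "(\<lambda>n. 2 * ?k * ?d n + ?C / sqrt (\<theta> * real n)) \<longlonglongrightarrow> 2 * ?k * 0 + 0"
  proof (intro tendsto_intros d)
    have "(\<lambda>n. C / sqrt (\<theta> * real n)) \<longlonglongrightarrow> 0" for C using theta_pos by real_asymp
    then show "(\<lambda>n. ?C / sqrt (\<theta> * real n)) \<longlonglongrightarrow> 0" .
  qed
  then have "\<forall>\<^sub>F n in sequentially. 2 * ?k * ?d n + ?C / sqrt (\<theta> * real n) < e / 2"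
    by (rule order_tendstoD(2)) (use e in simp)
  then have "\<forall>\<^sub>F n in sequentially. 2 * ?k * ?d n + ?C / sqrt (\<theta> * real n) < e / 2 \<and> n \<ge> 1"
    by (intro eventually_conj eventually_ge_at_top)
  then obtain n0 where n0: "\<And>n. n \<ge> n0 \<Longrightarrow> 2 * ?k * ?d n + ?C / sqrt (\<theta> * real n) < e / 2 \<and> n \<ge> 1"
    by (auto simp: eventually_sequentially)
  let ?L = "\<integral>\<omega>. exp (- (?k * ?M \<omega>)) \<partial>P" and ?L' = "\<integral>\<omega>. exp (- (?k * mass m \<omega>)) \<partial>P"
  have LL': "\<bar>?L' - ?L\<bar> \<le> ?k * ?d m"
  proof -
    have i1: "integrable P (\<lambda>\<omega>. exp (- (?k * ?M \<omega>)))"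
      using M0 by (intro integrable_const_bound[where B = 1]) auto
    have i2: "integrable P (\<lambda>\<omega>. exp (- (?k * mass m \<omega>)))"
      using mass_nonneg by (intro integrable_const_bound[where B = 1]) auto
    have "norm (?L' - ?L) = norm (\<integral>\<omega>. exp (- (?k * mass m \<omega>)) - exp (- (?k * ?M \<omega>)) \<partial>P)"
      using i1 i2 by simp
    also have "\<dots> \<le> (\<integral>\<omega>. ?k * \<bar>mass m \<omega> - ?M \<omega>\<bar> \<partial>P)"
    proof (rule norm_integral_le)
      show "norm (exp (- (?k * mass m \<omega>)) - exp (- (?k * ?M \<omega>))) \<le> ?k * \<bar>mass m \<omega> - ?M \<omega>\<bar>" for \<omega>
      proof -
        have "\<bar>exp (- (?k * mass m \<omega>)) - exp (- (?k * ?M \<omega>))\<bar> \<le> \<bar>?k * mass m \<omega> - ?k * ?M \<omega>\<bar>"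
          using M0 mass_nonneg by (intro exp_neg_Lipschitz mult_nonneg_nonneg) auto
        also have "\<dots> = ?k * \<bar>mass m \<omega> - ?M \<omega>\<bar>" unfolding right_diff_distrib[symmetric] abs_mult by simp
        finally show ?thesis by simp
      qed
    qed (use i1 i2 intM integrable_mass in auto)
    finally show ?thesis by simp
  qed
  show "\<exists>n0. \<forall>n\<ge>n0. norm ((\<integral>\<omega>. exp (\<i> * of_real (Re (cnj \<xi> * nc n \<omega>))) \<partial>P) - of_real ?L) < e"
  proof (intro exI[of _ n0] allI impI)
    fix n assume n: "n \<ge> n0"
    let ?\<phi> = "\<integral>\<omega>. exp (\<i> * of_real (Re (cnj \<xi> * nc n \<omega>))) \<partial>P"
    have n1: "n \<ge> 1" using n0[OF n] by simp
    \<comment> \<open>As \<theta> > 0, the lower bound \<theta> n^(\<theta>-1) for the weight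
      exceeds \<theta>/n, which makes the Stein error of order n^(-1/2).\<close>
    have "sqrt (\<theta> * real n) \<le> real n * sqrt (gbinom_wt \<theta> n)"
    proof -
      have "\<theta> / real n \<le> gbinom_wt \<theta> n"
      proof -
        have "\<theta> * real n powr (- 1) \<le> \<theta> * real n powr (\<theta> - 1)"
          using theta_pos n1 by (intro mult_left_mono powr_mono) auto
        also have "\<dots> \<le> gbinom_wt \<theta> n" by (rule gbinom_wt_ge[OF theta_pos theta_lt_1 n1])
        finally show ?thesis using n1 by (simp add: powr_minus_divide)
      qed
      then have "(real n)\<^sup>2 * (\<theta> / real n) \<le> (real n)\<^sup>2 * gbinom_wt \<theta> n" by (intro mult_left_mono) auto
      then have "\<theta> * real n \<le> (real n)\<^sup>2 * gbinom_wt \<theta> n" using n1 by (simp add: power2_eq_square field_simps)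
      then have "sqrt (\<theta> * real n) \<le> sqrt ((real n)\<^sup>2 * gbinom_wt \<theta> n)" by (rule real_sqrt_le_mono)
      then show ?thesis by (simp add: real_sqrt_mult)
    qed
    moreover have "sqrt (\<theta> * real n) > 0" using theta_pos n1 by simp
    ultimately have "?C / (real n * sqrt (gbinom_wt \<theta> n)) \<le> ?C / sqrt (\<theta> * real n)"
      using C n1 gbinom_wt_pos[OF theta_pos, of n] by (intro divide_left_mono mult_pos_pos) auto
    moreover have "(\<integral>\<omega>. \<bar>mass m \<omega> - mass n \<omega>\<bar> \<partial>P) \<le> ?d m + ?d n"
    proof -
      have "(\<integral>\<omega>. \<bar>mass m \<omega> - mass n \<omega>\<bar> \<partial>P) \<le> (\<integral>\<omega>. \<bar>mass m \<omega> - ?M \<omega>\<bar> + \<bar>mass n \<omega> - ?M \<omega>\<bar> \<partial>P)"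
        using integrable_mass intM by (intro integral_mono) auto
      also have "\<dots> = ?d m + ?d n" using integrable_mass intM by simp
      finally show ?thesis .
    qed
    then have "2 * ?k * (\<integral>\<omega>. \<bar>mass m \<omega> - mass n \<omega>\<bar> \<partial>P) \<le> 2 * ?k * (?d m + ?d n)" by (intro mult_left_mono) auto
    moreover have "cmod (?\<phi> - of_real ?L') \<le> 2 * ?k * (\<integral>\<omega>. \<bar>mass m \<omega> - mass n \<omega>\<bar> \<partial>P) + ?C / (real n * sqrt (gbinom_wt \<theta> n))"
      using charfun_stein[OF m(2) n1, of \<xi>] by simp
    moreover have "cmod (of_real ?L' - of_real ?L) \<le> ?k * ?d m" using LL' by (simp only: of_real_diff[symmetric] norm_of_real)
    moreover have "cmod (?\<phi> - of_real ?L) \<le> cmod (?\<phi> - of_real ?L') + cmod (of_real ?L' - of_real ?L)"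
      using norm_triangle_ineq[of "?\<phi> - of_real ?L'" "of_real ?L' - of_real ?L"] by simp
    moreover have "2 * ?k * (?d m + ?d n) = 2 * ?k * ?d m + 2 * ?k * ?d n" by (simp only: distrib_left)
    ultimately show "cmod (?\<phi> - of_real ?L) < e" using n0[OF n] m(1) by linarith
  qed
qed

end

theorem theorem1p8:
  fixes P :: "'a measure" and N :: "nat \<Rightarrow> 'a \<Rightarrow> complex" and \<theta> :: real
    and GMC :: "'a \<Rightarrow> real measure"
    and Q :: "'b measure" and M :: "'b \<Rightarrow> real" and Z :: "'b \<Rightarrow> complex"
  assumes "prob_space P"
    and "iid_std_complex_normal P N"
    and "0 < \<theta>" and "\<theta> < 1 / 2"
    and "is_GMC P N \<theta> GMC"
    and "prob_space Q"
    and "indep_rvs Q M Z"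
    and "std_complex_normal Q Z"
    and "distr Q borel M = distr P borel (GMC_mass GMC)"
  shows "converges_in_distribution P
           (\<lambda>n \<omega>. secular_coeff N \<theta> n \<omega> /
              complex_of_real (sqrt (prob_space.expectation P (\<lambda>\<omega>'. (cmod (secular_coeff N \<theta> n \<omega>'))\<^sup>2))))
           Q (\<lambda>\<omega>. complex_of_real (sqrt (M \<omega>)) * Z \<omega>)"
proof -
  interpret prob_space P by fact
  interpret secular_chaos P N \<theta> by unfold_locales (use assms in auto)
  have [measurable]: "M \<in> borel_measurable Q" "Z \<in> borel_measurable Q"
    using assms(7) by (auto simp: indep_rvs_def)
  have Y: "(\<lambda>\<omega>. complex_of_real (sqrt (M \<omega>)) * Z \<omega>) \<in> borel_measurable Q" by measurable
  have massm: "GMC_mass GMC \<in> borel_measurable P"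
    by (rule GMC_mass_conv(2)[OF assms(5), of "\<lambda>n. 1 - 1 / real (Suc n)" 1]) (simp, simp, real_asymp, simp)
  have law: "(\<integral>\<omega>. exp (\<i> * of_real (Re (cnj \<xi> * (of_real (sqrt (M \<omega>)) * Z \<omega>)))) \<partial>Q) =
     of_real (\<integral>\<omega>. exp (- ((cmod \<xi>)\<^sup>2 / 4 * GMC_mass GMC \<omega>)) \<partial>P)" for \<xi>
  \<comment> \<open>Only the law of M enters, so the integral moves to the space of the chaos; there
    the total mass is nonnegative and the absolute value disappears.\<close>
  proof -
    have "(\<integral>\<omega>. exp (- ((cmod \<xi>)\<^sup>2 / 4 * \<bar>M \<omega>\<bar>)) \<partial>Q) = (\<integral>x. exp (- ((cmod \<xi>)\<^sup>2 / 4 * \<bar>x\<bar>)) \<partial>distr Q borel M)"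
      by (subst integral_distr) auto
    also have "\<dots> = (\<integral>\<omega>. exp (- ((cmod \<xi>)\<^sup>2 / 4 * \<bar>GMC_mass GMC \<omega>\<bar>)) \<partial>P)"
      unfolding assms(9) using massm by (subst integral_distr) auto
    finally show ?thesis unfolding indep_rvs_char[OF assms(6-8)] by (simp add: GMC_mass_def)
  qed
  have conv: "(\<lambda>n. \<integral>\<omega>. f (nc n \<omega>) \<partial>P) \<longlonglongrightarrow> (\<integral>\<omega>. f (complex_of_real (sqrt (M \<omega>)) * Z \<omega>) \<partial>Q)"
    if f: "continuous_on UNIV f" "bounded (range f)" for f :: "complex \<Rightarrow> real"
    by (rule Levy_complex[OF prob_space_axioms nc_measurable assms(6) Y integrable_nc_sq _ _ f])
       (use charfun_limit[OF assms(5)] in \<open>simp_all only: nc_sq law order_refl\<close>)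
  show ?thesis unfolding converges_in_distribution_def expectation_secular_coeff
  proof (intro conjI allI impI)
    show "(\<lambda>\<omega>. secular_coeff N \<theta> n \<omega> / of_real (sqrt (gbinom_wt \<theta> n))) \<in> borel_measurable P" for n
      by measurable
    fix f :: "complex \<Rightarrow> real" assume f: "continuous_on UNIV f" "bounded (range f)"
    have [measurable]: "f \<in> borel_measurable borel" using f(1) by (rule borel_measurable_continuous_onI)
    \<comment> \<open>The coefficients agree with the polynomials \<open>c n\<close> off a null set,
      which leaves these integrals unchanged.\<close>
    have "(\<integral>\<omega>. f (secular_coeff N \<theta> n \<omega> / of_real (sqrt (gbinom_wt \<theta> n))) \<partial>P) = (\<integral>\<omega>. f (nc n \<omega>) \<partial>P)" for n
    proof (rule integral_cong_AE)
      show "AE \<omega> in P. f (secular_coeff N \<theta> n \<omega> / of_real (sqrt (gbinom_wt \<theta> n))) = f (nc n \<omega>)"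
        using AE_secular_coeff by eventually_elim (simp add: nc_def)
    qed measurable
    then show "(\<lambda>n. \<integral>\<omega>. f (secular_coeff N \<theta> n \<omega> / of_real (sqrt (gbinom_wt \<theta> n))) \<partial>P) \<longlonglongrightarrow>
        (\<integral>\<omega>. f (complex_of_real (sqrt (M \<omega>)) * Z \<omega>) \<partial>Q)"
      using conv[OF f] by simp
  qed (rule Y)
qed

end
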